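(* There is a polynomial $p$ such that the following holds. Let $n,k,d$ be positive integers with $k\le n$ and $d\le n$, let $\sigma>0$, let $\mu_1,\ldots,\mu_n\in[0,1]^d$ be arbitrary, and let $\mathcal{X}=\{x_1,\ldots,x_n\}\subseteq\mathbb{R}^d$, where $x_i=\mu_i+g_i$ and $g_1,\ldots,g_n$ are independent $d$-dimensional Gaussian random vectors with mean $0$ whose coordinates are independent with standard deviation $\sigma$. Then for every choice of initial centers, the expected number of iterations of the $k$-means method on $\mathcal{X}$ is at most $k^{kd}\cdot p(n,1/\sigma)$.
   Context: The $k$-means method on a finite point set $\mathcal{X}\subseteq\mathbb{R}^d$ with $k$ clusters: (1) select initial cluster centers $c_1,\ldots,c_k\in\mathbb{R}^d$; (2) assign every $x\in\mathcal{X}$ to the cluster $C_i$ whose center $c_i$ is closest to $x$; (3) set $c_i=\frac{1}{|C_i|}\sum_{x\in C_i}x$ for every $i$; (4) if the clusters or the centers have changed, go to (2), otherwise terminate. An iteration is one execution of steps (2)–(3); the running time is the number of iterations. The paper's standing assumptions are $k\le n$ and $d\le n$. *)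

theory Defs
  imports "HOL-Probability.Probability"
begin

text \<open>Points of R^d are represented as functions nat => real, of which only the
coordinates l < d are relevant. A point set with n points is a function
nat => (nat => real), of which only the points j < n are relevant.
k centers are a function nat => (nat => real) with relevant indices i < k.\<close>

type_synonym vec = "nat \<Rightarrow> real"

definition sqdist :: "nat \<Rightarrow> vec \<Rightarrow> vec \<Rightarrow> real" where
  "sqdist d x y = (\<Sum>l<d. (x l - y l)^2)"

definition closest :: "nat \<Rightarrow> nat \<Rightarrow> (nat \<Rightarrow> vec) \<Rightarrow> vec \<Rightarrow> nat" where
  "closest d k c x = (LEAST i. i < k \<and> (\<forall>i'<k. sqdist d x (c i) \<le> sqdist d x (c i')))"

definition assign :: "nat \<Rightarrow> nat \<Rightarrow> (nat \<Rightarrow> vec) \<Rightarrow> (nat \<Rightarrow> vec) \<Rightarrow> (nat \<Rightarrow> nat)" where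
  "assign d k c X = (\<lambda>j. closest d k c (X j))"

definition update :: "nat \<Rightarrow> (nat \<Rightarrow> vec) \<Rightarrow> (nat \<Rightarrow> nat) \<Rightarrow> (nat \<Rightarrow> vec) \<Rightarrow> (nat \<Rightarrow> vec)" where
  "update n X a c = (\<lambda>i. if \<exists>j<n. a j = i
      then (\<lambda>l. (\<Sum>j\<in>{j. j < n \<and> a j = i}. X j l) / real (card {j. j < n \<and> a j = i}))
      else c i)"

fun kmeans_state :: "nat \<Rightarrow> nat \<Rightarrow> nat \<Rightarrow> (nat \<Rightarrow> vec) \<Rightarrow> (nat \<Rightarrow> vec) \<Rightarrow> nat
    \<Rightarrow> (nat \<Rightarrow> vec) \<times> (nat \<Rightarrow> nat)" where
  "kmeans_state d n k X c0 0 = (c0, undefined)"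
| "kmeans_state d n k X c0 (Suc t) =
     (let c = fst (kmeans_state d n k X c0 t); a = assign d k c X in (update n X a c, a))"

text \<open>Step (4): after iteration t the method terminates iff neither the centers nor
the clusters changed (in the first iteration there are no previous clusters).\<close>
definition kmeans_stops :: "nat \<Rightarrow> nat \<Rightarrow> nat \<Rightarrow> (nat \<Rightarrow> vec) \<Rightarrow> (nat \<Rightarrow> vec) \<Rightarrow> nat \<Rightarrow> bool" where
  "kmeans_stops d n k X c0 t \<longleftrightarrow>
     (\<forall>i<k. \<forall>l<d. fst (kmeans_state d n k X c0 t) i l = fst (kmeans_state d n k X c0 (t - 1)) i l) \<and>
     (t \<ge> 2 \<longrightarrow> (\<forall>j<n. snd (kmeans_state d n k X c0 t) j = snd (kmeans_state d n k X c0 (t - 1)) j))"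

definition kmeans_iterations :: "nat \<Rightarrow> nat \<Rightarrow> nat \<Rightarrow> (nat \<Rightarrow> vec) \<Rightarrow> (nat \<Rightarrow> vec) \<Rightarrow> enat" where
  "kmeans_iterations d n k X c0 =
     (if \<exists>t\<ge>1. kmeans_stops d n k X c0 t
      then enat (LEAST t. t \<ge> 1 \<and> kmeans_stops d n k X c0 t) else \<infinity>)"

definition perturbed_points :: "nat \<Rightarrow> nat \<Rightarrow> real \<Rightarrow> (nat \<Rightarrow> vec) \<Rightarrow> (nat \<Rightarrow> vec) measure" where
  "perturbed_points n d \<sigma> \<mu> =
     PiM {..<n} (\<lambda>j. PiM {..<d} (\<lambda>l. density lborel (normal_density (\<mu> j l) \<sigma>)))"

end

theory Submission
  imports Defs
begin

text \<open>
Let a window consist of \<open>m = k ^ b * 2 ^ k\<close> consecutive iterations with \<open>b\<close> about \<open>k / 8\<close>. The potential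
(the sum of squared distances to the assigned centers) strictly decreases, so a window that is not cut
short by termination runs through more than \<open>m\<close> pairwise distinct clusterings; if the potential drops by
only \<open>\<epsilon>\<close> in it, every center moves by at most \<open>\<rho> = m * sqrt \<epsilon>\<close>. Two cases show that this is unlikely.

If fewer than \<open>22 * d * k\<close> points change their cluster, pigeonhole over the assignments of already chosen
pivot points yields, again and again, a cluster with three distinct point sets that agree on all pivots.
Their means nearly coincide, and eliminating the mean gives an integer linear relation among the
moved points that nearly holds, vanishes on the old pivots and has a new pivot. The resulting
\<open>b\<close> relations form a triangular system, which a Gaussian satisfies with probability of order \<open>\<rho> ^ (b * d)\<close>;
this beats the number of choices of points and relations.

If at least \<open>22 * d * k\<close> points move, few of them move into clusters with at most \<open>4 * d + 3\<close> points, as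
otherwise three small point sets have nearly equal means. A point moving into a larger cluster lies
close to the bisector of two centers, and these are well separated, as otherwise the whole target
cluster lies close to a hyperplane. Rounding the centers to a grid, \<open>6 * d * k\<close> points close to bisectors of
\<open>k\<close> centers with \<open>d * k\<close> coordinates are unlikely.

Hence \<open>\<epsilon>\<close> can be chosen as an inverse polynomial up to factors \<open>2 ^ O(k)\<close> and \<open>k ^ (k / 4)\<close>, and these are
absorbed by \<open>k ^ (k * d)\<close>. The failure probability is linear in \<open>\<epsilon>\<close> and there are at most \<open>k ^ n + 1\<close> iterations, so
summing over dyadic \<open>\<epsilon>\<close> costs only a polynomial factor.
\<close>

section \<open>Triangular systems of Gaussian slabs\<close>

text \<open>What matters is the exponent with which an event is rare. A window spends m iterations
  on each \<epsilon> of potential, so the expectation weighs 1/\<epsilon> against probabilities; as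
  \<rho> is m * sqrt \<epsilon>, every event needs probability of order \<rho>^2, even for d = k =
  1. Rounding costs about 1/\<delta> choices per hyperplane parameter and 1/\<rho> per center
  coordinate. It is paid for by four points, each with a factor \<delta>, and by six points, each
  with a factor \<rho>/\<delta>. Balancing makes \<delta> the geometric mean of \<rho> and \<sigma>;
  four points for each of d + 1 parameters explain the threshold 4 * d + 3. Small sets with nearly
  equal means must give two relations to reach the exponent 2 in dimension one, hence three sets.

  The length m enters the final bound as m^3: once as the length of a window, twice through
  \<rho>^2. So b has to stay below about k/3. It has to be proportional to k, because the n^(22 * d
  * k) choices of the moved points are to be outweighed by b * d factors \<rho> at a cost that is
  polynomial in n.\<close>

definition aff :: "nat \<Rightarrow> nat \<Rightarrow> (nat \<Rightarrow> nat \<Rightarrow> real) \<Rightarrow> real \<Rightarrow> (nat \<Rightarrow> vec) \<Rightarrow> real" where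
  "aff n d w z X = (\<Sum>j<n. \<Sum>l<d. w j l * X j l) - z"

lemma prob_space_normal: "0 < \<sigma> \<Longrightarrow> prob_space (density lborel (normal_density m \<sigma>))"
  by (rule prob_space_normal_density)

lemma normal_density_le_inverse:
  assumes "0 < \<sigma>" shows "normal_density m \<sigma> x \<le> 1 / \<sigma>"
proof -
  have "1 * \<sigma> \<le> sqrt (2 * pi * \<sigma>\<^sup>2)"
  proof (rule real_le_rsqrt)
    have "1 * \<sigma>\<^sup>2 \<le> (2 * pi) * \<sigma>\<^sup>2" using pi_gt3 by (intro mult_right_mono) auto
    then show "(1 * \<sigma>)\<^sup>2 \<le> 2 * pi * \<sigma>\<^sup>2" by simp
  qed
  then have "1 / sqrt (2 * pi * \<sigma>\<^sup>2) \<le> 1 / \<sigma>" using assms by (intro divide_left_mono) auto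
  moreover have "exp (- (x - m)\<^sup>2 / (2 * \<sigma>\<^sup>2)) \<le> 1" by (simp add: divide_nonneg_nonneg)
  ultimately have "(1 / sqrt (2 * pi * \<sigma>\<^sup>2)) * exp (- (x - m)\<^sup>2 / (2 * \<sigma>\<^sup>2)) \<le> (1/\<sigma>) * 1"
    using assms by (intro mult_mono) auto
  then show ?thesis by (simp add: normal_density_def)
qed

text \<open>The slab lies in an interval of length \<open>2 * \<eta>\<close>, as the slope is at
  least 1, and the density is at most \<open>1 / \<sigma>\<close>.\<close>

lemma normal_slab:
  assumes \<sigma>: "0 < \<sigma>" and a: "1 \<le> \<bar>a\<bar>" and \<eta>: "0 \<le> \<eta>"
  shows "emeasure (density lborel (normal_density m \<sigma>)) {y. \<bar>a * y + c\<bar> \<le> \<eta>} \<le> ennreal (2 * \<eta> / \<sigma>)"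
proof -
  let ?I = "{-c/a - \<eta> .. -c/a + \<eta>}"
  have sub: "{y. \<bar>a * y + c\<bar> \<le> \<eta>} \<subseteq> ?I"
  proof
    fix y assume "y \<in> {y. \<bar>a * y + c\<bar> \<le> \<eta>}"
    then have y: "\<bar>a * y + c\<bar> \<le> \<eta>" by simp
    have "y + c/a = (a * y + c) / a" using a by (auto simp: add_divide_distrib)
    then have "\<bar>y + c/a\<bar> = \<bar>a * y + c\<bar> / \<bar>a\<bar>" by simp
    also have "\<dots> \<le> \<bar>a * y + c\<bar> / 1" using a by (intro divide_left_mono) auto
    finally have "\<bar>y + c/a\<bar> \<le> \<eta>" using y by simp
    then show "y \<in> ?I" by auto
  qed
  have "emeasure (density lborel (normal_density m \<sigma>)) {y. \<bar>a * y + c\<bar> \<le> \<eta>}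
      \<le> emeasure (density lborel (normal_density m \<sigma>)) ?I"
    by (rule emeasure_mono[OF sub]) simp
  also have "\<dots> = (\<integral>\<^sup>+x. ennreal (normal_density m \<sigma> x) * indicator ?I x \<partial>lborel)"
    by (rule emeasure_density) auto
  also have "\<dots> \<le> (\<integral>\<^sup>+x. ennreal (1/\<sigma>) * indicator ?I x \<partial>lborel)"
    by (intro nn_integral_mono mult_right_mono ennreal_leI normal_density_le_inverse \<sigma>) auto
  also have "\<dots> = ennreal (1/\<sigma>) * emeasure lborel ?I"
    by (rule nn_integral_cmult_indicator) simp
  also have "\<dots> = ennreal (2 * \<eta> / \<sigma>)"
    using \<eta> \<sigma> by (simp add: ennreal_mult[symmetric])
  finally show ?thesis .
qed

lemma prob_space_perturbed_points:
  assumes "0 < \<sigma>" shows "prob_space (perturbed_points n d \<sigma> \<mu>)"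
proof -
  interpret N: prob_space "density lborel (normal_density m \<sigma>)" for m
    by (rule prob_space_normal[OF assms])
  have "prob_space (PiM {..<d} (\<lambda>l. density lborel (normal_density (\<mu> j l) \<sigma>)))" for j
    by (rule prob_space_PiM) unfold_locales
  then show ?thesis unfolding perturbed_points_def by (rule prob_space_PiM)
qed

lemma measurable_coordinate [measurable]:
  assumes "j < n" "l < d"
  shows "(\<lambda>X. X j l) \<in> borel_measurable (perturbed_points n d \<sigma> \<mu>)"
proof -
  have "(\<lambda>X. X j) \<in> measurable (perturbed_points n d \<sigma> \<mu>)
      (PiM {..<d} (\<lambda>l. density lborel (normal_density (\<mu> j l) \<sigma>)))"
    unfolding perturbed_points_def using assms by (intro measurable_component_singleton) simp
  moreover have "(\<lambda>x. x l) \<in> measurable (PiM {..<d} (\<lambda>l. density lborel (normal_density (\<mu> j l) \<sigma>)))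
      (density lborel (normal_density (\<mu> j l) \<sigma>))"
    using assms by (intro measurable_component_singleton) simp
  ultimately have "(\<lambda>X. X j l) \<in> measurable (perturbed_points n d \<sigma> \<mu>) (density lborel (normal_density (\<mu> j l) \<sigma>))"
    by (rule measurable_compose)
  then show ?thesis by simp
qed

lemma measurable_aff [measurable]:
  "aff n d w z \<in> borel_measurable (perturbed_points n d \<sigma> \<mu>)"
  unfolding aff_def by measurable

text \<open>Fubini with the coordinate \<open>(j, l)\<close> innermost: there \<open>g\<close> is
  constant and the form is \<open>w j l * y\<close> plus a constant, so \<open>normal_slab\<close>
  bounds the inner integral uniformly in all other coordinates.\<close>

lemma nn_integral_slab_mult:
  fixes j l n d :: nat and w :: "nat \<Rightarrow> nat \<Rightarrow> real"
  assumes \<sigma>: "0 < \<sigma>" and \<eta>: "0 \<le> \<eta>" and j: "j < n" and l: "l < d" and w: "1 \<le> \<bar>w j l\<bar>"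
    and g[measurable]: "g \<in> borel_measurable (perturbed_points n d \<sigma> \<mu>)"
    and gc: "\<And>X y. g (X(j := (X j)(l := y))) = g X"
  shows "(\<integral>\<^sup>+X. indicator {X. \<bar>aff n d w z X\<bar> \<le> \<eta>} X * g X \<partial>perturbed_points n d \<sigma> \<mu>)
    \<le> ennreal (2 * \<eta> / \<sigma>) * (\<integral>\<^sup>+X. g X \<partial>perturbed_points n d \<sigma> \<mu>)"
proof -
  let ?N = "\<lambda>j l. density lborel (normal_density (\<mu> j l) \<sigma>)"
  let ?P = "\<lambda>j. PiM {..<d} (?N j)"
  interpret N: prob_space "density lborel (normal_density m \<sigma>)" for m
    by (rule prob_space_normal[OF \<sigma>])
  interpret P: prob_space "?P i" for i by (rule prob_space_PiM) unfold_locales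
  interpret inner: product_sigma_finite "?N i" for i by standard
  interpret outer: product_sigma_finite ?P by standard
  have n: "{..<n} = insert j ({..<n} - {j})" using j by blast
  have d: "{..<d} = insert l ({..<d} - {l})" using l by blast
  \<comment> \<open>The measure is a product of products, so the coordinate is split off in two
    stages: the point \<open>j\<close> among the points, then \<open>l\<close> among its
    coordinates.\<close>
  have split: "(\<integral>\<^sup>+X. F X \<partial>perturbed_points n d \<sigma> \<mu>) =
     (\<integral>\<^sup>+X. (\<integral>\<^sup>+x. (\<integral>\<^sup>+y. F (X(j := x(l := y))) \<partial>?N j l) \<partial>PiM ({..<d} - {l}) (?N j)) \<partial>PiM ({..<n} - {j}) ?P)"
    if F[measurable]: "F \<in> borel_measurable (perturbed_points n d \<sigma> \<mu>)" for F
  proof -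
    have F': "F \<in> borel_measurable (PiM (insert j ({..<n} - {j})) ?P)"
      using F unfolding perturbed_points_def n[symmetric] .
    have "(\<integral>\<^sup>+X. F X \<partial>perturbed_points n d \<sigma> \<mu>)
      = (\<integral>\<^sup>+X. (\<integral>\<^sup>+x. F (X(j := x)) \<partial>?P j) \<partial>PiM ({..<n} - {j}) ?P)"
      unfolding perturbed_points_def
      by (subst n, rule outer.product_nn_integral_insert) (use F' in auto)
    also have "\<dots> = (\<integral>\<^sup>+X. (\<integral>\<^sup>+x. (\<integral>\<^sup>+y. F (X(j := x(l := y))) \<partial>?N j l) \<partial>PiM ({..<d} - {l}) (?N j)) \<partial>PiM ({..<n} - {j}) ?P)"
    proof (rule nn_integral_cong)
      fix X assume X: "X \<in> space (PiM ({..<n} - {j}) ?P)"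
      have m1: "(\<lambda>x. X(j := x)) \<in> measurable (?P j) (PiM (insert j ({..<n} - {j})) ?P)"
        using X by (intro measurable_fun_upd[where J="{..<n}-{j}"]) auto
      have "(\<lambda>x. F (X(j := x))) \<in> borel_measurable (?P j)"
        by (rule measurable_compose[OF m1 F'])
      then have m2: "(\<lambda>x. F (X(j := x))) \<in> borel_measurable (PiM (insert l ({..<d} - {l})) (?N j))"
        unfolding d[symmetric] .
      show "(\<integral>\<^sup>+x. F (X(j := x)) \<partial>?P j) = (\<integral>\<^sup>+x. (\<integral>\<^sup>+y. F (X(j := x(l := y))) \<partial>?N j l) \<partial>PiM ({..<d} - {l}) (?N j))"
        by (subst d, rule inner.product_nn_integral_insert) (use m2 in auto)
    qed
    finally show ?thesis .
  qed
  have mI[measurable]: "(\<lambda>X. indicator {X. \<bar>aff n d w z X\<bar> \<le> \<eta>} X * g X) \<in> borel_measurable (perturbed_points n d \<sigma> \<mu>)"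
    by (rule borel_measurable_times_ennreal[OF borel_measurable_indicator' g]) measurable
  have s1: "(\<integral>\<^sup>+X. indicator {X. \<bar>aff n d w z X\<bar> \<le> \<eta>} X * g X \<partial>perturbed_points n d \<sigma> \<mu>) =
    (\<integral>\<^sup>+X. (\<integral>\<^sup>+x. (\<integral>\<^sup>+y. indicator {X. \<bar>aff n d w z X\<bar> \<le> \<eta>} (X(j := x(l := y))) * g (X(j := x(l := y)))
       \<partial>?N j l) \<partial>PiM ({..<d} - {l}) (?N j)) \<partial>PiM ({..<n} - {j}) ?P)"
    by (rule split[OF mI])
  have s2: "(\<integral>\<^sup>+X. (\<integral>\<^sup>+x. (\<integral>\<^sup>+y. indicator {X. \<bar>aff n d w z X\<bar> \<le> \<eta>} (X(j := x(l := y))) * g (X(j := x(l := y)))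
       \<partial>?N j l) \<partial>PiM ({..<d} - {l}) (?N j)) \<partial>PiM ({..<n} - {j}) ?P) \<le> (\<integral>\<^sup>+X. (\<integral>\<^sup>+x. (\<integral>\<^sup>+y. ennreal (2 * \<eta> / \<sigma>) * g (X(j := x(l := y)))
       \<partial>?N j l) \<partial>PiM ({..<d} - {l}) (?N j)) \<partial>PiM ({..<n} - {j}) ?P)"
  proof (rule nn_integral_mono, rule nn_integral_mono)
    fix X :: "nat \<Rightarrow> vec" and x :: vec
    define c where "c = aff n d w z (X(j := x(l := 0)))"
    have aff: "aff n d w z (X(j := x(l := y))) = w j l * y + c" for y
    proof -
      have "(\<Sum>j'<n. \<Sum>l'<d. w j' l' * (X(j := x(l := y))) j' l') =
        (\<Sum>j'<n. \<Sum>l'<d. w j' l' * (X(j := x(l := 0))) j' l' + (if j' = j then (if l' = l then w j l * y else 0) else 0))"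
        by (intro sum.cong) auto
      also have "\<dots> = (\<Sum>j'<n. \<Sum>l'<d. w j' l' * (X(j := x(l := 0))) j' l') +
          (\<Sum>j'<n. \<Sum>l'<d. (if j' = j then (if l' = l then w j l * y else 0) else 0))"
        by (simp only: sum.distrib)
      also have "(\<Sum>j'<n. \<Sum>l'<d. (if j' = j then (if l' = l then w j l * y else 0) else 0)) =
          (\<Sum>j'<n. if j' = j then w j l * y else 0)" using l by (intro sum.cong) auto
      also have "\<dots> = w j l * y" using j by simp
      finally show ?thesis unfolding aff_def c_def by linarith
    qed
    have g0: "g (X(j := x(l := y))) = g (X(j := x))" for y
      using gc[of "X(j := x)" y] by simp
    have "(\<integral>\<^sup>+y. indicator {X. \<bar>aff n d w z X\<bar> \<le> \<eta>} (X(j := x(l := y))) * g (X(j := x(l := y))) \<partial>?N j l)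
      = (\<integral>\<^sup>+y. g (X(j := x)) * indicator {y. \<bar>w j l * y + c\<bar> \<le> \<eta>} y \<partial>?N j l)"
      unfolding g0 by (intro nn_integral_cong) (simp add: indicator_def aff)
    also have "\<dots> = g (X(j := x)) * emeasure (?N j l) {y. \<bar>w j l * y + c\<bar> \<le> \<eta>}"
      by (rule nn_integral_cmult_indicator) simp
    also have "\<dots> \<le> g (X(j := x)) * ennreal (2 * \<eta> / \<sigma>)"
      by (intro mult_left_mono normal_slab \<sigma> w \<eta>) auto
    also have "\<dots> = (\<integral>\<^sup>+y. ennreal (2 * \<eta> / \<sigma>) * g (X(j := x(l := y))) \<partial>?N j l)"
      unfolding g0 using N.emeasure_space_1 by (simp add: mult.commute)
    finally show "(\<integral>\<^sup>+y. indicator {X. \<bar>aff n d w z X\<bar> \<le> \<eta>} (X(j := x(l := y))) * g (X(j := x(l := y))) \<partial>?N j l)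
       \<le> (\<integral>\<^sup>+y. ennreal (2 * \<eta> / \<sigma>) * g (X(j := x(l := y))) \<partial>?N j l)" .
  qed
  have gm: "(\<lambda>X. ennreal (2 * \<eta> / \<sigma>) * g X) \<in> borel_measurable (perturbed_points n d \<sigma> \<mu>)"
    using g by (rule borel_measurable_times_ennreal[OF borel_measurable_const])
  show ?thesis
    using s1 s2 split[OF gm] nn_integral_cmult[OF g, of "ennreal (2 * \<eta> / \<sigma>)"] by (simp only:)
qed

text \<open>Induction that adds the forms by increasing rank. The forms already present do not
  involve the pivot coordinate of the new one, so their joint indicator can serve as
  \<open>g\<close> in \<open>nn_integral_slab_mult\<close>, and each form contributes a factor
  \<open>2 * \<eta> / \<sigma>\<close>.\<close>

lemma emeasure_triangular_system:
  fixes rank :: "'i \<Rightarrow> nat"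
  assumes \<sigma>: "0 < \<sigma>" and \<eta>: "0 \<le> \<eta>" and fin: "finite I"
    and piv: "\<And>i. i \<in> I \<Longrightarrow> J i < n \<and> K i < d \<and> 1 \<le> \<bar>w i (J i) (K i)\<bar>"
    and tri: "\<And>i i'. i \<in> I \<Longrightarrow> i' \<in> I \<Longrightarrow> i \<noteq> i' \<Longrightarrow> rank i \<le> rank i' \<Longrightarrow> w i (J i') (K i') = 0"
  shows "emeasure (perturbed_points n d \<sigma> \<mu>)
     {X \<in> space (perturbed_points n d \<sigma> \<mu>). \<forall>i\<in>I. \<bar>aff n d (w i) (z i) X\<bar> \<le> \<eta>} \<le> ennreal ((2 * \<eta> / \<sigma>) ^ card I)"
  using fin piv tri
proof (induction I rule: finite_ranking_induct[where f=rank])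
  case empty
  interpret prob_space "perturbed_points n d \<sigma> \<mu>" by (rule prob_space_perturbed_points[OF \<sigma>])
  show ?case using emeasure_space_1 by simp
next
  case (insert i I)
  let ?M = "perturbed_points n d \<sigma> \<mu>"
  show ?case
  proof (cases "i \<in> I")
    case True
    then show ?thesis using insert.IH insert.prems by (simp add: insert_absorb)
  next
    case False
    let ?A = "{X \<in> space ?M. \<forall>i\<in>I. \<bar>aff n d (w i) (z i) X\<bar> \<le> \<eta>}"
    let ?G = "{X. \<forall>i\<in>I. \<bar>aff n d (w i) (z i) X\<bar> \<le> \<eta>}"
    have Am: "?A \<in> sets ?M" using insert.hyps(1) by measurable
    have Bm: "{X \<in> space ?M. \<forall>i\<in>insert i I. \<bar>aff n d (w i) (z i) X\<bar> \<le> \<eta>} \<in> sets ?M"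
      using finite.insertI[OF insert.hyps(1), of i] by measurable
    have gm: "(indicator ?G :: _ \<Rightarrow> ennreal) \<in> borel_measurable ?M"
      using insert.hyps(1) by measurable
    have "emeasure ?M {X \<in> space ?M. \<forall>i\<in>insert i I. \<bar>aff n d (w i) (z i) X\<bar> \<le> \<eta>}
      = (\<integral>\<^sup>+X. indicator {X \<in> space ?M. \<forall>i\<in>insert i I. \<bar>aff n d (w i) (z i) X\<bar> \<le> \<eta>} X \<partial>?M)"
      using Bm by simp
    also have "\<dots> = (\<integral>\<^sup>+X. indicator {X. \<bar>aff n d (w i) (z i) X\<bar> \<le> \<eta>} X * indicator ?G X \<partial>?M)"
      by (intro nn_integral_cong) (auto simp: indicator_def)
    also have "\<dots> \<le> ennreal (2 * \<eta> / \<sigma>) * (\<integral>\<^sup>+X. indicator ?G X \<partial>?M)"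
    proof (rule nn_integral_slab_mult[OF \<sigma> \<eta> _ _ _ gm])
      show "J i < n" "K i < d" "1 \<le> \<bar>w i (J i) (K i)\<bar>" using insert.prems(1)[of i] by auto
      fix X :: "nat \<Rightarrow> vec" and y
      have "aff n d (w i') (z i') (X(J i := (X (J i))(K i := y))) = aff n d (w i') (z i') X" if "i' \<in> I" for i'
      proof -
        have "w i' (J i) (K i) = 0" using that False insert.hyps(2) by (intro insert.prems(2)) auto
        then show ?thesis unfolding aff_def by (intro arg_cong2[where f="(-)"] sum.cong refl) auto
      qed
      then show "(indicator ?G (X(J i := (X (J i))(K i := y))) :: ennreal) = indicator ?G X"
        by (auto simp: indicator_def)
    qed
    also have "(\<integral>\<^sup>+X. indicator ?G X \<partial>?M) = (\<integral>\<^sup>+X. indicator ?A X \<partial>?M)"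
      by (intro nn_integral_cong) (auto simp: indicator_def)
    also have "\<dots> = emeasure ?M ?A" using Am by simp
    also have "ennreal (2 * \<eta> / \<sigma>) * emeasure ?M ?A \<le> ennreal (2 * \<eta> / \<sigma>) * ennreal ((2 * \<eta> / \<sigma>) ^ card I)"
      using insert.prems by (intro mult_left_mono insert.IH) auto
    also have "\<dots> = ennreal ((2 * \<eta> / \<sigma>) ^ card (insert i I))"
      using False insert.hyps(1) \<sigma> \<eta> by (simp add: ennreal_mult[symmetric])
    finally show ?thesis .
  qed
qed

section \<open>Dynamics of the k-means method\<close>

lemma sqdist_nonneg [simp]: "0 \<le> sqdist d x y"
  by (simp add: sqdist_def sum_nonneg)

lemma closest_minimal:
  assumes "0 < k"
  shows "closest d k c x < k" and "i < k \<Longrightarrow> sqdist d x (c (closest d k c x)) \<le> sqdist d x (c i)"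
proof -
  have "finite ((\<lambda>i. sqdist d x (c i)) ` {..<k})" "(\<lambda>i. sqdist d x (c i)) ` {..<k} \<noteq> {}"
    using assms by auto
  from Min_in[OF this] obtain i0 where "i0 < k" "sqdist d x (c i0) = Min ((\<lambda>i. sqdist d x (c i)) ` {..<k})"
    by force
  then have "i0 < k \<and> (\<forall>i'<k. sqdist d x (c i0) \<le> sqdist d x (c i'))" by auto
  then have *: "closest d k c x < k \<and> (\<forall>i'<k. sqdist d x (c (closest d k c x)) \<le> sqdist d x (c i'))"
    unfolding closest_def by (rule LeastI)
  show "closest d k c x < k" "i < k \<Longrightarrow> sqdist d x (c (closest d k c x)) \<le> sqdist d x (c i)"
    using * by auto
qed

text \<open>Steiner's identity. Characterizing the mean by a product instead of a quotient covers
  empty \<open>C\<close> with any \<open>m\<close>.\<close>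

lemma sum_sqdist_mean:
  assumes "finite C" and "\<And>l. l < d \<Longrightarrow> (\<Sum>j\<in>C. X j l) = real (card C) * m l"
  shows "(\<Sum>j\<in>C. sqdist d (X j) z) = (\<Sum>j\<in>C. sqdist d (X j) m) + real (card C) * sqdist d z m"
proof -
  have "(\<Sum>j\<in>C. (X j l - z l)\<^sup>2) = (\<Sum>j\<in>C. (X j l - m l)\<^sup>2) + real (card C) * (z l - m l)\<^sup>2" if "l < d" for l
  proof -
    have "(\<Sum>j\<in>C. (X j l - z l)\<^sup>2) = (\<Sum>j\<in>C. (X j l - m l)\<^sup>2 + 2 * (m l - z l) * X j l + ((z l)\<^sup>2 - (m l)\<^sup>2))"
      by (intro sum.cong refl) (simp add: power2_eq_square algebra_simps)
    also have "\<dots> = (\<Sum>j\<in>C. (X j l - m l)\<^sup>2) + 2 * (m l - z l) * (real (card C) * m l) + real (card C) * ((z l)\<^sup>2 - (m l)\<^sup>2)"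
      by (simp add: sum.distrib sum_distrib_left[symmetric] assms(2)[OF that])
    also have "\<dots> = (\<Sum>j\<in>C. (X j l - m l)\<^sup>2) + real (card C) * (z l - m l)\<^sup>2"
      by (simp add: power2_eq_square algebra_simps)
    finally show ?thesis .
  qed
  then have "(\<Sum>l<d. \<Sum>j\<in>C. (X j l - z l)\<^sup>2) = (\<Sum>l<d. (\<Sum>j\<in>C. (X j l - m l)\<^sup>2) + real (card C) * (z l - m l)\<^sup>2)"
    by (intro sum.cong) auto
  then show ?thesis
    unfolding sqdist_def by (subst (1 2) sum.swap) (simp add: sum.distrib sum_distrib_left)
qed

locale kmeans_run =
  fixes d n k :: nat and X :: "nat \<Rightarrow> vec" and c0 :: "nat \<Rightarrow> vec"
  assumes k_pos: "0 < k"
begin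

text \<open>\<open>asg t\<close> is the assignment made in iteration \<open>t\<close>, hence
  computed from \<open>ctr (t - 1)\<close>, whereas \<open>ctr t\<close> is updated afterwards. As
  \<open>asg 0\<close> is undefined, \<open>cl\<close> and \<open>pot\<close> carry meaning from
  \<open>t = 1\<close> on.\<close>

definition ctr :: "nat \<Rightarrow> nat \<Rightarrow> vec" where "ctr t = fst (kmeans_state d n k X c0 t)"
definition asg :: "nat \<Rightarrow> nat \<Rightarrow> nat" where "asg t = snd (kmeans_state d n k X c0 t)"
definition cl :: "nat \<Rightarrow> nat \<Rightarrow> nat set" where "cl t i = {j. j < n \<and> asg t j = i}"
definition pot :: "nat \<Rightarrow> real" where "pot t = (\<Sum>j<n. sqdist d (X j) (ctr t (asg t j)))"

lemma ctr_0: "ctr 0 = c0"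
  by (simp add: ctr_def)

lemma asg_Suc: "asg (Suc t) = assign d k (ctr t) X"
  by (simp add: asg_def ctr_def Let_def)

lemma ctr_Suc: "ctr (Suc t) = update n X (asg (Suc t)) (ctr t)"
  by (simp add: asg_def ctr_def Let_def)

lemma asg_less: "1 \<le> t \<Longrightarrow> asg t j < k"
  using asg_Suc[of "t - 1"] closest_minimal(1)[OF k_pos] by (simp add: assign_def)

lemma asg_minimal: "i < k \<Longrightarrow> sqdist d (X j) (ctr t (asg (Suc t) j)) \<le> sqdist d (X j) (ctr t i)"
  using closest_minimal(2)[OF k_pos] by (simp add: asg_Suc assign_def)

lemma finite_cl [simp]: "finite (cl t i)"
  by (simp add: cl_def)

lemma cl_subset: "cl t i \<subseteq> {..<n}"
  by (auto simp: cl_def)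

lemma card_cl_le: "card (cl t i) \<le> n"
  using card_mono[OF _ cl_subset] by fastforce

lemma ctr_empty: "cl (Suc t) i = {} \<Longrightarrow> ctr (Suc t) i = ctr t i"
  by (auto simp: ctr_Suc update_def cl_def)

lemma sum_cl: "1 \<le> t \<Longrightarrow> (\<Sum>j\<in>cl t i. X j l) = real (card (cl t i)) * ctr t i l"
proof (cases "cl t i = {}")
  case False
  assume "1 \<le> t"
  then obtain t' where t: "t = Suc t'" by (cases t) auto
  have "\<exists>j<n. asg t j = i" using False by (auto simp: cl_def)
  then have "ctr t i l = (\<Sum>j\<in>cl t i. X j l) / real (card (cl t i))"
    unfolding t ctr_Suc update_def cl_def by simp
  then show ?thesis using False by (simp add: card_gt_0_iff)
qed simp

lemma sum_by_clusters:
  "1 \<le> t \<Longrightarrow> (\<Sum>j<n. f j (asg t j)) = (\<Sum>i<k. \<Sum>j\<in>cl t i. f j i)"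
proof -
  assume t: "1 \<le> t"
  have "(\<Sum>j<n. f j (asg t j)) = (\<Sum>i<k. \<Sum>j\<in>{j\<in>{..<n}. asg t j = i}. f j (asg t j))"
    by (rule sum.group[symmetric]) (use asg_less[OF t] in auto)
  also have "\<dots> = (\<Sum>i<k. \<Sum>j\<in>cl t i. f j i)"
    by (intro sum.cong) (auto simp: cl_def)
  finally show ?thesis .
qed

lemma pot_nonneg: "0 \<le> pot t"
  by (simp add: pot_def sum_nonneg)

text \<open>The two halves of an iteration: reassigning the points while \<open>ctr t\<close> is
  kept, then moving every center to its mean, whose gain is given by
  \<open>sum_sqdist_mean\<close>.\<close>

lemma pot_diff:
  assumes "1 \<le> t"
  shows "pot t - pot (Suc t) =
    (\<Sum>j<n. sqdist d (X j) (ctr t (asg t j)) - sqdist d (X j) (ctr t (asg (Suc t) j))) +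
    (\<Sum>i<k. real (card (cl (Suc t) i)) * sqdist d (ctr t i) (ctr (Suc t) i))"
proof -
  have "(\<Sum>j<n. sqdist d (X j) (ctr t (asg (Suc t) j))) = (\<Sum>i<k. \<Sum>j\<in>cl (Suc t) i. sqdist d (X j) (ctr t i))"
    by (rule sum_by_clusters) simp
  also have "\<dots> = (\<Sum>i<k. (\<Sum>j\<in>cl (Suc t) i. sqdist d (X j) (ctr (Suc t) i)) +
      real (card (cl (Suc t) i)) * sqdist d (ctr t i) (ctr (Suc t) i))"
    by (intro sum.cong refl sum_sqdist_mean) (auto simp: sum_cl)
  also have "\<dots> = pot (Suc t) + (\<Sum>i<k. real (card (cl (Suc t) i)) * sqdist d (ctr t i) (ctr (Suc t) i))"
    unfolding sum.distrib pot_def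
    by (simp add: sum_by_clusters[of "Suc t" "\<lambda>j i. sqdist d (X j) (ctr (Suc t) i)", symmetric])
  finally show ?thesis unfolding pot_def by (simp add: sum_subtractf)
qed

lemma reassign_nonneg:
  "1 \<le> t \<Longrightarrow> 0 \<le> sqdist d (X j) (ctr t (asg t j)) - sqdist d (X j) (ctr t (asg (Suc t) j))"
  using asg_minimal[OF asg_less] by simp

lemma reassign_le_pot_diff:
  assumes "1 \<le> t" "j < n"
  shows "sqdist d (X j) (ctr t (asg t j)) - sqdist d (X j) (ctr t (asg (Suc t) j)) \<le> pot t - pot (Suc t)"
proof -
  have "sqdist d (X j) (ctr t (asg t j)) - sqdist d (X j) (ctr t (asg (Suc t) j)) \<le>
    (\<Sum>j<n. sqdist d (X j) (ctr t (asg t j)) - sqdist d (X j) (ctr t (asg (Suc t) j)))"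
    using assms reassign_nonneg
    by (intro member_le_sum[where f="\<lambda>j. sqdist d (X j) (ctr t (asg t j)) - sqdist d (X j) (ctr t (asg (Suc t) j))"]) auto
  moreover have "0 \<le> (\<Sum>i<k. real (card (cl (Suc t) i)) * sqdist d (ctr t i) (ctr (Suc t) i))"
    by (intro sum_nonneg mult_nonneg_nonneg) auto
  ultimately show ?thesis using pot_diff[OF assms(1)] by linarith
qed

lemma pot_Suc_le: "1 \<le> t \<Longrightarrow> pot (Suc t) \<le> pot t"
proof -
  assume t: "1 \<le> t"
  have "0 \<le> (\<Sum>j<n. sqdist d (X j) (ctr t (asg t j)) - sqdist d (X j) (ctr t (asg (Suc t) j)))"
    using reassign_nonneg[OF t] by (intro sum_nonneg) auto
  moreover have "0 \<le> (\<Sum>i<k. real (card (cl (Suc t) i)) * sqdist d (ctr t i) (ctr (Suc t) i))"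
    by (intro sum_nonneg mult_nonneg_nonneg) auto
  ultimately show ?thesis using pot_diff[OF t] by linarith
qed

lemma pot_antimono:
  assumes "1 \<le> t" "t \<le> t'" shows "pot t' \<le> pot t"
  using assms(2)
proof (induction t' rule: dec_induct)
  case (step m) then show ?case using pot_Suc_le[of m] assms(1) by simp
qed simp

text \<open>A nonempty cluster gains at least the squared displacement of its center; the center of
  an empty cluster does not move.\<close>

lemma center_move_le:
  assumes "1 \<le> t" "i < k" "l < d"
  shows "(ctr (Suc t) i l - ctr t i l)\<^sup>2 \<le> pot t - pot (Suc t)"
proof (cases "cl (Suc t) i = {}")
  case True
  then show ?thesis using pot_Suc_le[OF assms(1)] by (simp add: ctr_empty)
next
  case False
  then have c: "1 \<le> real (card (cl (Suc t) i))" by (simp add: Suc_le_eq card_gt_0_iff)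
  have "(ctr (Suc t) i l - ctr t i l)\<^sup>2 = (ctr t i l - ctr (Suc t) i l)\<^sup>2"
    by (rule power2_commute)
  also have "\<dots> \<le> sqdist d (ctr t i) (ctr (Suc t) i)"
    unfolding sqdist_def using assms
    by (intro member_le_sum[where f="\<lambda>l. (ctr t i l - ctr (Suc t) i l)\<^sup>2"]) auto
  also have "\<dots> \<le> real (card (cl (Suc t) i)) * sqdist d (ctr t i) (ctr (Suc t) i)"
    using mult_right_mono[OF c, of "sqdist d (ctr t i) (ctr (Suc t) i)"] by simp
  also have "\<dots> \<le> (\<Sum>i<k. real (card (cl (Suc t) i)) * sqdist d (ctr t i) (ctr (Suc t) i))"
    using assms by (intro member_le_sum[where f="\<lambda>i. real (card (cl (Suc t) i)) * sqdist d (ctr t i) (ctr (Suc t) i)"]) auto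
  also have "\<dots> \<le> pot t - pot (Suc t)"
  proof -
    have "0 \<le> (\<Sum>j<n. sqdist d (X j) (ctr t (asg t j)) - sqdist d (X j) (ctr t (asg (Suc t) j)))"
      using reassign_nonneg[OF assms(1)] by (intro sum_nonneg) auto
    then show ?thesis using pot_diff[OF assms(1)] by linarith
  qed
  finally show ?thesis .
qed

text \<open>No single iteration loses more potential than the whole window, so each moves a
  coordinate by at most \<open>sqrt \<epsilon>\<close>; at most \<open>m\<close> such moves add
  up.\<close>

lemma center_move_window:
  assumes "1 \<le> s" "i < k" "l < d" "s \<le> t" "t \<le> t'" "t' \<le> s + m" "pot s - pot (s + m) \<le> \<epsilon>" "0 \<le> \<epsilon>"
  shows "\<bar>ctr t' i l - ctr t i l\<bar> \<le> real m * sqrt \<epsilon>"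
proof -
  have "\<bar>ctr t' i l - ctr t i l\<bar> \<le> real (t' - t) * sqrt \<epsilon>"
    using assms(5,6)
  proof (induction t' rule: dec_induct)
    case (step u)
    have "pot u - pot (Suc u) \<le> pot s - pot (s + m)"
      using pot_antimono[of s u] pot_antimono[of "Suc u" "s + m"] step assms by simp
    then have "(ctr (Suc u) i l - ctr u i l)\<^sup>2 \<le> \<epsilon>"
      using center_move_le[of u i l] assms step by simp
    then have "\<bar>ctr (Suc u) i l - ctr u i l\<bar> \<le> sqrt \<epsilon>"
      using real_sqrt_le_mono[of "(ctr (Suc u) i l - ctr u i l)\<^sup>2" \<epsilon>] by simp
    moreover have "\<bar>ctr u i l - ctr t i l\<bar> \<le> real (u - t) * sqrt \<epsilon>" using step by simp
    moreover have "real (Suc u - t) * sqrt \<epsilon> = real (u - t) * sqrt \<epsilon> + sqrt \<epsilon>"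
      using step by (simp add: Suc_diff_le algebra_simps)
    ultimately show ?case by linarith
  qed simp
  also have "\<dots> \<le> real m * sqrt \<epsilon>" using assms by (intro mult_right_mono) auto
  finally show ?thesis .
qed

lemma center_move_window':
  assumes "1 \<le> s" "i < k" "l < d" "s \<le> t" "t \<le> s + m" "s \<le> t'" "t' \<le> s + m" "pot s - pot (s + m) \<le> \<epsilon>" "0 \<le> \<epsilon>"
  shows "\<bar>ctr t' i l - ctr t i l\<bar> \<le> real m * sqrt \<epsilon>"
proof (cases "t \<le> t'")
  case True
  then show ?thesis using assms by (intro center_move_window)
next
  case False
  then have "\<bar>ctr t i l - ctr t' i l\<bar> \<le> real m * sqrt \<epsilon>" using assms by (intro center_move_window) auto
  then show ?thesis by (simp add: abs_minus_commute)
qed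

lemma cl_eq_imp_mean_eq:
  assumes "1 \<le> t" "1 \<le> t'" "cl t i = cl t' i" "cl t i \<noteq> {}"
  shows "ctr t i l = ctr t' i l"
proof -
  have "0 < card (cl t i)" using assms(4) by (simp add: card_gt_0_iff)
  then show ?thesis using sum_cl[OF assms(1), where i=i and l=l] sum_cl[OF assms(2), where i=i and l=l] assms(3,4) by auto
qed

section \<open>Repeated clusterings and termination\<close>

definition stops :: "nat \<Rightarrow> bool" where "stops = kmeans_stops d n k X c0"

lemma stops_iff: "stops t \<longleftrightarrow> (\<forall>i<k. \<forall>l<d. ctr t i l = ctr (t - 1) i l) \<and>
     (t \<ge> 2 \<longrightarrow> (\<forall>j<n. asg t j = asg (t - 1) j))"
  by (simp add: stops_def kmeans_stops_def ctr_def asg_def)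

text \<open>Only centers of nonempty clusters enter the potential, and these are means determined by
  the clustering.\<close>

lemma pot_clustering:
  assumes "1 \<le> t" "1 \<le> t'" "\<And>j. j < n \<Longrightarrow> asg t j = asg t' j"
  shows "pot t = pot t'"
  unfolding pot_def
proof (intro sum.cong refl)
  fix j assume "j \<in> {..<n}"
  then have j: "j < n" by simp
  have "cl t (asg t j) = cl t' (asg t j)" using assms(3) by (auto simp: cl_def)
  moreover have "cl t (asg t j) \<noteq> {}" using j by (auto simp: cl_def)
  ultimately have "ctr t (asg t j) l = ctr t' (asg t j) l" for l
    using assms by (intro cl_eq_imp_mean_eq)
  then have "ctr t (asg t j) = ctr t' (asg t j)" by blast
  then show "sqdist d (X j) (ctr t (asg t j)) = sqdist d (X j) (ctr t' (asg t' j))" using assms(3) j by simp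
qed

lemma assign_cong:
  "(\<And>i l. i < k \<Longrightarrow> l < d \<Longrightarrow> c i l = c' i l) \<Longrightarrow> assign d k c X j = assign d k c' X j"
proof -
  assume *: "\<And>i l. i < k \<Longrightarrow> l < d \<Longrightarrow> c i l = c' i l"
  have "sqdist d (X j) (c i) = sqdist d (X j) (c' i)" if "i < k" for i
    using * that by (simp add: sqdist_def)
  then show ?thesis unfolding assign_def closest_def
    by (intro arg_cong[where f=Least] ext) auto
qed

text \<open>Equal clusterings have equal potential, so the drop in between is 0 and
  \<open>center_move_window\<close> with \<epsilon> = 0 freezes all centers; frozen centers
  reproduce the assignment.\<close>

lemma repeat_imp_stops:
  assumes "1 \<le> t" "t < t'" "\<And>j. j < n \<Longrightarrow> asg t j = asg t' j"
  shows "\<exists>u. 1 \<le> u \<and> u \<le> t' \<and> stops u"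
proof (cases "t' = Suc t")
  case True
  have "ctr (Suc t) i l = ctr t i l" for i l
  proof (cases "cl (Suc t) i = {}")
    case False
    have "cl t i = cl (Suc t) i" using assms(3) True by (auto simp: cl_def)
    then show ?thesis using cl_eq_imp_mean_eq[of "Suc t" t i] False assms(1) by simp
  qed (simp add: ctr_empty)
  then have "stops (Suc t)" using assms(3) True by (simp add: stops_iff)
  then show ?thesis using True assms by (intro exI[of _ "Suc t"]) auto
next
  case False
  then have le: "Suc (Suc t) \<le> t'" using assms by simp
  have p: "pot t = pot t'" by (rule pot_clustering) (use assms in auto)
  have same: "ctr u' i l = ctr t i l" if "i < k" "l < d" "t \<le> u'" "u' \<le> t'" for i l u'
    using center_move_window[of t i l t u' "t' - t" 0] p assms that by simp
  have "ctr (Suc t) i l = ctr t i l" "ctr (Suc (Suc t)) i l = ctr (Suc t) i l" if "i < k" "l < d" for i l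
    using same[OF that, of "Suc t"] same[OF that, of "Suc (Suc t)"] le by auto
  moreover from this have "asg (Suc (Suc t)) j = asg (Suc t) j" for j
    unfolding asg_Suc by (intro assign_cong)
  ultimately have "stops (Suc (Suc t))" by (simp add: stops_iff)
  then show ?thesis using le by (intro exI[of _ "Suc (Suc t)"]) auto
qed

lemma asg_distinct:
  assumes "\<And>u. 1 \<le> u \<Longrightarrow> u \<le> T \<Longrightarrow> \<not> stops u" "1 \<le> t" "t < t'" "t' \<le> T"
  shows "\<exists>j<n. asg t j \<noteq> asg t' j"
  using repeat_imp_stops[of t t'] assms by fastforce

text \<open>There are \<open>k ^ n\<close> assignments of the \<open>n\<close> points. This
  deterministic bound pays for point sets outside a bounded box and ends the chain of dyadic
  scales.\<close>

lemma stops_exponential: "\<exists>u. 1 \<le> u \<and> u \<le> k ^ n + 1 \<and> stops u"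
proof (rule ccontr)
  assume *: "\<not> ?thesis"
  let ?f = "\<lambda>t. restrict (asg t) {..<n}"
  have "inj_on ?f {1..k ^ n + 1}"
  proof (rule linorder_inj_onI)
    fix t t' assume "t < t'" "t \<in> {1..k ^ n + 1}" "t' \<in> {1..k ^ n + 1}"
    then have "\<exists>j<n. asg t j \<noteq> asg t' j" using * by (intro asg_distinct[of "k ^ n + 1"]) auto
    then obtain j where "j < n" "asg t j \<noteq> asg t' j" by blast
    then have "?f t j \<noteq> ?f t' j" by simp
    then show "?f t \<noteq> ?f t'" by metis
  qed auto
  moreover have "?f ` {1..k ^ n + 1} \<subseteq> (\<Pi>\<^sub>E j\<in>{..<n}. {..<k})"
    using asg_less by (intro image_subsetI) simp
  ultimately have "card {1..k ^ n + 1} \<le> card (\<Pi>\<^sub>E j\<in>{..<n}. {..<k})"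
    by (intro card_inj_on_le) (auto intro!: finite_PiE)
  then show False by (simp add: card_PiE)
qed

lemma iterations_le:
  assumes "1 \<le> u" "u \<le> T" "stops u"
  shows "kmeans_iterations d n k X c0 \<le> enat T"
proof -
  have "(LEAST t. t \<ge> 1 \<and> stops t) \<le> u" by (rule Least_le) (use assms in auto)
  then show ?thesis using assms unfolding kmeans_iterations_def stops_def by auto
qed

end

section \<open>Unlikely configurations\<close>

text \<open>
If \<open>B0\<close>, \<open>B1\<close>, \<open>B2\<close> have a common mean \<open>c\<close>, then the sums over \<open>B1\<close> and \<open>B2\<close> differ from that over \<open>B0\<close> by
\<open>e1\<close> and \<open>e2\<close> times \<open>c\<close>; these coefficients eliminate \<open>c\<close>. The same holds if a common part is removed
from the three sets.
\<close>

definition relation_coeff :: "nat set \<times> nat set \<times> nat set \<Rightarrow> nat \<Rightarrow> real" where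
  "relation_coeff = (\<lambda>(B0, B1, B2) j.
     let e1 = real (card B1) - real (card B0); e2 = real (card B2) - real (card B0) in
     if e1 = 0 \<and> e2 = 0 then indicator B1 j - indicator B0 j
     else e2 * (indicator B1 j - indicator B0 j) - e1 * (indicator B2 j - indicator B0 j))"

lemma relation_coeff_Ints: "relation_coeff B j \<in> \<int>"
  by (auto simp: relation_coeff_def Let_def indicator_def split: prod.splits intro!: Ints_diff Ints_mult)

lemma relation_coeff_eq_0: "(j \<in> B0 \<longleftrightarrow> j \<in> B1) \<Longrightarrow> (j \<in> B0 \<longleftrightarrow> j \<in> B2) \<Longrightarrow> relation_coeff (B0, B1, B2) j = 0"
  by (auto simp: relation_coeff_def Let_def indicator_def)

text \<open>The coefficients are integers, so one nonzero value suffices. If all vanish and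
  \<open>e1\<close>, \<open>e2\<close> are not both 0, then a point separating \<open>B0\<close>
  from \<open>B1\<close> forces \<open>e2 = 0\<close> or \<open>e2 = e1\<close>, one separating
  \<open>B0\<close> from \<open>B2\<close> forces \<open>e1 = 0\<close> or \<open>e2 = e1\<close>.
  Hence \<open>e1 = e2\<close> is nonzero, and then \<open>B1 = B2\<close>.\<close>

lemma relation_coeff_pivot:
  assumes "B0 \<noteq> B1" "B0 \<noteq> B2" "B1 \<noteq> B2"
  shows "\<exists>j\<in>B0 \<union> B1 \<union> B2. 1 \<le> \<bar>relation_coeff (B0, B1, B2) j\<bar>"
proof -
  have "\<exists>j. relation_coeff (B0, B1, B2) j \<noteq> 0"
  proof (rule ccontr)
    assume "\<not> ?thesis"
    then have z: "relation_coeff (B0, B1, B2) j = 0" for j by blast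
    define e1 where "e1 = real (card B1) - real (card B0)"
    define e2 where "e2 = real (card B2) - real (card B0)"
    obtain j1 where j1: "(j1 \<in> B0) \<noteq> (j1 \<in> B1)" using assms(1) by blast
    obtain j2 where j2: "(j2 \<in> B0) \<noteq> (j2 \<in> B2)" using assms(2) by blast
    obtain j3 where j3: "(j3 \<in> B1) \<noteq> (j3 \<in> B2)" using assms(3) by blast
    have ne: "\<not> (e1 = 0 \<and> e2 = 0)"
      using z[of j1] j1 by (auto simp: relation_coeff_def Let_def e1_def e2_def indicator_def split: if_splits)
    have eq: "e2 * (indicator B1 j - indicator B0 j) - e1 * (indicator B2 j - indicator B0 j) = 0" for j
      using z[of j] ne by (simp add: relation_coeff_def Let_def e1_def e2_def split: if_splits)
    have "e2 = 0 \<or> e2 = e1"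
      using eq[of j1] j1 by (cases "j1 \<in> B0"; cases "j1 \<in> B2") auto
    moreover have "e1 = 0 \<or> e2 = e1"
      using eq[of j2] j2 by (cases "j2 \<in> B0"; cases "j2 \<in> B1") auto
    ultimately have e: "e2 = e1" "e1 \<noteq> 0" using ne by auto
    have "e1 * (indicator B1 j3 - indicator B2 j3) = 0" using eq[of j3] e(1) by (simp add: algebra_simps)
    then have "indicator B1 j3 = (indicator B2 j3 :: real)" using e(2) by simp
    then show False using j3 by (cases "j3 \<in> B1") auto
  qed
  then obtain j where j: "relation_coeff (B0, B1, B2) j \<noteq> 0" by blast
  then have "j \<in> B0 \<union> B1 \<union> B2" using relation_coeff_eq_0[of j B0 B1 B2] by blast
  then show ?thesis using j Ints_nonzero_abs_ge1[OF relation_coeff_Ints j] by blast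
qed

text \<open>Two pigeonholes. More than \<open>2 ^ k\<close> of the times agree on \<open>S\<close>.
  If among them every cluster index took at most two point sets, the assignment would be determined
  by \<open>k\<close> binary choices, contradicting that the assignments are distinct.\<close>

lemma pigeonhole_three_classes:
  fixes A :: "nat \<Rightarrow> nat \<Rightarrow> nat"
  assumes fin: "finite \<T>" and lt: "\<And>t j. t \<in> \<T> \<Longrightarrow> j < n \<Longrightarrow> A t j < k"
    and dist: "\<And>t t'. t \<in> \<T> \<Longrightarrow> t' \<in> \<T> \<Longrightarrow> t < t' \<Longrightarrow> \<exists>j<n. A t j \<noteq> A t' j"
    and S: "S \<subseteq> {..<n}" and card: "k ^ card S * 2 ^ k < card \<T>"
  shows "\<exists>i<k. \<exists>t0\<in>\<T>. \<exists>t1\<in>\<T>. \<exists>t2\<in>\<T>. (\<forall>j\<in>S. A t0 j = A t1 j \<and> A t0 j = A t2 j) \<and>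
     {j. j < n \<and> A t0 j = i} \<noteq> {j. j < n \<and> A t1 j = i} \<and>
     {j. j < n \<and> A t0 j = i} \<noteq> {j. j < n \<and> A t2 j = i} \<and>
     {j. j < n \<and> A t1 j = i} \<noteq> {j. j < n \<and> A t2 j = i}"
proof -
  have finS: "finite S" using S finite_subset by blast
  let ?f = "\<lambda>t. restrict (A t) S"
  let ?P = "\<Pi>\<^sub>E j\<in>S. {..<k}"
  have finP: "finite ?P" by (intro finite_PiE finS) auto
  have im: "?f ` \<T> \<subseteq> ?P" using lt S by fastforce
  have "\<exists>y\<in>?P. 2 ^ k < card {t\<in>\<T>. ?f t = y}"
  proof (rule ccontr)
    assume "\<not> ?thesis"
    then have le: "card {t\<in>\<T>. ?f t = y} \<le> 2 ^ k" if "y \<in> ?P" for y using that by (meson not_le)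
    have "\<T> = (\<Union>y\<in>?P. {t\<in>\<T>. ?f t = y})" using im by blast
    then have "card \<T> = card (\<Union>y\<in>?P. {t\<in>\<T>. ?f t = y})" by simp
    also have "\<dots> \<le> (\<Sum>y\<in>?P. card {t\<in>\<T>. ?f t = y})" by (rule card_UN_le[OF finP])
    also have "\<dots> \<le> (\<Sum>y\<in>?P. 2 ^ k)" by (rule sum_mono[OF le])
    also have "\<dots> = k ^ card S * 2 ^ k" using finS by (simp add: card_PiE)
    finally show False using card by simp
  qed
  then obtain y where y: "2 ^ k < card {t\<in>\<T>. ?f t = y}" by blast
  define U where "U = {t\<in>\<T>. ?f t = y}"
  have finU: "finite U" using fin by (simp add: U_def)
  let ?C = "\<lambda>t i. {j. j < n \<and> A t j = i}"
  have "\<exists>i<k. 2 < card ((\<lambda>t. ?C t i) ` U)"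
  proof (rule ccontr)
    assume "\<not> ?thesis"
    then have le: "card ((\<lambda>t. ?C t i) ` U) \<le> 2" if "i < k" for i using that by (meson not_le)
    let ?g = "\<lambda>t. \<lambda>i\<in>{..<k}. ?C t i"
    have "inj_on ?g U"
    proof (rule linorder_inj_onI)
      fix t t' assume tt: "t < t'" "t \<in> U" "t' \<in> U"
      then obtain j where j: "j < n" "A t j \<noteq> A t' j" using dist[of t t'] by (auto simp: U_def)
      have Ak: "A t j < k" using lt tt j by (auto simp: U_def)
      have "j \<in> ?g t (A t j)" "j \<notin> ?g t' (A t j)" using j Ak by auto
      then show "?g t \<noteq> ?g t'" by metis
    qed auto
    moreover have "?g ` U \<subseteq> (\<Pi>\<^sub>E i\<in>{..<k}. (\<lambda>t. ?C t i) ` U)" by auto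
    ultimately have "card U \<le> card (\<Pi>\<^sub>E i\<in>{..<k}. (\<lambda>t. ?C t i) ` U)"
      using finU by (intro card_inj_on_le) (auto intro!: finite_PiE)
    also have "\<dots> = (\<Prod>i<k. card ((\<lambda>t. ?C t i) ` U))" by (simp add: card_PiE)
    also have "\<dots> \<le> (\<Prod>i<k. 2)" using le by (intro prod_mono) auto
    finally show False using y by (simp add: U_def)
  qed
  then obtain i where i: "i < k" "3 \<le> card ((\<lambda>t. ?C t i) ` U)" by auto
  obtain V where V: "V \<subseteq> (\<lambda>t. ?C t i) ` U" "card V = 3" using obtain_subset_with_card_n[OF i(2)] by metis
  then obtain a b c where abc: "V = {a, b, c}" "a \<noteq> b" "b \<noteq> c" "a \<noteq> c" by (auto simp: card_3_iff)
  then obtain t0 t1 t2 where t: "t0 \<in> U" "t1 \<in> U" "t2 \<in> U" "a = ?C t0 i" "b = ?C t1 i" "c = ?C t2 i"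
    using V(1) by auto
  have "A t0 j = A t j" if "t \<in> U" "j \<in> S" for t j
  proof -
    have "?f t0 = ?f t" using that t(1) by (simp add: U_def)
    then have "?f t0 j = ?f t j" by simp
    then show ?thesis using that by simp
  qed
  then have "(\<forall>j\<in>S. A t0 j = A t1 j \<and> A t0 j = A t2 j) \<and>
     ?C t0 i \<noteq> ?C t1 i \<and> ?C t0 i \<noteq> ?C t2 i \<and> ?C t1 i \<noteq> ?C t2 i" using t abc by metis
  moreover have "t0 \<in> \<T>" "t1 \<in> \<T>" "t2 \<in> \<T>" using t by (auto simp: U_def)
  ultimately show ?thesis using i(1) by blast
qed

section \<open>The exceptional events\<close>

definition mean :: "(nat \<Rightarrow> vec) \<Rightarrow> nat set \<Rightarrow> vec" where
  "mean X P l = (\<Sum>j\<in>P. X j l) / real (card P)"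

text \<open>General position, which keeps centers apart. The second clause is for centers still at
  their initial position, which need not be means of points.\<close>

definition generic :: "nat \<Rightarrow> nat \<Rightarrow> nat \<Rightarrow> (nat \<Rightarrow> vec) \<Rightarrow> (nat \<Rightarrow> vec) \<Rightarrow> bool" where
  "generic n d k c0 X \<longleftrightarrow>
     (\<forall>P Q. P \<subseteq> {..<n} \<and> Q \<subseteq> {..<n} \<and> P \<noteq> {} \<and> Q \<noteq> {} \<and> P \<inter> Q = {} \<longrightarrow> (\<exists>l<d. mean X P l \<noteq> mean X Q l)) \<and>
     (\<forall>P i. P \<subseteq> {..<n} \<and> P \<noteq> {} \<and> i < k \<longrightarrow> (\<exists>l<d. mean X P l \<noteq> c0 i l))"

text \<open>The normal vector has maximum norm 1, so some coordinate can serve as a pivot. A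
  hyperplane has \<open>d + 1\<close> parameters, and four points are asked for per
  parameter.\<close>

definition slab_event :: "nat \<Rightarrow> nat \<Rightarrow> real \<Rightarrow> (nat \<Rightarrow> vec) \<Rightarrow> bool" where
  "slab_event n d \<delta> X \<longleftrightarrow> (\<exists>T\<subseteq>{..<n}. card T = 4 * (d + 1) \<and>
     (\<exists>a s. (\<forall>l<d. \<bar>a l\<bar> \<le> 1) \<and> (\<exists>l<d. \<bar>a l\<bar> = 1) \<and>
        (\<forall>j\<in>T. \<bar>(\<Sum>l<d. a l * X j l) - s\<bar> \<le> real n * real d * \<delta>)))"

text \<open>The size bound is the negation of \<open>4 * (d + 1) \<le> card P\<close>, the size from
  which a target cluster is handled by \<open>slab_event\<close>.\<close>

definition small_sets :: "nat \<Rightarrow> nat \<Rightarrow> nat set set" where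
  "small_sets n d = {P. P \<subseteq> {..<n} \<and> P \<noteq> {} \<and> card P \<le> 4 * d + 3}"

text \<open>The non-inclusions supply triangular pivots: a point of \<open>P1\<close> outside
  \<open>P0\<close>, and a point of \<open>P2\<close> outside both other sets.\<close>

definition means_event :: "nat \<Rightarrow> nat \<Rightarrow> real \<Rightarrow> (nat \<Rightarrow> vec) \<Rightarrow> bool" where
  "means_event n d \<rho> X \<longleftrightarrow> (\<exists>P0\<in>small_sets n d. \<exists>P1\<in>small_sets n d. \<exists>P2\<in>small_sets n d.
     \<not> P1 \<subseteq> P0 \<and> \<not> P2 \<subseteq> P0 \<union> P1 \<and>
     (\<forall>l<d. \<bar>mean X P1 l - mean X P0 l\<bar> \<le> \<rho> \<and> \<bar>mean X P2 l - mean X P0 l\<bar> \<le> \<rho>))"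

text \<open>\<open>C\<close> stands for the centers at the start of a window. The true bisectors
  belong to moving centers; the term \<open>3 * \<rho>\<close> and most of the factor 13 allow for
  freezing them.\<close>

definition bisector_event :: "nat \<Rightarrow> nat \<Rightarrow> nat \<Rightarrow> real \<Rightarrow> real \<Rightarrow> real \<Rightarrow> (nat \<Rightarrow> vec) \<Rightarrow> bool" where
  "bisector_event n d k R \<rho> \<delta> X \<longleftrightarrow> (\<exists>T\<subseteq>{..<n}. card T = 6 * d * k \<and>
     (\<exists>C. (\<forall>i<k. \<forall>l<d. \<bar>C i l\<bar> \<le> 2 * R) \<and>
       (\<forall>j\<in>T. \<exists>i<k. \<exists>i'<k. (\<exists>l<d. \<delta> - 3 * \<rho> \<le> \<bar>C i l - C i' l\<bar>) \<and>
          \<bar>sqdist d (X j) (C i) - sqdist d (X j) (C i')\<bar> \<le> 13 * real d * R * \<rho>)))"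

text \<open>The numbering runs backwards: relations with smaller index are found later and vanish at
  all pivots found before.\<close>

definition triangular :: "nat \<Rightarrow> nat \<Rightarrow> (nat \<Rightarrow> nat set \<times> nat set \<times> nat set) \<Rightarrow> (nat \<Rightarrow> nat) \<Rightarrow> bool" where
  "triangular n b B J \<longleftrightarrow> (\<forall>r<b. J r < n \<and> 1 \<le> \<bar>relation_coeff (B r) (J r)\<bar>) \<and>
     (\<forall>r'<b. \<forall>r<r'. relation_coeff (B r) (J r') = 0)"

text \<open>\<open>M\<close> will be the set of all moved points. Confining the relations to one set
  with fewer than \<open>q\<close> points leaves at most \<open>8 ^ q\<close> triples for each
  relation.\<close>

definition relation_event :: "nat \<Rightarrow> nat \<Rightarrow> nat \<Rightarrow> nat \<Rightarrow> real \<Rightarrow> (nat \<Rightarrow> vec) \<Rightarrow> bool" where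
  "relation_event n d q b \<rho> X \<longleftrightarrow> (\<exists>M\<subseteq>{..<n}. card M < q \<and>
     (\<exists>B J. (\<forall>r<b. B r \<in> Pow M \<times> Pow M \<times> Pow M) \<and> triangular n b B J \<and>
       (\<forall>r<b. \<forall>l<d. \<bar>\<Sum>j<n. relation_coeff (B r) j * X j l\<bar> \<le> 2 * (real n)\<^sup>2 * \<rho>)))"

context kmeans_run
begin

lemma mean_cl: "1 \<le> t \<Longrightarrow> cl t i \<noteq> {} \<Longrightarrow> mean X (cl t i) = ctr t i"
  using sum_cl[of t, where i=i] by (auto simp: mean_def fun_eq_iff card_eq_0_iff)

text \<open>
Two centers can only coincide as long as both are untouched initial centers: the mean of a nonempty
cluster is the unique minimizer of its cost, so its points would not have preferred a center
different from an already present copy of their mean.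
\<close>

lemma pairwise_centers_distinct:
  assumes gen: "generic n d k c0 X" and ij: "i < k" "j < k" "i \<noteq> j"
    and eq: "\<forall>l<d. ctr t i l = ctr t j l" and u: "1 \<le> u" "u \<le> t"
  shows "cl u i = {} \<and> cl u j = {}"
  using eq u
proof (induction t arbitrary: u)
  case (Suc t)
  have stale: "ctr t i' l = c0 i' l" if "\<And>u. 1 \<le> u \<Longrightarrow> u \<le> t \<Longrightarrow> cl u i' = {}" for i' l
    using that by (induction t) (auto simp: ctr_0 ctr_empty)
  have half: "cl (Suc t) a = {}"
    if ab: "a < k" "b < k" "a \<noteq> b" and e: "\<forall>l<d. ctr (Suc t) a l = ctr (Suc t) b l"
      and IH: "\<And>u. \<forall>l<d. ctr t a l = ctr t b l \<Longrightarrow> 1 \<le> u \<Longrightarrow> u \<le> t \<Longrightarrow> cl u b = {}" for a b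
  proof (rule ccontr)
    assume ne: "cl (Suc t) a \<noteq> {}"
    have ma: "mean X (cl (Suc t) a) = ctr (Suc t) a" using ne by (intro mean_cl) auto
    show False
    proof (cases "cl (Suc t) b = {}")
      case False
      then have "mean X (cl (Suc t) b) = ctr (Suc t) b" by (intro mean_cl) auto
      moreover have "cl (Suc t) a \<inter> cl (Suc t) b = {}" using ab by (auto simp: cl_def)
      ultimately show False using gen ne False ma e cl_subset unfolding generic_def by metis
    next
      case True
      have eb: "ctr t b l = ctr (Suc t) a l" if "l < d" for l using True e that by (simp add: ctr_empty)
      have "(\<Sum>j\<in>cl (Suc t) a. sqdist d (X j) (ctr t a)) =
        (\<Sum>j\<in>cl (Suc t) a. sqdist d (X j) (ctr (Suc t) a)) + real (card (cl (Suc t) a)) * sqdist d (ctr t a) (ctr (Suc t) a)"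
        by (rule sum_sqdist_mean) (auto simp: sum_cl)
      moreover have "(\<Sum>j\<in>cl (Suc t) a. sqdist d (X j) (ctr t a)) \<le> (\<Sum>j\<in>cl (Suc t) a. sqdist d (X j) (ctr t b))"
        using asg_minimal[OF ab(2)] by (intro sum_mono) (auto simp: cl_def)
      moreover have "(\<Sum>j\<in>cl (Suc t) a. sqdist d (X j) (ctr t b)) = (\<Sum>j\<in>cl (Suc t) a. sqdist d (X j) (ctr (Suc t) a))"
        by (simp add: sqdist_def eb)
      ultimately have "real (card (cl (Suc t) a)) * sqdist d (ctr t a) (ctr (Suc t) a) \<le> 0" by linarith
      moreover have "0 < real (card (cl (Suc t) a))" using ne by (simp add: card_gt_0_iff)
      ultimately have "sqdist d (ctr t a) (ctr (Suc t) a) = 0"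
        by (metis mult_le_0_iff not_less order_antisym sqdist_nonneg)
      then have "\<forall>l<d. ctr t a l = ctr (Suc t) a l"
        unfolding sqdist_def by (subst (asm) sum_nonneg_eq_0_iff) auto
      then have "\<forall>l<d. ctr t a l = ctr t b l" using eb by simp
      \<comment> \<open>The two centers already coincided at time \<open>t\<close>, so by the
        induction hypothesis \<open>b\<close> never owned a point and still is at its initial
        position, which would be the mean of cluster \<open>a\<close>.\<close>
      then have "ctr t b l = c0 b l" for l using IH by (intro stale) auto
      then have "\<forall>l<d. mean X (cl (Suc t) a) l = c0 b l" using eb ma by simp
      then show False using gen ne cl_subset ab unfolding generic_def by metis
    qed
  qed
  have 1: "cl (Suc t) i = {}"
    by (rule half[OF ij(1,2,3) Suc.prems(1)]) (use Suc.IH in blast)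
  have 2: "cl (Suc t) j = {}"
    by (rule half[OF ij(2,1) ij(3)[symmetric]]) (use Suc.IH Suc.prems(1) in metis)+
  have "\<forall>l<d. ctr t i l = ctr t j l" using Suc.prems(1) 1 2 by (simp add: ctr_empty)
  then have "cl u i = {} \<and> cl u j = {}" if "u \<le> t" using Suc.IH Suc.prems that by blast
  then show ?case using 1 2 Suc.prems by (cases "u = Suc t") auto
qed simp

end

section \<open>A window with a small drop of the potential\<close>

lemma abs_sqdist_diff_le:
  assumes "\<And>l. l < d \<Longrightarrow> \<bar>x l\<bar> \<le> A" "\<And>l. l < d \<Longrightarrow> \<bar>c l\<bar> \<le> B" "\<And>l. l < d \<Longrightarrow> \<bar>c' l\<bar> \<le> B'"
    "\<And>l. l < d \<Longrightarrow> \<bar>c l - c' l\<bar> \<le> \<rho>"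
  shows "\<bar>sqdist d x c - sqdist d x c'\<bar> \<le> real d * (\<rho> * (2 * A + B + B'))"
proof -
  have "sqdist d x c - sqdist d x c' = (\<Sum>l<d. (c' l - c l) * (2 * x l - c l - c' l))"
    unfolding sqdist_def sum_subtractf[symmetric]
    by (intro sum.cong) (auto simp: power2_eq_square algebra_simps)
  also have "\<bar>\<dots>\<bar> \<le> (\<Sum>l<d. \<rho> * (2 * A + B + B'))"
  proof (rule order_trans[OF sum_abs], rule sum_mono)
    fix l assume "l \<in> {..<d}"
    then have l: "l < d" by simp
    have "\<bar>c' l - c l\<bar> \<le> \<rho>" "\<bar>2 * x l - c l - c' l\<bar> \<le> 2 * A + B + B'"
      using assms(1)[OF l] assms(2)[OF l] assms(3)[OF l] assms(4)[OF l] by auto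
    then show "\<bar>(c' l - c l) * (2 * x l - c l - c' l)\<bar> \<le> \<rho> * (2 * A + B + B')"
      unfolding abs_mult by (intro mult_mono) auto
  qed
  finally show ?thesis by simp
qed

context kmeans_run
begin

lemma abs_ctr_le:
  assumes "1 \<le> t" "cl t i \<noteq> {}" "\<And>j. j < n \<Longrightarrow> \<bar>X j l\<bar> \<le> R"
  shows "\<bar>ctr t i l\<bar> \<le> R"
proof -
  have pos: "0 < real (card (cl t i))" using assms(2) by (simp add: card_gt_0_iff)
  have "real (card (cl t i)) * \<bar>ctr t i l\<bar> = \<bar>\<Sum>j\<in>cl t i. X j l\<bar>"
    by (simp add: sum_cl[OF assms(1)] abs_mult)
  also have "\<dots> \<le> (\<Sum>j\<in>cl t i. R)"
    by (rule order_trans[OF sum_abs], rule sum_mono) (use assms(3) in \<open>auto simp: cl_def\<close>)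
  also have "\<dots> = real (card (cl t i)) * R" by simp
  finally show ?thesis using pos by simp
qed

text \<open>The initial centers may be arbitrarily far away, so the potential is controlled from
  iteration 1 on, when every center in use is a mean of points.\<close>

lemma pot_1_le:
  assumes "\<And>j l. j < n \<Longrightarrow> l < d \<Longrightarrow> \<bar>X j l\<bar> \<le> R"
  shows "pot 1 \<le> 4 * real n * real d * R\<^sup>2"
proof -
  have "sqdist d (X j) (ctr 1 (asg 1 j)) \<le> real d * (2 * R)\<^sup>2" if j: "j < n" for j
  proof -
    have ne: "cl 1 (asg 1 j) \<noteq> {}" using j by (auto simp: cl_def)
    have "(X j l - ctr 1 (asg 1 j) l)\<^sup>2 \<le> (2 * R)\<^sup>2" if l: "l < d" for l
    proof -
      have "\<bar>ctr 1 (asg 1 j) l\<bar> \<le> R" using ne assms l by (intro abs_ctr_le) auto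
      then have "\<bar>X j l - ctr 1 (asg 1 j) l\<bar> \<le> 2 * R" using assms[OF j l] by linarith
      then show ?thesis by (rule power2_le_iff_abs_le[THEN iffD2, rotated]) (use assms[OF j l] in linarith)
    qed
    then have "(\<Sum>l<d. (X j l - ctr 1 (asg 1 j) l)\<^sup>2) \<le> (\<Sum>l<d. (2 * R)\<^sup>2)" by (intro sum_mono) auto
    then show ?thesis by (simp add: sqdist_def)
  qed
  then have "pot 1 \<le> (\<Sum>j<n. real d * (2 * R)\<^sup>2)" unfolding pot_def by (intro sum_mono) auto
  then show ?thesis by (simp add: power2_eq_square algebra_simps)
qed

text \<open>The points of the target cluster lie on the side of \<open>ctr t i'\<close> of the
  bisector, but their mean is within \<delta> of \<open>ctr t i\<close>, which lies on the other
  side. Nonnegative signed distances with a small average are all small, so the whole cluster is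
  close to the bisector.\<close>

lemma large_target_separated:
  assumes gen: "generic n d k c0 X" and d: "0 < d" and t: "1 \<le> t" and i: "i < k" "i' < k" "i \<noteq> i'"
    and ne: "cl t i \<noteq> {}" and large: "4 * (d + 1) \<le> card (cl (Suc t) i')"
    and near: "\<And>l. l < d \<Longrightarrow> \<bar>ctr (Suc t) i' l - ctr t i l\<bar> \<le> \<delta>"
  shows "slab_event n d \<delta> X"
proof -
  define u where "u = (\<lambda>l. ctr t i' l - ctr t i l)"
  define U where "U = Max ((\<lambda>l. \<bar>u l\<bar>) ` {..<d})"
  have fin: "finite ((\<lambda>l. \<bar>u l\<bar>) ` {..<d})" "(\<lambda>l. \<bar>u l\<bar>) ` {..<d} \<noteq> {}" using d by auto
  have uU: "\<bar>u l\<bar> \<le> U" if "l < d" for l unfolding U_def using fin that by (intro Max_ge) auto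
  obtain l0 where l0: "l0 < d" "\<bar>u l0\<bar> = U" using Max_in[OF fin] unfolding U_def by auto
  \<comment> \<open>Cluster \<open>i\<close> owns a point, so the two centers cannot coincide; hence
    \<open>U\<close> is positive and may be divided by.\<close>
  obtain l1 where "l1 < d" "u l1 \<noteq> 0"
    using pairwise_centers_distinct[OF gen i, of t t] ne t unfolding u_def by force
  then have U: "0 < U" using uU[of l1] by linarith
  define a where "a = (\<lambda>l. u l / U)"
  define s where "s = (\<Sum>l<d. a l * ((ctr t i l + ctr t i' l) / 2))"
  \<comment> \<open>\<open>g\<close> vanishes on the bisector of \<open>ctr t i\<close> and
    \<open>ctr t i'\<close>; \<open>2 * U * g\<close> is the difference of the squared distances to
    them.\<close>
  define g where "g = (\<lambda>y. (\<Sum>l<d. a l * y l) - s)"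
  let ?Q = "cl (Suc t) i'"
  have g_eq: "g y = (\<Sum>l<d. a l * (y l - (ctr t i l + ctr t i' l) / 2))" for y
    by (simp add: g_def s_def sum_subtractf algebra_simps)
  have a1: "\<bar>a l\<bar> \<le> 1" if "l < d" for l using uU[OF that] U by (simp add: a_def)
  have g0: "0 \<le> g (X j)" if "j \<in> ?Q" for j
  proof -
    have "sqdist d (X j) (ctr t i') \<le> sqdist d (X j) (ctr t i)"
      using asg_minimal[OF i(1), of j t] that by (simp add: cl_def)
    moreover have "sqdist d (X j) (ctr t i) - sqdist d (X j) (ctr t i') = 2 * U * g (X j)"
      unfolding sqdist_def sum_subtractf[symmetric] g_eq sum_distrib_left
      using U by (intro sum.cong) (auto simp: a_def u_def power2_eq_square field_simps)
    ultimately have "0 \<le> 2 * U * g (X j)" by simp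
    then show ?thesis using U by (simp add: zero_le_mult_iff)
  qed
  have "(\<Sum>j\<in>?Q. g (X j)) = (\<Sum>l<d. a l * (\<Sum>j\<in>?Q. X j l)) - real (card ?Q) * s"
    unfolding g_def sum_subtractf sum_distrib_left by (subst sum.swap) simp
  also have "\<dots> = real (card ?Q) * g (ctr (Suc t) i')"
    by (simp add: sum_cl g_def sum_distrib_left algebra_simps)
  finally have sumg: "(\<Sum>j\<in>?Q. g (X j)) = real (card ?Q) * g (ctr (Suc t) i')" .
  have "g (ctr (Suc t) i') = (\<Sum>l<d. a l * (ctr (Suc t) i' l - ctr t i l)) - (\<Sum>l<d. a l * u l / 2)"
    unfolding g_eq sum_subtractf[symmetric] by (intro sum.cong) (auto simp: u_def field_simps)
  also have "\<dots> \<le> (\<Sum>l<d. \<delta>) - 0"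
  proof (rule diff_mono)
    have "a l * (ctr (Suc t) i' l - ctr t i l) \<le> \<delta>" if "l < d" for l
    proof -
      have "a l * (ctr (Suc t) i' l - ctr t i l) \<le> \<bar>a l\<bar> * \<bar>ctr (Suc t) i' l - ctr t i l\<bar>"
        by (metis abs_ge_self abs_mult)
      also have "\<dots> \<le> 1 * \<delta>" using a1[OF that] near[OF that] by (intro mult_mono) auto
      finally show ?thesis by simp
    qed
    then show "(\<Sum>l<d. a l * (ctr (Suc t) i' l - ctr t i l)) \<le> (\<Sum>l<d. \<delta>)" by (intro sum_mono) auto
    show "0 \<le> (\<Sum>l<d. a l * u l / 2)" using U by (intro sum_nonneg) (auto simp: a_def)
  qed
  finally have gm: "g (ctr (Suc t) i') \<le> real d * \<delta>" by simp
  have \<delta>0: "0 \<le> \<delta>" using near[OF d] by linarith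
  have slab: "\<bar>(\<Sum>l<d. a l * X j l) - s\<bar> \<le> real n * real d * \<delta>" if "j \<in> ?Q" for j
  proof -
    have "g (X j) \<le> (\<Sum>j\<in>?Q. g (X j))" using that g0 by (intro member_le_sum) auto
    also have "\<dots> \<le> real (card ?Q) * (real d * \<delta>)" unfolding sumg using gm by (intro mult_left_mono) auto
    also have "\<dots> \<le> real n * (real d * \<delta>)" using card_cl_le \<delta>0 by (intro mult_right_mono) auto
    finally show ?thesis using g0[OF that] by (simp add: g_def mult.assoc)
  qed
  obtain T where T: "T \<subseteq> ?Q" "card T = 4 * (d + 1)" using obtain_subset_with_card_n[OF large] by metis
  have "\<bar>a l0\<bar> = 1" using l0 U by (simp add: a_def)
  then show ?thesis unfolding slab_event_def
    using T slab a1 l0 cl_subset[of "Suc t" i'] by (intro exI[of _ T]) blast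
qed

section \<open>Points that move within a window\<close>

definition moved :: "nat \<Rightarrow> nat \<Rightarrow> nat set" where
  "moved s m = {j. j < n \<and> (\<exists>t\<in>{s..<s + m}. asg t j \<noteq> asg (Suc t) j)}"

lemma asg_unmoved:
  assumes "j < n" "j \<notin> moved s m" "t \<in> {s..s + m}" "t' \<in> {s..s + m}"
  shows "asg t j = asg t' j"
proof -
  have "asg t j = asg s j" if "t \<in> {s..s + m}" for t
  proof -
    from that have "s \<le> t" "t \<le> s + m" by auto
    then show ?thesis
    proof (induction t rule: dec_induct)
      case (step u)
      then have "asg u j = asg (Suc u) j" using assms(1,2) by (auto simp: moved_def)
      then show ?case using step by simp
    qed simp
  qed
  then show ?thesis using assms by metis
qed

text \<open>Within the window a cluster consists of a fixed part \<open>D\<close> and its moving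
  points, so the sum over the latter is \<open>N t * ctr t i l\<close> minus a constant. The
  constant cancels in differences, and once all centers are replaced by \<open>ctr t0 i\<close> the
  coefficients annihilate the rest. The error is a sum of two products: a difference of sizes, at
  most n in absolute value, times a size times a displacement, at most n * \<rho>.\<close>

lemma sum_relation_coeff_le:
  assumes s: "1 \<le> s" and i: "i < k" and l: "l < d" and \<epsilon>: "pot s - pot (s + m) \<le> \<epsilon>" "0 \<le> \<epsilon>"
    and t: "t0 \<in> {s..s + m}" "t1 \<in> {s..s + m}" "t2 \<in> {s..s + m}"
  shows "\<bar>\<Sum>j<n. relation_coeff (cl t0 i \<inter> moved s m, cl t1 i \<inter> moved s m, cl t2 i \<inter> moved s m) j * X j l\<bar>
     \<le> 2 * (real n)\<^sup>2 * (real m * sqrt \<epsilon>)"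
proof -
  let ?M = "moved s m"
  let ?\<rho> = "real m * sqrt \<epsilon>"
  define g where "g = (\<lambda>t. \<Sum>j<n. indicator (cl t i \<inter> ?M) j * X j l)"
  define N where "N = (\<lambda>t. real (card (cl t i)))"
  define D where "D = cl t0 i - ?M"
  have D: "cl t i - ?M = D" if "t \<in> {s..s + m}" for t
    using asg_unmoved[OF _ _ that t(1)] by (auto simp: D_def cl_def)
  have card: "real (card (cl t i \<inter> ?M)) = N t - real (card D)" if "t \<in> {s..s + m}" for t
  proof -
    have "card (cl t i \<inter> ?M) + card (cl t i - ?M) = card (cl t i)"
      by (subst card_Un_disjoint[symmetric]) (auto intro!: arg_cong[where f=card])
    then show ?thesis using D[OF that] by (simp add: N_def)
  qed
  have g: "g t = N t * ctr t i l - (\<Sum>j\<in>D. X j l)" if "t \<in> {s..s + m}" for t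
  proof -
    have "g t = (\<Sum>j\<in>cl t i \<inter> ?M. X j l)"
      unfolding g_def indicator_def
      by (rule sum.mono_neutral_cong_right) (auto simp: cl_def)
    moreover have "(\<Sum>j\<in>cl t i. X j l) = (\<Sum>j\<in>cl t i \<inter> ?M. X j l) + (\<Sum>j\<in>cl t i - ?M. X j l)"
      by (subst sum.union_disjoint[symmetric]) (auto intro!: sum.cong)
    ultimately show ?thesis using D[OF that] sum_cl[of t, where i=i and l=l] s that by (simp add: N_def)
  qed
  have move: "\<bar>ctr t i l - ctr t0 i l\<bar> \<le> ?\<rho>" if "t \<in> {s..s + m}" for t
    using that t(1) s i l \<epsilon> by (intro center_move_window') auto
  have Nn: "0 \<le> N t" "N t \<le> real n" for t using card_cl_le by (auto simp: N_def)
  have \<rho>: "0 \<le> ?\<rho>" using \<epsilon> by simp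
  have small: "\<bar>N t * (ctr t i l - ctr t0 i l)\<bar> \<le> real n * ?\<rho>" if "t \<in> {s..s + m}" for t
    unfolding abs_mult using Nn move[OF that] by (intro mult_mono) auto
  have gdiff: "g t - g t0 = (N t - N t0) * ctr t0 i l + N t * (ctr t i l - ctr t0 i l)" if "t \<in> {s..s + m}" for t
    using g[OF that] g[OF t(1)] by (simp add: algebra_simps)
  \<comment> \<open>If the three sets have equal size, the relation is a plain difference with error
    n * \<rho>; this fits it under the common bound.\<close>
  have nn: "real n * ?\<rho> \<le> 2 * (real n)\<^sup>2 * ?\<rho>"
  proof (cases "n = 0")
    case False
    then have "real n * 1 \<le> real n * (2 * real n)" by (intro mult_left_mono) auto
    then have "real n \<le> 2 * (real n)\<^sup>2" by (simp add: power2_eq_square)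
    then show ?thesis using \<rho> by (rule mult_right_mono)
  qed simp
  let ?e1 = "N t1 - N t0" and ?e2 = "N t2 - N t0"
  have e: "real (card (cl t1 i \<inter> ?M)) - real (card (cl t0 i \<inter> ?M)) = ?e1"
    "real (card (cl t2 i \<inter> ?M)) - real (card (cl t0 i \<inter> ?M)) = ?e2" using card t by auto
  show ?thesis
  proof (cases "?e1 = 0 \<and> ?e2 = 0")
    case True
    then have "(\<Sum>j<n. relation_coeff (cl t0 i \<inter> ?M, cl t1 i \<inter> ?M, cl t2 i \<inter> ?M) j * X j l) = g t1 - g t0"
      unfolding g_def sum_subtractf[symmetric] relation_coeff_def Let_def prod.case e
      by (intro sum.cong) (auto simp: left_diff_distrib)
    also have "\<bar>\<dots>\<bar> \<le> real n * ?\<rho>" using gdiff[OF t(2)] True small[OF t(2)] by simp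
    finally show ?thesis using nn by linarith
  next
    case False
    have "(\<Sum>j<n. relation_coeff (cl t0 i \<inter> ?M, cl t1 i \<inter> ?M, cl t2 i \<inter> ?M) j * X j l)
       = (\<Sum>j<n. ?e2 * (indicator (cl t1 i \<inter> ?M) j * X j l) - ?e2 * (indicator (cl t0 i \<inter> ?M) j * X j l)
          - ?e1 * (indicator (cl t2 i \<inter> ?M) j * X j l) + ?e1 * (indicator (cl t0 i \<inter> ?M) j * X j l))"
    proof (intro sum.cong refl)
      fix j
      have rv: "relation_coeff (cl t0 i \<inter> ?M, cl t1 i \<inter> ?M, cl t2 i \<inter> ?M) j =
        ?e2 * (indicator (cl t1 i \<inter> ?M) j - indicator (cl t0 i \<inter> ?M) j)
        - ?e1 * (indicator (cl t2 i \<inter> ?M) j - indicator (cl t0 i \<inter> ?M) j)"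
        unfolding relation_coeff_def Let_def prod.case e using False by (simp only: if_False)
      show "relation_coeff (cl t0 i \<inter> ?M, cl t1 i \<inter> ?M, cl t2 i \<inter> ?M) j * X j l =
        ?e2 * (indicator (cl t1 i \<inter> ?M) j * X j l) - ?e2 * (indicator (cl t0 i \<inter> ?M) j * X j l)
          - ?e1 * (indicator (cl t2 i \<inter> ?M) j * X j l) + ?e1 * (indicator (cl t0 i \<inter> ?M) j * X j l)"
        unfolding rv by (simp only: algebra_simps)
    qed
    also have "\<dots> = ?e2 * (g t1 - g t0) - ?e1 * (g t2 - g t0)"
      unfolding sum.distrib sum_subtractf sum_distrib_left[symmetric] g_def by (simp add: algebra_simps)
    also have "\<dots> = ?e2 * (N t1 * (ctr t1 i l - ctr t0 i l)) - ?e1 * (N t2 * (ctr t2 i l - ctr t0 i l))"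
      unfolding gdiff[OF t(2)] gdiff[OF t(3)] by (simp add: algebra_simps)
    also have "\<bar>\<dots>\<bar> \<le> \<bar>?e2 * (N t1 * (ctr t1 i l - ctr t0 i l))\<bar> + \<bar>?e1 * (N t2 * (ctr t2 i l - ctr t0 i l))\<bar>"
      by (rule abs_triangle_ineq4)
    also have "\<dots> \<le> real n * (real n * ?\<rho>) + real n * (real n * ?\<rho>)"
      unfolding abs_mult[of ?e1] abs_mult[of ?e2]
      by (intro add_mono mult_mono small t) (use Nn[of t0] Nn[of t1] Nn[of t2] in auto)
    also have "\<dots> = 2 * (real n)\<^sup>2 * ?\<rho>" by (simp add: power2_eq_square)
    finally show ?thesis .
  qed
qed

text \<open>The three clusters agree on the unmoved points, so cutting them down to moved points
  keeps them distinct and yields a pivot among the moved points. As the coefficients vanish on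
  \<open>S\<close>, the pivot is new.\<close>

lemma relation_exists:
  assumes s: "1 \<le> s" and run: "\<And>u. 1 \<le> u \<Longrightarrow> u \<le> s + m \<Longrightarrow> \<not> stops u"
    and \<epsilon>: "pot s - pot (s + m) \<le> \<epsilon>" "0 \<le> \<epsilon>"
    and S: "S \<subseteq> moved s m" "k ^ card S * 2 ^ k \<le> m"
  shows "\<exists>B\<in>Pow (moved s m) \<times> Pow (moved s m) \<times> Pow (moved s m). (\<forall>j\<in>S. relation_coeff B j = 0) \<and>
    (\<exists>p\<in>moved s m. 1 \<le> \<bar>relation_coeff B p\<bar>) \<and>
    (\<forall>l<d. \<bar>\<Sum>j<n. relation_coeff B j * X j l\<bar> \<le> 2 * (real n)\<^sup>2 * (real m * sqrt \<epsilon>))"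
proof -
  let ?M = "moved s m"
  have Mn: "?M \<subseteq> {..<n}" by (auto simp: moved_def)
  have "\<exists>i<k. \<exists>t0\<in>{s..s + m}. \<exists>t1\<in>{s..s + m}. \<exists>t2\<in>{s..s + m}. (\<forall>j\<in>S. asg t0 j = asg t1 j \<and> asg t0 j = asg t2 j) \<and>
     {j. j < n \<and> asg t0 j = i} \<noteq> {j. j < n \<and> asg t1 j = i} \<and>
     {j. j < n \<and> asg t0 j = i} \<noteq> {j. j < n \<and> asg t2 j = i} \<and>
     {j. j < n \<and> asg t1 j = i} \<noteq> {j. j < n \<and> asg t2 j = i}"
  \<comment> \<open>A window of \<open>m\<close> iterations contains \<open>m + 1\<close>
    assignments, which gives the strict inequality that the pigeonhole needs.\<close>
  proof (rule pigeonhole_three_classes)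
    show "asg t j < k" if "t \<in> {s..s + m}" for t j using that s by (intro asg_less) auto
    show "\<exists>j<n. asg t j \<noteq> asg t' j" if "t \<in> {s..s + m}" "t' \<in> {s..s + m}" "t < t'" for t t'
      using that s run by (intro asg_distinct[of "s + m"]) auto
    show "S \<subseteq> {..<n}" using S Mn by blast
  qed (use S in auto)
  then obtain i t0 t1 t2 where i: "i < k" and t: "t0 \<in> {s..s + m}" "t1 \<in> {s..s + m}" "t2 \<in> {s..s + m}"
    and agree: "\<forall>j\<in>S. asg t0 j = asg t1 j \<and> asg t0 j = asg t2 j"
    and ne: "cl t0 i \<noteq> cl t1 i" "cl t0 i \<noteq> cl t2 i" "cl t1 i \<noteq> cl t2 i"
    unfolding cl_def by blast
  have outside: "cl t i - ?M = cl t0 i - ?M" if "t \<in> {s..s + m}" for t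
    using asg_unmoved[OF _ _ that t(1)] by (auto simp: cl_def)
  let ?B = "(cl t0 i \<inter> ?M, cl t1 i \<inter> ?M, cl t2 i \<inter> ?M)"
  have "cl t0 i \<inter> ?M \<noteq> cl t1 i \<inter> ?M" "cl t0 i \<inter> ?M \<noteq> cl t2 i \<inter> ?M" "cl t1 i \<inter> ?M \<noteq> cl t2 i \<inter> ?M"
    using ne outside[OF t(2)] outside[OF t(3)] by blast+
  then have "\<exists>p\<in>?M. 1 \<le> \<bar>relation_coeff ?B p\<bar>" using relation_coeff_pivot[of "cl t0 i \<inter> ?M" "cl t1 i \<inter> ?M" "cl t2 i \<inter> ?M"] by blast
  moreover have "\<forall>j\<in>S. relation_coeff ?B j = 0"
  proof
    fix j assume "j \<in> S"
    then show "relation_coeff ?B j = 0" using agree by (intro relation_coeff_eq_0) (auto simp: cl_def)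
  qed
  moreover have "\<forall>l<d. \<bar>\<Sum>j<n. relation_coeff ?B j * X j l\<bar> \<le> 2 * (real n)\<^sup>2 * (real m * sqrt \<epsilon>)"
    using sum_relation_coeff_le[OF s i _ \<epsilon> t] by blast
  ultimately show ?thesis by (intro bexI[of _ ?B]) auto
qed

text \<open>The first relation found gets the largest index. Its pivot joins \<open>S\<close> before
  the others are sought, so they vanish there. \<open>S\<close> grows by one point per relation,
  whence the exponent \<open>card S + b\<close> in the window length.\<close>

lemma triangular_relations_exist:
  assumes s: "1 \<le> s" and run: "\<And>u. 1 \<le> u \<Longrightarrow> u \<le> s + m \<Longrightarrow> \<not> stops u"
    and \<epsilon>: "pot s - pot (s + m) \<le> \<epsilon>" "0 \<le> \<epsilon>"
    and m: "k ^ (card S + b) * 2 ^ k \<le> m" and S: "S \<subseteq> moved s m"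
  shows "\<exists>B J. (\<forall>r<b. B r \<in> Pow (moved s m) \<times> Pow (moved s m) \<times> Pow (moved s m) \<and> (\<forall>j\<in>S. relation_coeff (B r) j = 0)) \<and>
    triangular n b B J \<and>
    (\<forall>r<b. \<forall>l<d. \<bar>\<Sum>j<n. relation_coeff (B r) j * X j l\<bar> \<le> 2 * (real n)\<^sup>2 * (real m * sqrt \<epsilon>))"
  using m S
proof (induction b arbitrary: S)
  case 0
  then show ?case by (auto simp: triangular_def)
next
  case (Suc b)
  let ?P = "Pow (moved s m) \<times> Pow (moved s m) \<times> Pow (moved s m)"
  have Mn: "moved s m \<subseteq> {..<n}" by (auto simp: moved_def)
  have finS: "finite S" by (rule finite_subset[OF subset_trans[OF Suc.prems(2) Mn]]) simp
  have "k ^ card S * 2 ^ k \<le> k ^ (card S + Suc b) * 2 ^ k"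
    using k_pos by (intro mult_right_mono power_increasing) auto
  then have "k ^ card S * 2 ^ k \<le> m" using Suc.prems(1) by linarith
  from relation_exists[OF s run \<epsilon> Suc.prems(2) this] obtain B' p where
    B': "B' \<in> ?P" "\<forall>j\<in>S. relation_coeff B' j = 0" "p \<in> moved s m" "1 \<le> \<bar>relation_coeff B' p\<bar>"
    "\<forall>l<d. \<bar>\<Sum>j<n. relation_coeff B' j * X j l\<bar> \<le> 2 * (real n)\<^sup>2 * (real m * sqrt \<epsilon>)" by blast
  have "k ^ (card (insert p S) + b) * 2 ^ k \<le> k ^ (card S + Suc b) * 2 ^ k"
    using k_pos finS by (intro mult_right_mono power_increasing) (auto simp: card_insert_if)
  then have "k ^ (card (insert p S) + b) * 2 ^ k \<le> m" using Suc.prems(1) by linarith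
  from Suc.IH[OF this] Suc.prems(2) B'(3) obtain B J where
    B: "\<forall>r<b. B r \<in> ?P \<and> (\<forall>j\<in>insert p S. relation_coeff (B r) j = 0)" "triangular n b B J"
      "\<forall>r<b. \<forall>l<d. \<bar>\<Sum>j<n. relation_coeff (B r) j * X j l\<bar> \<le> 2 * (real n)\<^sup>2 * (real m * sqrt \<epsilon>)" by blast
  have "triangular n (Suc b) (B(b := B')) (J(b := p))"
    using B(1,2) B'(3,4) Mn by (auto simp: triangular_def less_Suc_eq)
  moreover have "(B(b := B')) r \<in> ?P \<and> (\<forall>j\<in>S. relation_coeff ((B(b := B')) r) j = 0)" if "r < Suc b" for r
    using that B(1) B'(1,2) by (cases "r = b") (simp_all add: less_Suc_eq)
  moreover have "\<bar>\<Sum>j<n. relation_coeff ((B(b := B')) r) j * X j l\<bar> \<le> 2 * (real n)\<^sup>2 * (real m * sqrt \<epsilon>)"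
    if "r < Suc b" "l < d" for r l
    using that B(3) B'(5) by (cases "r = b") (simp_all add: less_Suc_eq)
  ultimately show ?case by (intro exI[of _ "B(b := B')"] exI[of _ "J(b := p)"]) (simp del: fun_upd_apply)
qed

text \<open>If the small sets taken by cluster \<open>i\<close> covered more points, three of them
  could be picked greedily, each with a point outside its predecessors. Their means are positions of
  one center, hence close to each other.\<close>

lemma small_target_count:
  assumes s: "1 \<le> s" and \<epsilon>: "pot s - pot (s + m) \<le> \<epsilon>" "0 \<le> \<epsilon>"
    and no: "\<not> means_event n d (real m * sqrt \<epsilon>) X" and i: "i < k"
  shows "card (\<Union> {P. \<exists>t\<in>{s..s + m}. P = cl t i \<and> P \<in> small_sets n d}) \<le> 2 * (4 * d + 3)"
proof (rule ccontr)
  let ?F = "{P. \<exists>t\<in>{s..s + m}. P = cl t i \<and> P \<in> small_sets n d}"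
  assume "\<not> ?thesis"
  then have big: "2 * (4 * d + 3) < card (\<Union>?F)" by simp
  have fin: "finite P" if "P \<in> ?F" for P using that by (auto simp: small_sets_def)
  have cd: "card P \<le> 4 * d + 3" if "P \<in> ?F" for P using that by (auto simp: small_sets_def)
  have ex: "\<exists>P\<in>?F. \<not> P \<subseteq> Q" if "finite Q" "card Q \<le> 2 * (4 * d + 3)" for Q
  proof (rule ccontr)
    assume "\<not> ?thesis"
    then have "\<Union>?F \<subseteq> Q" by blast
    then have "card (\<Union>?F) \<le> card Q" by (rule card_mono[OF that(1)])
    then show False using big that by simp
  qed
  obtain P0 where P0: "P0 \<in> ?F" using ex[of "{}"] by auto
  obtain P1 where P1: "P1 \<in> ?F" "\<not> P1 \<subseteq> P0" using ex[of P0] fin[OF P0] cd[OF P0] by auto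
  have "card (P0 \<union> P1) \<le> 2 * (4 * d + 3)" 
    using order_trans[OF card_Un_le[of P0 P1] add_mono[OF cd[OF P0] cd[OF P1(1)]]] by simp
  then obtain P2 where P2: "P2 \<in> ?F" "\<not> P2 \<subseteq> P0 \<union> P1" using ex[of "P0 \<union> P1"] fin[OF P0] fin[OF P1(1)] by auto
  have near: "\<bar>mean X P l - mean X P0 l\<bar> \<le> real m * sqrt \<epsilon>" if PF: "P \<in> ?F" "l < d" for P l
  proof -
    obtain t where t: "t \<in> {s..s + m}" "P = cl t i" "P \<noteq> {}" using PF unfolding small_sets_def by blast
    obtain t0 where t0: "t0 \<in> {s..s + m}" "P0 = cl t0 i" "P0 \<noteq> {}" using P0 unfolding small_sets_def by blast
    have "mean X P = ctr t i" "mean X P0 = ctr t0 i" using t t0 s by (auto intro!: mean_cl)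
    then show ?thesis using t t0 s \<epsilon> i PF by (simp add: center_move_window')
  qed
  have "P0 \<in> small_sets n d" "P1 \<in> small_sets n d" "P2 \<in> small_sets n d" using P0 P1 P2 by auto
  then have "means_event n d (real m * sqrt \<epsilon>) X" unfolding means_event_def
    using P1 P2 near[OF P1(1)] near[OF P2(1)] by blast
  then show False using no by simp
qed

text \<open>The constant 22 is 16 + 6. For each cluster index, the sets it takes while small cover
  at most \<open>2 * (4 * d + 3) \<le> 16 * d\<close> points. Of \<open>22 * d * k\<close> moved
  points there remain \<open>6 * d * k\<close> whose moves all have large targets; each of them is
  close to a bisector.\<close>

theorem window_events:
  assumes d: "0 < d" and gen: "generic n d k c0 X"
    and R: "0 \<le> R" "\<And>j l. j < n \<Longrightarrow> l < d \<Longrightarrow> \<bar>X j l\<bar> \<le> R"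
    and s: "1 \<le> s" and run: "\<And>u. 1 \<le> u \<Longrightarrow> u \<le> s + m \<Longrightarrow> \<not> stops u"
    and \<epsilon>: "pot s - pot (s + m) \<le> \<epsilon>" "0 \<le> \<epsilon>" and m: "k ^ b * 2 ^ k \<le> m"
    and \<rho>: "\<rho> = real m * sqrt \<epsilon>" "\<rho> \<le> R" "\<epsilon> \<le> real d * R * \<rho>"
  shows "slab_event n d \<delta> X \<or> means_event n d \<rho> X \<or> bisector_event n d k R \<rho> \<delta> X \<or>
    relation_event n d (22 * d * k) b \<rho> X"
proof (rule ccontr)
  assume neg: "\<not> ?thesis"
  let ?M = "moved s m"
  have Mn: "?M \<subseteq> {..<n}" by (auto simp: moved_def)
  have finM: "finite ?M" using Mn finite_subset by blast
  have \<rho>0: "0 \<le> \<rho>" using \<rho>(1) \<epsilon>(2) by simp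
  have move: "\<bar>ctr t i l - ctr t' i l\<bar> \<le> \<rho>" if "t \<in> {s..s + m}" "t' \<in> {s..s + m}" "i < k" "l < d" for t t' i l
    unfolding \<rho>(1) using that s \<epsilon> by (intro center_move_window') auto
  have cardM: "22 * d * k \<le> card ?M"
  proof (rule ccontr)
    assume "\<not> ?thesis"
    then have "card ?M < 22 * d * k" by simp
    moreover have "\<exists>B J. (\<forall>r<b. B r \<in> Pow ?M \<times> Pow ?M \<times> Pow ?M \<and> (\<forall>j\<in>{}. relation_coeff (B r) j = 0)) \<and>
      triangular n b B J \<and> (\<forall>r<b. \<forall>l<d. \<bar>\<Sum>j<n. relation_coeff (B r) j * X j l\<bar> \<le> 2 * (real n)\<^sup>2 * (real m * sqrt \<epsilon>))"
      by (rule triangular_relations_exist[OF s run \<epsilon>]) (use m in auto)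
    ultimately have "relation_event n d (22 * d * k) b \<rho> X"
      unfolding relation_event_def \<rho>(1) using Mn by (intro exI[of _ ?M]) (simp del: mem_Sigma_iff)
    then show False using neg by blast
  qed
  define Sm where "Sm = (\<Union>i<k. \<Union> {P. \<exists>t\<in>{s..s + m}. P = cl t i \<and> P \<in> small_sets n d})"
  have "card Sm \<le> (\<Sum>i<k. card (\<Union> {P. \<exists>t\<in>{s..s + m}. P = cl t i \<and> P \<in> small_sets n d}))"
    unfolding Sm_def by (rule card_UN_le) simp
  also have "\<dots> \<le> (\<Sum>i<k. 2 * (4 * d + 3))"
    using neg \<rho>(1) by (intro sum_mono small_target_count[OF s \<epsilon>]) auto
  also have "\<dots> \<le> 16 * d * k"
  proof -
    have "2 * (4 * d + 3) \<le> 16 * d" using d by simp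
    then have "k * (2 * (4 * d + 3)) \<le> k * (16 * d)" by (rule mult_le_mono2)
    then show ?thesis by (simp add: mult_ac)
  qed
  finally have cardS: "card Sm \<le> 16 * d * k" .
  have finS: "finite Sm"
  proof (rule finite_subset)
    show "Sm \<subseteq> {..<n}" unfolding Sm_def using cl_subset by blast
  qed simp
  have "card ?M \<le> card (?M - Sm) + card Sm"
    using card_Diff_subset_Int[of ?M Sm] finM card_mono[OF finS, of "?M \<inter> Sm"] by simp
  then have "6 * d * k \<le> card (?M - Sm)" using cardM cardS by linarith
  then obtain T where T: "T \<subseteq> ?M - Sm" "card T = 6 * d * k" using obtain_subset_with_card_n by metis
  \<comment> \<open>A center that owns no point during the window may lie anywhere, for instance at
    a remote initial position. It takes part in no move and is replaced by 0, which keeps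
    \<open>C\<close> in a bounded box. An active center is a mean at some time, hence within
    \<open>R + \<rho> \<le> 2 * R\<close> throughout.\<close>
  define act where "act = (\<lambda>i. \<exists>t\<in>{s..s + m}. cl t i \<noteq> {})"
  define C where "C = (\<lambda>i. if act i then ctr s i else (\<lambda>l. 0))"
  have ctr_le: "\<bar>ctr t i l\<bar> \<le> 2 * R" if ai: "act i" "t \<in> {s..s + m}" "i < k" "l < d" for i l t
  proof -
    obtain t' where t': "t' \<in> {s..s + m}" "cl t' i \<noteq> {}" using ai(1) unfolding act_def by blast
    have "\<bar>ctr t' i l\<bar> \<le> R" using t' s R ai by (intro abs_ctr_le) auto
    then show ?thesis using move[OF ai(2) t'(1) ai(3,4)] \<rho>(2) by linarith
  qed
  have C_le: "\<bar>C i l\<bar> \<le> 2 * R" if "i < k" "l < d" for i l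
    using ctr_le[of i s l] that R(1) by (simp add: C_def)
  have "\<exists>i<k. \<exists>i'<k. (\<exists>l<d. \<delta> - 3 * \<rho> \<le> \<bar>C i l - C i' l\<bar>) \<and>
          \<bar>sqdist d (X j) (C i) - sqdist d (X j) (C i')\<bar> \<le> 13 * real d * R * \<rho>" if jT: "j \<in> T" for j
  proof -
    have jM: "j \<in> ?M" "j \<notin> Sm" using jT T by auto
    then obtain t where t: "s \<le> t" "t < s + m" "asg t j \<noteq> asg (Suc t) j" and jn: "j < n"
      by (auto simp: moved_def)
    define i i' where "i = asg t j" and "i' = asg (Suc t) j"
    have ii: "i < k" "i' < k" "i \<noteq> i'" using t s asg_less by (auto simp: i_def i'_def)
    have ne: "cl t i \<noteq> {}" "cl (Suc t) i' \<noteq> {}" using jn by (auto simp: i_def i'_def cl_def)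
    have tt: "t \<in> {s..s + m}" "Suc t \<in> {s..s + m}" "s \<in> {s..s + m}" using t by auto
    have large: "4 * (d + 1) \<le> card (cl (Suc t) i')"
    proof (rule ccontr)
      assume "\<not> ?thesis"
      then have "cl (Suc t) i' \<in> small_sets n d" using ne cl_subset by (auto simp: small_sets_def)
      moreover have "j \<in> cl (Suc t) i'" using jn by (simp add: cl_def i'_def)
      ultimately have "j \<in> Sm" unfolding Sm_def using tt ii by blast
      then show False using jM by simp
    qed
    have "\<exists>l<d. \<delta> < \<bar>ctr (Suc t) i' l - ctr t i l\<bar>"
    proof (rule ccontr)
      assume "\<not> ?thesis"
      then have "slab_event n d \<delta> X"
        using t s by (intro large_target_separated[OF gen d _ ii ne(1) large]) auto
      then show False using neg by blast
    qed
    then obtain l where l: "l < d" "\<delta> < \<bar>ctr (Suc t) i' l - ctr t i l\<bar>" by blast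
    have act: "act i" "act i'" using ne tt by (auto simp: act_def)
    have CC: "C i = ctr s i" "C i' = ctr s i'" using act by (auto simp: C_def)
    have sep: "\<delta> - 3 * \<rho> \<le> \<bar>C i l - C i' l\<bar>"
      unfolding CC using l(2) move[OF tt(2,3) ii(2) l(1)] move[OF tt(1,3) ii(1) l(1)] \<rho>0 by linarith
    have app: "\<bar>sqdist d (X j) (ctr s a) - sqdist d (X j) (ctr t a)\<bar> \<le> real d * (\<rho> * (2 * R + 2 * R + 2 * R))"
      if "a < k" "act a" for a
      using that R(2)[OF jn] ctr_le tt move by (intro abs_sqdist_diff_le) auto
    have "pot t - pot (Suc t) \<le> \<epsilon>"
      using pot_antimono[of s t] pot_antimono[of "Suc t" "s + m"] t s \<epsilon>(1) by simp
    then have "sqdist d (X j) (ctr t i) - sqdist d (X j) (ctr t i') \<le> \<epsilon>"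
      using reassign_le_pot_diff[of t j] t s jn by (simp add: i_def i'_def)
    moreover have "0 \<le> sqdist d (X j) (ctr t i) - sqdist d (X j) (ctr t i')"
      using reassign_nonneg[of t j] t s by (simp add: i_def i'_def)
    ultimately have "\<bar>sqdist d (X j) (C i) - sqdist d (X j) (C i')\<bar> \<le> \<epsilon> + 2 * (real d * (\<rho> * (2 * R + 2 * R + 2 * R)))"
      unfolding CC using app[OF ii(1) act(1)] app[OF ii(2) act(2)] by linarith
    \<comment> \<open>13 = 1 + 2 * 6: \<epsilon> is at most \<open>real d * R * \<rho>\<close>, and
      freezing each of the two centers costs six times as much.\<close>
    also have "\<dots> \<le> 13 * real d * R * \<rho>" using \<rho>(3) by (simp add: algebra_simps)
    finally show ?thesis using ii l(1) sep by blast
  qed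
  then have "bisector_event n d k R \<rho> \<delta> X" unfolding bisector_event_def
    using T Mn C_le by (intro exI[of _ T]) blast
  then show False using neg by blast
qed

end

section \<open>Probability of linear relations\<close>

text \<open>An outer-measure bound, so that no measurability of the events has to be established.\<close>

definition outer_le :: "'a measure \<Rightarrow> ('a \<Rightarrow> bool) \<Rightarrow> real \<Rightarrow> bool" where
  "outer_le M P B \<longleftrightarrow> (\<exists>A\<in>sets M. {X \<in> space M. P X} \<subseteq> A \<and> emeasure M A \<le> ennreal B)"

lemma outer_leI:
  "{X \<in> space M. P X} \<subseteq> A \<Longrightarrow> A \<in> sets M \<Longrightarrow> emeasure M A \<le> ennreal B \<Longrightarrow> outer_le M P B"
  by (auto simp: outer_le_def)

lemma outer_le_mono:
  assumes "outer_le M P B" "\<And>X. X \<in> space M \<Longrightarrow> Q X \<Longrightarrow> P X" "B \<le> B'"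
  shows "outer_le M Q B'"
proof -
  obtain A where "A \<in> sets M" "{X \<in> space M. P X} \<subseteq> A" "emeasure M A \<le> ennreal B"
    using assms(1) by (auto simp: outer_le_def)
  then show ?thesis using assms(2,3) by (intro outer_leI[of M Q A]) (auto intro: order_trans ennreal_leI)
qed

lemma outer_le_one: "prob_space M \<Longrightarrow> 1 \<le> B \<Longrightarrow> outer_le M P B"
  by (rule outer_leI[of _ _ "space M"]) (auto simp: prob_space.emeasure_space_1)

lemma outer_le_Bex:
  assumes "finite I" "0 \<le> B" "\<And>i. i \<in> I \<Longrightarrow> outer_le M (P i) B"
  shows "outer_le M (\<lambda>X. \<exists>i\<in>I. P i X) (real (card I) * B)"
proof -
  have "\<forall>i\<in>I. \<exists>A. A \<in> sets M \<and> {X \<in> space M. P i X} \<subseteq> A \<and> emeasure M A \<le> ennreal B"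
    using assms(3) by (auto simp: outer_le_def)
  then obtain A where A: "\<And>i. i \<in> I \<Longrightarrow> A i \<in> sets M \<and> {X \<in> space M. P i X} \<subseteq> A i \<and> emeasure M (A i) \<le> ennreal B"
    by metis
  have "emeasure M (\<Union>i\<in>I. A i) \<le> (\<Sum>i\<in>I. emeasure M (A i))"
    using A assms(1) by (intro emeasure_subadditive_finite) auto
  also have "\<dots> \<le> (\<Sum>i\<in>I. ennreal B)" using A by (intro sum_mono) auto
  also have "\<dots> = ennreal (real (card I) * B)"
    using assms(2) by (simp add: ennreal_mult ennreal_of_nat_eq_real_of_nat)
  finally show ?thesis using A assms(1) by (intro outer_leI[of _ _ "\<Union>i\<in>I. A i"]) auto
qed

lemma outer_le_disj:
  assumes "outer_le M P B" "outer_le M Q B'" "0 \<le> B" "0 \<le> B'"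
  shows "outer_le M (\<lambda>X. P X \<or> Q X) (B + B')"
proof -
  obtain A where A: "A \<in> sets M" "{X \<in> space M. P X} \<subseteq> A" "emeasure M A \<le> ennreal B"
    using assms(1) by (auto simp: outer_le_def)
  obtain A' where A': "A' \<in> sets M" "{X \<in> space M. Q X} \<subseteq> A'" "emeasure M A' \<le> ennreal B'"
    using assms(2) by (auto simp: outer_le_def)
  have "emeasure M (A \<union> A') \<le> emeasure M A + emeasure M A'" using A A' by (intro emeasure_subadditive)
  also have "\<dots> \<le> ennreal (B + B')" using A(3) A'(3) assms by (simp add: add_mono)
  finally show ?thesis using A A' by (intro outer_leI[of _ _ "A \<union> A'"]) auto
qed

text \<open>A set with at most \<open>q\<close> elements is the content of \<open>q\<close> slots,
  each holding an element of \<open>A\<close> or nothing.\<close>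

lemma card_bounded_subsets:
  assumes "finite A"
  shows "finite {M. M \<subseteq> A \<and> card M \<le> q}" "card {M. M \<subseteq> A \<and> card M \<le> q} \<le> (card A + 1) ^ q"
proof -
  let ?F = "\<Pi>\<^sub>E i\<in>{..<q}. insert None (Some ` A)"
  show fin: "finite {M. M \<subseteq> A \<and> card M \<le> q}" using assms by simp
  have "{M. M \<subseteq> A \<and> card M \<le> q} \<subseteq> (\<lambda>f. {x. \<exists>i<q. f i = Some x}) ` ?F"
  proof
    fix M assume "M \<in> {M. M \<subseteq> A \<and> card M \<le> q}"
    then have M: "M \<subseteq> A" "card M \<le> q" by auto
    then have finM: "finite M" using assms finite_subset by blast
    obtain e where e: "bij_betw e {0..<card M} M" using ex_bij_betw_nat_finite[OF finM] by blast
    define f where "f = (\<lambda>i\<in>{..<q}. if i < card M then Some (e i) else None)"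
    have "e i \<in> A" if "i < card M" for i using e that M(1) by (auto simp: bij_betw_def)
    then have "f \<in> ?F" by (auto simp: f_def)
    moreover have "{x. \<exists>i<q. f i = Some x} = e ` {0..<card M}"
    proof (intro set_eqI iffI)
      fix x assume "x \<in> {x. \<exists>i<q. f i = Some x}"
      then obtain i where i: "i < q" "f i = Some x" by blast
      then have "i < card M" "e i = x" by (cases "i < card M"; simp add: f_def)+
      then show "x \<in> e ` {0..<card M}" by auto
    next
      fix x assume "x \<in> e ` {0..<card M}"
      then obtain i where "i < card M" "x = e i" by auto
      then have "i < q" "f i = Some x" using M(2) by (simp_all add: f_def)
      then show "x \<in> {x. \<exists>i<q. f i = Some x}" by blast
    qed
    then have "{x. \<exists>i<q. f i = Some x} = M" using e by (simp add: bij_betw_def)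
    ultimately show "M \<in> (\<lambda>f. {x. \<exists>i<q. f i = Some x}) ` ?F" by blast
  qed
  then have "card {M. M \<subseteq> A \<and> card M \<le> q} \<le> card ?F"
    using assms by (intro surj_card_le[where f="\<lambda>f. {x. \<exists>i<q. f i = Some x}"] finite_PiE) auto
  also have "\<dots> = (card A + 1) ^ q"
    using assms by (simp add: card_PiE card_insert_if card_image image_iff)
  finally show "card {M. M \<subseteq> A \<and> card M \<le> q} \<le> (card A + 1) ^ q" .
qed

locale gaussian_points =
  fixes n d :: nat and \<sigma> :: real and \<mu> :: "nat \<Rightarrow> vec"
  assumes \<sigma>: "0 < \<sigma>"
begin

abbreviation "PP \<equiv> perturbed_points n d \<sigma> \<mu>"

sublocale prob_space PP by (rule prob_space_perturbed_points[OF \<sigma>])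

lemma outer_le_triangular:
  fixes rank :: "'i \<Rightarrow> nat"
  assumes "0 \<le> \<eta>" "finite I"
    and "\<And>i. i \<in> I \<Longrightarrow> J i < n \<and> K i < d \<and> 1 \<le> \<bar>w i (J i) (K i)\<bar>"
    and "\<And>i i'. i \<in> I \<Longrightarrow> i' \<in> I \<Longrightarrow> i \<noteq> i' \<Longrightarrow> rank i \<le> rank i' \<Longrightarrow> w i (J i') (K i') = 0"
    and "\<And>X i. X \<in> space PP \<Longrightarrow> P X \<Longrightarrow> i \<in> I \<Longrightarrow> \<bar>aff n d (w i) (z i) X\<bar> \<le> \<eta>"
  shows "outer_le PP P ((2 * \<eta> / \<sigma>) ^ card I)"
proof (rule outer_leI)
  show "{X \<in> space PP. P X} \<subseteq> {X \<in> space PP. \<forall>i\<in>I. \<bar>aff n d (w i) (z i) X\<bar> \<le> \<eta>}" using assms(5) by blast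
  show "{X \<in> space PP. \<forall>i\<in>I. \<bar>aff n d (w i) (z i) X\<bar> \<le> \<eta>} \<in> sets PP" using assms(2) by measurable
  show "emeasure PP {X \<in> space PP. \<forall>i\<in>I. \<bar>aff n d (w i) (z i) X\<bar> \<le> \<eta>} \<le> ennreal ((2 * \<eta> / \<sigma>) ^ card I)"
    by (rule emeasure_triangular_system[OF \<sigma> assms(1,2), where J=J and K=K and rank=rank])
      (use assms(3,4) in blast)+
qed

text \<open>Union bound over at most \<open>n ^ q\<close> sets \<open>T\<close> and the assignments
  \<open>\<phi>\<close> of members of \<open>H\<close> to the points of \<open>T\<close>. For a
  fixed choice the form of point \<open>j\<close> involves no other point, so the system is diagonal
  and all ranks may be equal.\<close>

lemma outer_le_slabs:
  assumes \<eta>: "0 \<le> \<eta>" and H: "finite H" "\<And>a s. (a, s) \<in> H \<Longrightarrow> \<exists>l<d. 1 \<le> \<bar>a l\<bar>"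
  shows "outer_le PP (\<lambda>X. \<exists>T\<subseteq>{..<n}. card T = q \<and> (\<forall>j\<in>T. \<exists>(a, s)\<in>H. \<bar>(\<Sum>l<d. a l * X j l) - s\<bar> \<le> \<eta>))
    ((real n * real (card H) * (2 * \<eta> / \<sigma>)) ^ q)"
proof -
  let ?Ts = "{T. T \<subseteq> {..<n} \<and> card T = q}"
  let ?Q = "\<lambda>T \<phi> X. \<forall>j\<in>T. \<bar>(\<Sum>l<d. fst (\<phi> j) l * X j l) - snd (\<phi> j)\<bar> \<le> \<eta>"
  have s1: "outer_le PP (?Q T \<phi>) ((2 * \<eta> / \<sigma>) ^ q)" if T: "T \<in> ?Ts" and \<phi>: "\<phi> \<in> (\<Pi>\<^sub>E j\<in>T. H)" for T \<phi>
  proof -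
    have "\<exists>l. \<forall>j\<in>T. l j < d \<and> 1 \<le> \<bar>fst (\<phi> j) (l j)\<bar>"
    proof (rule bchoice, rule ballI)
      fix j assume "j \<in> T"
      then have "(fst (\<phi> j), snd (\<phi> j)) \<in> H" using \<phi> by (auto simp: PiE_def Pi_def)
      from H(2)[OF this] show "\<exists>l. l < d \<and> 1 \<le> \<bar>fst (\<phi> j) l\<bar>" by blast
    qed
    then obtain L where L: "\<And>j. j \<in> T \<Longrightarrow> L j < d \<and> 1 \<le> \<bar>fst (\<phi> j) (L j)\<bar>" by blast
    define w where "w = (\<lambda>j j' l. if j' = j then fst (\<phi> j) l else (0::real))"
    have aff: "aff n d (w j) (snd (\<phi> j)) X = (\<Sum>l<d. fst (\<phi> j) l * X j l) - snd (\<phi> j)" if "j < n" for j X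
    proof -
      have "(\<Sum>j'<n. \<Sum>l<d. w j j' l * X j' l) = (\<Sum>j'<n. if j' = j then (\<Sum>l<d. fst (\<phi> j) l * X j l) else 0)"
        unfolding w_def by (intro sum.cong) auto
      then show ?thesis using that by (simp add: aff_def)
    qed
    have "outer_le PP (?Q T \<phi>) ((2 * \<eta> / \<sigma>) ^ card T)"
    proof (rule outer_le_triangular[where J="\<lambda>j. j" and K=L and w=w and z="\<lambda>j. snd (\<phi> j)" and rank="\<lambda>_. 0"])
      show "finite T" using T finite_subset[of T "{..<n}"] by auto
      show "\<And>i. i \<in> T \<Longrightarrow> i < n \<and> L i < d \<and> 1 \<le> \<bar>w i i (L i)\<bar>" using T L by (auto simp: w_def)
      show "\<And>X i. X \<in> space PP \<Longrightarrow> ?Q T \<phi> X \<Longrightarrow> i \<in> T \<Longrightarrow> \<bar>aff n d (w i) (snd (\<phi> i)) X\<bar> \<le> \<eta>"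
        using T by (subst aff) auto
    qed (use \<eta> in \<open>auto simp: w_def\<close>)
    then show ?thesis using T by simp
  qed
  have c0: "0 \<le> (2 * \<eta> / \<sigma>) ^ q" using \<eta> \<sigma> by simp
  have s2: "outer_le PP (\<lambda>X. \<exists>\<phi>\<in>(\<Pi>\<^sub>E j\<in>T. H). ?Q T \<phi> X) ((real (card H) * (2 * \<eta> / \<sigma>)) ^ q)" if T: "T \<in> ?Ts" for T
  proof -
    have fT: "finite T" using T finite_subset[of T "{..<n}"] by auto
    have "outer_le PP (\<lambda>X. \<exists>\<phi>\<in>(\<Pi>\<^sub>E j\<in>T. H). ?Q T \<phi> X) (real (card (\<Pi>\<^sub>E j\<in>T. H)) * (2 * \<eta> / \<sigma>) ^ q)"
      by (rule outer_le_Bex[OF _ c0 s1[OF T]]) (use fT H in \<open>auto intro!: finite_PiE\<close>)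
    moreover have "real (card (\<Pi>\<^sub>E j\<in>T. H)) = real (card H) ^ q" using fT T by (simp add: card_PiE)
    ultimately show ?thesis by (simp only: power_mult_distrib)
  qed
  have "outer_le PP (\<lambda>X. \<exists>T\<in>?Ts. \<exists>\<phi>\<in>(\<Pi>\<^sub>E j\<in>T. H). ?Q T \<phi> X) (real (card ?Ts) * (real (card H) * (2 * \<eta> / \<sigma>)) ^ q)"
    by (rule outer_le_Bex[OF _ _ s2]) (use \<eta> \<sigma> in auto)
  moreover have "real (card ?Ts) \<le> real n ^ q"
  proof (cases "q \<le> n")
    case True
    have "card ?Ts = n choose q" using n_subsets[of "{..<n}" q] by simp
    then show ?thesis using binomial_le_pow[OF True] by (metis of_nat_le_iff of_nat_power)
  next
    case False
    then have "?Ts = {}" using card_mono[of "{..<n}"] by fastforce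
    then have "card ?Ts = 0" by (simp only: card.empty)
    then show ?thesis by (simp only: of_nat_0 zero_le_power of_nat_0_le_iff)
  qed
  ultimately show ?thesis
  proof (elim outer_le_mono)
    fix X assume "\<exists>T\<subseteq>{..<n}. card T = q \<and> (\<forall>j\<in>T. \<exists>(a, s)\<in>H. \<bar>(\<Sum>l<d. a l * X j l) - s\<bar> \<le> \<eta>)"
    then obtain T where T: "T \<in> ?Ts" and ex: "\<forall>j\<in>T. \<exists>h. h \<in> H \<and> \<bar>(\<Sum>l<d. fst h l * X j l) - snd h\<bar> \<le> \<eta>"
      by fastforce
    obtain \<phi> where \<phi>: "\<forall>j\<in>T. \<phi> j \<in> H \<and> \<bar>(\<Sum>l<d. fst (\<phi> j) l * X j l) - snd (\<phi> j)\<bar> \<le> \<eta>"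
      using bchoice[OF ex] by blast
    then have "restrict \<phi> T \<in> (\<Pi>\<^sub>E j\<in>T. H)" "?Q T (restrict \<phi> T) X" by auto
    then show "\<exists>T\<in>?Ts. \<exists>\<phi>\<in>(\<Pi>\<^sub>E j\<in>T. H). ?Q T \<phi> X" using T by blast
  next
    assume "real (card ?Ts) \<le> real n ^ q"
    then have "real (card ?Ts) * (real (card H) * (2 * \<eta> / \<sigma>)) ^ q \<le> real n ^ q * (real (card H) * (2 * \<eta> / \<sigma>)) ^ q"
      using \<eta> \<sigma> by (intro mult_right_mono) auto
    then show "real (card ?Ts) * (real (card H) * (2 * \<eta> / \<sigma>)) ^ q \<le> (real n * real (card H) * (2 * \<eta> / \<sigma>)) ^ q"
      by (simp only: power_mult_distrib mult.assoc)
  qed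
qed

lemma aff_coordinate:
  assumes "l < d"
  shows "aff n d (\<lambda>j l'. if l' = l then v j else 0) z X = (\<Sum>j<n. v j * X j l) - z"
proof -
  have "(\<Sum>l'<d. (if l' = l then v j else 0) * X j l') = v j * X j l" for j
    using assms by (simp add: if_distrib[where f="\<lambda>x. x * _"] cong: if_cong)
  then show ?thesis by (simp add: aff_def)
qed

text \<open>A relation holds in each coordinate separately. Forms for different coordinates share no
  variables, and within one coordinate the index \<open>r\<close> is the required rank, so there are
  \<open>b * d\<close> forms.\<close>

lemma outer_le_relation_family:
  assumes \<eta>: "0 \<le> \<eta>"
    and piv: "\<And>r. r < b \<Longrightarrow> J r < n \<and> 1 \<le> \<bar>v r (J r)\<bar>" and tri: "\<And>r r'. r' < b \<Longrightarrow> r < r' \<Longrightarrow> v r (J r') = 0"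
    and P: "\<And>X r l. P X \<Longrightarrow> r < b \<Longrightarrow> l < d \<Longrightarrow> \<bar>\<Sum>j<n. v r j * X j l\<bar> \<le> \<eta>"
  shows "outer_le PP P ((2 * \<eta> / \<sigma>) ^ (b * d))"
proof -
  let ?w = "\<lambda>(r, l) j l'. if l' = l then v r j else 0"
  have "outer_le PP P ((2 * \<eta> / \<sigma>) ^ card ({..<b} \<times> {..<d}))"
  proof (rule outer_le_triangular[where J="\<lambda>(r, l). J r" and K=snd and w="?w" and z="\<lambda>_. 0" and rank=fst])
    fix i i' :: "nat \<times> nat" assume i: "i \<in> {..<b} \<times> {..<d}" "i' \<in> {..<b} \<times> {..<d}" "i \<noteq> i'" "fst i \<le> fst i'"
    show "?w i (case i' of (r, l) \<Rightarrow> J r) (snd i') = 0"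
    proof (cases "fst i = fst i'")
      case True
      then have "snd i \<noteq> snd i'" using i(3) by (simp add: prod_eq_iff)
      then show ?thesis by (simp add: case_prod_beta)
    next
      case False
      then have "v (fst i) (J (fst i')) = 0" using i tri[of "fst i'" "fst i"] by auto
      then show ?thesis by (simp add: case_prod_beta)
    qed
  next
    fix X and i :: "nat \<times> nat" assume "P X" "i \<in> {..<b} \<times> {..<d}"
    then show "\<bar>aff n d (?w i) 0 X\<bar> \<le> \<eta>" using P by (auto simp: aff_coordinate)
  qed (use piv \<eta> in auto)
  then show ?thesis by simp
qed

text \<open>At most \<open>(n + 1) ^ q\<close> sets \<open>M\<close>, and \<open>8 ^ q\<close>
  triples of subsets for each relation. The pivots \<open>J\<close> are not counted: for a fixed
  family of relations one admissible choice is enough.\<close>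

lemma outer_le_relation_event:
  assumes "0 \<le> \<rho>"
  shows "outer_le PP (relation_event n d q b \<rho>)
    ((real n + 1) ^ q * 8 ^ (q * b) * (4 * (real n)\<^sup>2 * \<rho> / \<sigma>) ^ (b * d))"
proof -
  let ?Ms = "{M. M \<subseteq> {..<n} \<and> card M \<le> q}"
  let ?Bs = "\<lambda>M. {B \<in> (\<Pi>\<^sub>E r\<in>{..<b}. Pow M \<times> Pow M \<times> Pow M). \<exists>J. triangular n b B J}"
  let ?Q = "\<lambda>B X. \<forall>r<b. \<forall>l<d. \<bar>\<Sum>j<n. relation_coeff (B r) j * X j l\<bar> \<le> 2 * (real n)\<^sup>2 * \<rho>"
  let ?c = "(4 * (real n)\<^sup>2 * \<rho> / \<sigma>) ^ (b * d)"
  have c0: "0 \<le> ?c" using assms \<sigma> by simp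
  have s1: "outer_le PP (?Q B) ?c" if BM: "B \<in> ?Bs M" for M B
  proof -
    obtain J where J: "triangular n b B J" using BM by blast
    have "outer_le PP (?Q B) ((2 * (2 * (real n)\<^sup>2 * \<rho>) / \<sigma>) ^ (b * d))"
      by (rule outer_le_relation_family[where J=J and v="\<lambda>r. relation_coeff (B r)"])
        (use J assms in \<open>auto simp: triangular_def\<close>)
    moreover have "2 * (2 * (real n)\<^sup>2 * \<rho>) / \<sigma> = 4 * (real n)\<^sup>2 * \<rho> / \<sigma>" by simp
    ultimately show ?thesis by (simp only:)
  qed
  have s2: "outer_le PP (\<lambda>X. \<exists>B\<in>?Bs M. ?Q B X) (8 ^ (q * b) * ?c)" if M: "M \<in> ?Ms" for M
  proof -
    have fM: "finite M" using M finite_subset[of M "{..<n}"] by auto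
    have fin: "finite (\<Pi>\<^sub>E r\<in>{..<b}. Pow M \<times> Pow M \<times> Pow M)" using fM by (intro finite_PiE) auto
    have "card (?Bs M) \<le> card (\<Pi>\<^sub>E r\<in>{..<b}. Pow M \<times> Pow M \<times> Pow M)" by (rule card_mono[OF fin]) auto
    also have "\<dots> = (8 ^ card M) ^ b"
      using fM by (simp add: card_PiE card_cartesian_product card_Pow power_mult_distrib[symmetric])
    also have "\<dots> \<le> (8 ^ q) ^ b" using M by (intro power_mono power_increasing) auto
    finally have "real (card (?Bs M)) \<le> real ((8 ^ q) ^ b)" by (rule of_nat_mono)
    then have c: "real (card (?Bs M)) \<le> 8 ^ (q * b)" by (simp add: power_mult)
    have "outer_le PP (\<lambda>X. \<exists>B\<in>?Bs M. ?Q B X) (real (card (?Bs M)) * ?c)"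
      by (rule outer_le_Bex[OF _ c0 s1]) (use fin in auto)
    then show ?thesis by (rule outer_le_mono) (use c c0 in \<open>auto intro: mult_right_mono\<close>)
  qed
  have fin: "finite ?Ms" and "card ?Ms \<le> (n + 1) ^ q" using card_bounded_subsets[of "{..<n}" q] by auto
  then have "real (card ?Ms) \<le> real ((n + 1) ^ q)" by (intro of_nat_mono)
  then have c: "real (card ?Ms) \<le> (real n + 1) ^ q" by (simp add: add.commute)
  have "outer_le PP (\<lambda>X. \<exists>M\<in>?Ms. \<exists>B\<in>?Bs M. ?Q B X) (real (card ?Ms) * (8 ^ (q * b) * ?c))"
    by (rule outer_le_Bex[OF fin _ s2]) (use c0 in auto)
  then show ?thesis
  proof (rule outer_le_mono)
    fix X assume "relation_event n d q b \<rho> X"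
    then obtain M B J where M: "M \<subseteq> {..<n}" "card M < q" and B: "\<forall>r<b. B r \<in> Pow M \<times> Pow M \<times> Pow M"
      and J: "triangular n b B J" and Q: "?Q B X" unfolding relation_event_def by blast
    let ?B = "restrict B {..<b}"
    have "?B \<in> (\<Pi>\<^sub>E r\<in>{..<b}. Pow M \<times> Pow M \<times> Pow M)" using B by (intro restrict_PiE_iff[THEN iffD2]) simp
    moreover have "triangular n b ?B J" using J by (auto simp: triangular_def)
    ultimately have "?B \<in> ?Bs M" by blast
    moreover have "?Q ?B X" using Q by simp
    moreover have "M \<in> ?Ms" using M by simp
    ultimately show "\<exists>M\<in>?Ms. \<exists>B\<in>?Bs M. ?Q B X" by blast
  next
    show "real (card ?Ms) * (8 ^ (q * b) * ?c) \<le> (real n + 1) ^ q * 8 ^ (q * b) * ?c"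
      using mult_right_mono[OF c mult_nonneg_nonneg[OF _ c0], of "8 ^ (q * b)"] by (simp only: mult.assoc) simp
  qed
qed

lemma mean_eq_sum:
  assumes "P \<subseteq> {..<n}"
  shows "mean X P l = (\<Sum>j<n. indicator P j / real (card P) * X j l)"
proof -
  have "(\<Sum>j<n. indicator P j / real (card P) * X j l) = (\<Sum>j\<in>P. X j l / real (card P))"
    using assms by (intro sum.mono_neutral_cong_right) (auto simp: indicator_def)
  then show ?thesis by (simp add: mean_def sum_divide_distrib)
qed

text \<open>A difference of means has pivot coefficient \<open>1 / card P\<close>, so it is
  multiplied by \<open>4 * d + 3\<close> to reach 1. The relation for \<open>P1\<close> vanishes at
  the pivot of the one for \<open>P2\<close>, so both form a family with
  \<open>b = 2\<close>.\<close>

lemma outer_le_means_event: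
  assumes \<rho>: "0 \<le> \<rho>"
  shows "outer_le PP (means_event n d \<rho>)
    ((real n + 1) ^ (3 * (4 * d + 3)) * (2 * real (4 * d + 3) * \<rho> / \<sigma>) ^ (2 * d))"
proof -
  let ?q = "4 * d + 3"
  let ?c = "(2 * real ?q * \<rho> / \<sigma>) ^ (2 * d)"
  let ?Q = "\<lambda>P0 P1 P2 X. \<not> P1 \<subseteq> P0 \<and> \<not> P2 \<subseteq> P0 \<union> P1 \<and>
     (\<forall>l<d. \<bar>mean X P1 l - mean X P0 l\<bar> \<le> \<rho> \<and> \<bar>mean X P2 l - mean X P0 l\<bar> \<le> \<rho>)"
  have c0: "0 \<le> ?c" using \<rho> \<sigma> by simp
  have fin: "finite (small_sets n d)"
    by (rule finite_subset[of _ "{M. M \<subseteq> {..<n} \<and> card M \<le> ?q}"]) (auto simp: small_sets_def)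
  have "card (small_sets n d) \<le> card {M. M \<subseteq> {..<n} \<and> card M \<le> ?q}"
    by (rule card_mono) (auto simp: small_sets_def)
  also have "\<dots> \<le> (n + 1) ^ ?q" using card_bounded_subsets(2)[of "{..<n}" ?q] by simp
  finally have "real (card (small_sets n d)) \<le> real ((n + 1) ^ ?q)" by (rule of_nat_mono)
  then have card: "real (card (small_sets n d)) \<le> (real n + 1) ^ ?q" by (simp add: add.commute)
  have s1: "outer_le PP (?Q P0 P1 P2) ?c"
    if "P0 \<in> small_sets n d" "P1 \<in> small_sets n d" "P2 \<in> small_sets n d" for P0 P1 P2
  proof (cases "\<not> P1 \<subseteq> P0 \<and> \<not> P2 \<subseteq> P0 \<union> P1")
    case False
    then show ?thesis by (intro outer_leI[of _ _ "{}"]) auto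
  next
    case True
    then obtain p1 p2 where p: "p1 \<in> P1" "p1 \<notin> P0" "p2 \<in> P2" "p2 \<notin> P0" "p2 \<notin> P1" by blast
    have sub: "P0 \<subseteq> {..<n}" "P1 \<subseteq> {..<n}" "P2 \<subseteq> {..<n}" using that by (auto simp: small_sets_def)
    define Pr where "Pr = (\<lambda>r::nat. if r = 0 then P1 else P2)"
    define v where "v = (\<lambda>r j. real ?q * (indicator (Pr r) j / real (card (Pr r)) - indicator P0 j / real (card P0)))"
    have piv: "1 \<le> real ?q * (1 / real (card P))" if "P \<in> small_sets n d" for P
    proof -
      have "finite P" using that finite_subset[of P "{..<n}"] by (auto simp: small_sets_def)
      then have "0 < card P" "card P \<le> ?q" using that by (auto simp: small_sets_def card_gt_0_iff)
      then have "0 < real (card P)" "real (card P) \<le> real ?q" by (auto simp only: of_nat_0_less_iff of_nat_le_iff)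
      then show ?thesis by (simp add: field_simps)
    qed
    have vs: "(\<Sum>j<n. v r j * X j l) = real ?q * (mean X (Pr r) l - mean X P0 l)" for r X l
    proof -
      have "Pr r \<subseteq> {..<n}" using sub by (simp add: Pr_def)
      then have "real ?q * (mean X (Pr r) l - mean X P0 l) =
        real ?q * (\<Sum>j<n. indicator (Pr r) j / real (card (Pr r)) * X j l - indicator P0 j / real (card P0) * X j l)"
        using sub by (simp only: mean_eq_sum sum_subtractf)
      also have "\<dots> = (\<Sum>j<n. v r j * X j l)"
        unfolding v_def sum_distrib_left by (intro sum.cong refl) (simp only: left_diff_distrib mult.assoc)
      finally show ?thesis by simp
    qed
    have "outer_le PP (?Q P0 P1 P2) ((2 * (real ?q * \<rho>) / \<sigma>) ^ (2 * d))"
    proof (rule outer_le_relation_family[where v=v and J="\<lambda>r. if r = 0 then p1 else p2"])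
      show "0 \<le> real ?q * \<rho>" using \<rho> by simp
      fix r :: nat assume r: "r < 2"
      have "1 \<le> v r (if r = 0 then p1 else p2)"
        using piv[OF that(2)] piv[OF that(3)] p by (simp add: v_def Pr_def)
      then show "(if r = 0 then p1 else p2) < n \<and> 1 \<le> \<bar>v r (if r = 0 then p1 else p2)\<bar>"
        using p sub by auto
    next
      fix r r' :: nat assume "r' < 2" "r < r'"
      then have "r = 0" "r' = 1" by auto
      then show "v r (if r' = 0 then p1 else p2) = 0" using p by (simp add: v_def Pr_def)
    next
      fix X r l assume X: "?Q P0 P1 P2 X" and "r < (2::nat)" and l: "l < d"
      have "\<bar>mean X (Pr r) l - mean X P0 l\<bar> \<le> \<rho>" using X l by (simp add: Pr_def)
      then show "\<bar>\<Sum>j<n. v r j * X j l\<bar> \<le> real ?q * \<rho>"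
        unfolding vs abs_mult by (simp add: mult_left_mono)
    qed
    moreover have "2 * (real ?q * \<rho>) / \<sigma> = 2 * real ?q * \<rho> / \<sigma>" by (simp only: mult.assoc)
    ultimately show ?thesis by (simp only:)
  qed
  let ?N = "real (card (small_sets n d))"
  have "outer_le PP (\<lambda>X. \<exists>P0\<in>small_sets n d. \<exists>P1\<in>small_sets n d. \<exists>P2\<in>small_sets n d. ?Q P0 P1 P2 X)
    (?N * (?N * (?N * ?c)))"
    by (intro outer_le_Bex fin s1 mult_nonneg_nonneg c0) auto
  then show ?thesis
  proof (rule outer_le_mono)
    have "?N * (?N * (?N * ?c)) = (?N ^ 3) * ?c" by (simp add: power3_eq_cube)
    also have "\<dots> \<le> ((real n + 1) ^ ?q) ^ 3 * ?c" using card c0 by (intro mult_right_mono power_mono) auto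
    finally show "?N * (?N * (?N * ?c)) \<le> (real n + 1) ^ (3 * ?q) * ?c" by (simp add: power_mult[symmetric] mult.commute)
  qed (simp add: means_event_def)
qed

lemma outer_le_zero_aff:
  assumes "j < n" "l < d" "1 \<le> \<bar>w j l\<bar>" "\<And>X. P X \<Longrightarrow> aff n d w z X = 0"
  shows "outer_le PP P 0"
proof -
  let ?A = "{X \<in> space PP. \<forall>i\<in>{()}. \<bar>aff n d w z X\<bar> \<le> 0}"
  have "emeasure PP ?A \<le> ennreal ((2 * 0 / \<sigma>) ^ card {()})"
    by (rule emeasure_triangular_system[OF \<sigma>, where J="\<lambda>_. j" and K="\<lambda>_. l" and rank="\<lambda>_. 0"])
      (use assms in auto)
  then show ?thesis by (intro outer_leI[of _ _ ?A]) (use assms(4) in auto)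
qed

text \<open>Failure of genericity implies one of finitely many nontrivial affine equations, that is,
  slabs of width 0. It suffices to look at coordinate 0.\<close>

lemma outer_le_not_generic:
  assumes d: "0 < d"
  shows "outer_le PP (\<lambda>X. \<not> generic n d k c0 X) 0"
proof -
  let ?S = "{P. P \<subseteq> {..<n} \<and> P \<noteq> {}}"
  let ?Q1 = "\<lambda>P Q X. P \<inter> Q = {} \<and> (\<forall>l<d. mean X P l = mean X Q l)"
  let ?Q2 = "\<lambda>P i X. \<forall>l<d. mean X P l = c0 i l"
  have fin: "finite ?S" by simp
  \<comment> \<open>One statement for both clauses: \<open>z = 0\<close> for two means, and
    \<open>Q = {}\<close> with \<open>z = c0 i 0\<close> for an initial center, the mean of the
    empty set being 0.\<close>
  have key: "outer_le PP (\<lambda>X. P \<inter> Q = {} \<and> mean X P 0 = (mean X Q 0 + z)) 0"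
    if P: "P \<in> ?S" and Q: "Q \<subseteq> {..<n}" for P Q z
  proof (cases "P \<inter> Q = {}")
    case True
    obtain p where p: "p \<in> P" using P by blast
    have "finite P" using P finite_subset[of P "{..<n}"] by auto
    then have c: "0 < real (card P)" using P by (simp add: card_gt_0_iff)
    define v where "v = (\<lambda>j. real (card P) * (indicator P j / real (card P) - indicator Q j / real (card Q)))"
    have "p \<notin> Q" using True p by blast
    then have "v p = 1" using p c by (simp add: v_def)
    have vs: "(\<Sum>j<n. v j * X j l) = real (card P) * (mean X P l - mean X Q l)" for X l
    proof -
      have "P \<subseteq> {..<n}" using P by blast
      then have "real (card P) * (mean X P l - mean X Q l) =
        real (card P) * (\<Sum>j<n. indicator P j / real (card P) * X j l - indicator Q j / real (card Q) * X j l)"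
        using Q by (simp only: mean_eq_sum sum_subtractf)
      also have "\<dots> = (\<Sum>j<n. v j * X j l)"
        unfolding v_def sum_distrib_left by (intro sum.cong refl) (simp only: left_diff_distrib mult.assoc)
      finally show ?thesis by simp
    qed
    show ?thesis
    proof (rule outer_le_zero_aff[where j=p and l=0 and w="\<lambda>j l'. if l' = 0 then v j else 0" and z="real (card P) * z"])
      fix X assume "P \<inter> Q = {} \<and> mean X P 0 = mean X Q 0 + z"
      then show "aff n d (\<lambda>j l'. if l' = 0 then v j else 0) (real (card P) * z) X = 0"
        using d by (simp add: aff_coordinate vs)
    qed (use p P d \<open>v p = 1\<close> in auto)
  next
    case False
    then show ?thesis by (intro outer_leI[of _ _ "{}"]) auto
  qed
  have k1: "outer_le PP (?Q1 P Q) 0" if "P \<in> ?S" "Q \<in> ?S" for P Q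
  proof (rule outer_le_mono)
    show "outer_le PP (\<lambda>X. P \<inter> Q = {} \<and> mean X P 0 = mean X Q 0 + 0) 0" using that by (intro key) auto
  qed (use d in auto)
  have k2: "outer_le PP (?Q2 P i) 0" if "P \<in> ?S" for P i
  proof (rule outer_le_mono)
    show "outer_le PP (\<lambda>X. P \<inter> {} = {} \<and> mean X P 0 = mean X {} 0 + c0 i 0) 0" using that by (intro key) auto
  qed (use d in \<open>auto simp: mean_def\<close>)
  have "outer_le PP (\<lambda>X. (\<exists>P\<in>?S. \<exists>Q\<in>?S. ?Q1 P Q X) \<or> (\<exists>P\<in>?S. \<exists>i\<in>{..<k}. ?Q2 P i X))
     (real (card ?S) * (real (card ?S) * 0) + real (card ?S) * (real (card {..<k}) * 0))"
    by (intro outer_le_disj outer_le_Bex fin k1 k2) auto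
  then show ?thesis
  proof (rule outer_le_mono)
    fix X assume "\<not> generic n d k c0 X"
    then consider P Q where "P \<in> ?S" "Q \<in> ?S" "?Q1 P Q X" | P i where "P \<in> ?S" "i \<in> {..<k}" "?Q2 P i X"
      unfolding generic_def mem_Collect_eq lessThan_iff by metis
    then show "(\<exists>P\<in>?S. \<exists>Q\<in>?S. ?Q1 P Q X) \<or> (\<exists>P\<in>?S. \<exists>i\<in>{..<k}. ?Q2 P i X)"
    proof cases
      case 1
      then show ?thesis by (intro disjI1 bexI[of _ P] bexI[of _ Q])
    next
      case 2
      then show ?thesis by (intro disjI2 bexI[of _ P] bexI[of _ i])
    qed
  qed simp
qed

end

section \<open>Probability of slabs and bisectors\<close>

definition grid :: "real \<Rightarrow> real \<Rightarrow> real set" where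
  "grid h B = (\<lambda>z. h * of_int z) ` {\<lfloor>- B / h\<rfloor>..\<lfloor>B / h\<rfloor>}"

lemma finite_grid [simp]: "finite (grid h B)"
  by (simp add: grid_def)

lemma card_grid_le: "0 < h \<Longrightarrow> 0 \<le> B \<Longrightarrow> real (card (grid h B)) \<le> 2 * B / h + 2"
proof -
  assume h: "0 < h" "0 \<le> B"
  have le: "\<lfloor>- B / h\<rfloor> \<le> \<lfloor>B / h\<rfloor>" using h by (intro floor_mono divide_right_mono) auto
  have "card (grid h B) \<le> card {\<lfloor>- B / h\<rfloor>..\<lfloor>B / h\<rfloor>}" unfolding grid_def by (rule card_image_le) simp
  also have "\<dots> = nat (\<lfloor>B / h\<rfloor> - \<lfloor>- B / h\<rfloor> + 1)" by simp
  finally have "real (card (grid h B)) \<le> real (nat (\<lfloor>B / h\<rfloor> - \<lfloor>- B / h\<rfloor> + 1))" by (rule of_nat_mono)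
  also have "\<dots> = of_int \<lfloor>B / h\<rfloor> - of_int \<lfloor>- B / h\<rfloor> + 1" using le by simp
  also have "\<dots> \<le> B / h - (- B / h - 1) + 1"
    using of_int_floor_le[of "B / h"] real_of_int_floor_gt_diff_one[of "- B / h"] by linarith
  also have "\<dots> = 2 * B / h + 2" by simp
  finally show ?thesis .
qed

lemma grid_approx:
  assumes "0 < h" "\<bar>y\<bar> \<le> B"
  shows "\<exists>g\<in>grid h B. \<bar>g - y\<bar> \<le> h"
proof
  let ?g = "h * of_int \<lfloor>y / h\<rfloor>"
  have "- B \<le> y" "y \<le> B" using assms(2) by auto
  then have "- B / h \<le> y / h" "y / h \<le> B / h"
    using divide_right_mono[of "- B" y h] divide_right_mono[of y B h] assms(1) by auto
  then show "?g \<in> grid h B" unfolding grid_def by (intro imageI) (auto intro: floor_mono)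
  have "of_int \<lfloor>y / h\<rfloor> \<le> y / h" "y / h \<le> of_int \<lfloor>y / h\<rfloor> + 1" by linarith+
  then have "h * of_int \<lfloor>y / h\<rfloor> \<le> h * (y / h)" "h * (y / h) \<le> h * (of_int \<lfloor>y / h\<rfloor> + 1)"
    using assms(1) by (simp_all only: mult_le_cancel_left_pos)
  then show "\<bar>?g - y\<bar> \<le> h" using assms(1) by (simp add: algebra_simps)
qed

lemma grid_approx_fun:
  assumes "0 < h" "\<And>l. l < d \<Longrightarrow> \<bar>y l\<bar> \<le> B"
  shows "\<exists>g\<in>(\<Pi>\<^sub>E l\<in>{..<d}. grid h B). \<forall>l<d. \<bar>g l - y l\<bar> \<le> h"
proof -
  have "\<forall>l\<in>{..<d}. \<exists>g. g \<in> grid h B \<and> \<bar>g - y l\<bar> \<le> h" using grid_approx[OF assms(1)] assms(2) by blast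
  from bchoice[OF this] obtain g where "\<forall>l\<in>{..<d}. g l \<in> grid h B \<and> \<bar>g l - y l\<bar> \<le> h" by blast
  then show ?thesis by (intro bexI[of _ "restrict g {..<d}"]) auto
qed

definition bounded_by :: "nat \<Rightarrow> nat \<Rightarrow> real \<Rightarrow> (nat \<Rightarrow> vec) \<Rightarrow> bool" where
  "bounded_by n d R X \<longleftrightarrow> (\<forall>j<n. \<forall>l<d. \<bar>X j l\<bar> \<le> R)"

context gaussian_points
begin

text \<open>The normal vector is rounded to multiples of \<open>\<delta> / R\<close> and the offset
  to multiples of \<delta>, so on points of the box both errors are of the order of the slab width.
  For each grid hyperplane, \<open>outer_le_slabs\<close> is applied with at most one hyperplane and
  \<open>4 * (d + 1)\<close> points.\<close>

lemma outer_le_slab_event: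
  assumes n: "0 < n" and d: "0 < d" and \<delta>: "0 < \<delta>" "2 * \<delta> \<le> R"
  shows "outer_le PP (\<lambda>X. bounded_by n d R X \<and> slab_event n d \<delta> X)
    ((4 * real n * real d * R / \<delta> * (12 * (real n)\<^sup>2 * real d * \<delta> / \<sigma>) ^ 4) ^ (d + 1))"
proof -
  have R: "0 < R" using \<delta> by linarith
  define h where "h = \<delta> / R"
  have h: "0 < h" "h \<le> 1 / 2" using \<delta> R by (auto simp: h_def field_simps)
  define S where "S = real d * R + real n * real d * \<delta>"
  let ?Ga = "\<Pi>\<^sub>E l\<in>{..<d}. grid h 1"
  let ?Gs = "grid \<delta> S"
  let ?\<eta> = "6 * real n * real d * \<delta>"
  have n1: "1 \<le> real n" "1 \<le> real d" using n d by auto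
  have S0: "0 \<le> S" using R \<delta> by (simp add: S_def)
  \<comment> \<open>Rounding may shrink the entry of absolute value 1 to 1/2, so everything is
    doubled to restore a pivot. Grid hyperplanes without a pivot are discarded by the
    intersection.\<close>
  let ?H = "\<lambda>a s. {((\<lambda>l. 2 * a l), 2 * s)} \<inter> {(a', s'). \<exists>l<d. 1 \<le> \<bar>a' l\<bar>}"
  let ?E = "\<lambda>a s X. \<exists>T\<subseteq>{..<n}. card T = 4 * (d + 1) \<and>
     (\<forall>j\<in>T. \<exists>(a, s)\<in>?H a s. \<bar>(\<Sum>l<d. a l * X j l) - s\<bar> \<le> ?\<eta>)"
  let ?c = "(real n * (2 * ?\<eta> / \<sigma>)) ^ (4 * (d + 1))"
  have c0: "0 \<le> ?c" using \<delta> \<sigma> by simp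
  have s1: "outer_le PP (?E a s) ?c" for a s
  proof -
    have "outer_le PP (?E a s) ((real n * real (card (?H a s)) * (2 * ?\<eta> / \<sigma>)) ^ (4 * (d + 1)))"
      using \<delta> by (intro outer_le_slabs) auto
    moreover have "card (?H a s) \<le> 1" using card_mono[of "{((\<lambda>l. 2 * a l), 2 * s)}" "?H a s"] by simp
    then have "real n * real (card (?H a s)) * (2 * ?\<eta> / \<sigma>) \<le> real n * 1 * (2 * ?\<eta> / \<sigma>)"
      using \<delta> \<sigma> by (intro mult_right_mono mult_left_mono) auto
    then have "(real n * real (card (?H a s)) * (2 * ?\<eta> / \<sigma>)) ^ (4 * (d + 1)) \<le> (real n * 1 * (2 * ?\<eta> / \<sigma>)) ^ (4 * (d + 1))"
      using \<delta> \<sigma> by (intro power_mono) auto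
    ultimately show ?thesis by (elim outer_le_mono) (simp_all only: mult_1_right)
  qed
  have "outer_le PP (\<lambda>X. \<exists>a\<in>?Ga. \<exists>s\<in>?Gs. ?E a s X) (real (card ?Ga) * (real (card ?Gs) * ?c))"
    by (intro outer_le_Bex s1 c0 mult_nonneg_nonneg finite_PiE) auto
  then show ?thesis
  proof (rule outer_le_mono)
    fix X assume "bounded_by n d R X \<and> slab_event n d \<delta> X"
    then have X: "\<And>j l. j < n \<Longrightarrow> l < d \<Longrightarrow> \<bar>X j l\<bar> \<le> R" and se: "slab_event n d \<delta> X"
      by (auto simp: bounded_by_def)
    from se obtain T a s l0 where T: "T \<subseteq> {..<n}" "card T = 4 * (d + 1)" and a: "\<And>l. l < d \<Longrightarrow> \<bar>a l\<bar> \<le> 1"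
      and l0: "l0 < d" "\<bar>a l0\<bar> = 1" and sl: "\<And>j. j \<in> T \<Longrightarrow> \<bar>(\<Sum>l<d. a l * X j l) - s\<bar> \<le> real n * real d * \<delta>"
      unfolding slab_event_def by blast
    have "T \<noteq> {}" using T(2) by auto
    then obtain j where j: "j \<in> T" by blast
    have "\<bar>\<Sum>l<d. a l * X j l\<bar> \<le> (\<Sum>l<d. 1 * R)"
    proof (rule order_trans[OF sum_abs], rule sum_mono)
      fix l assume "l \<in> {..<d}"
      then show "\<bar>a l * X j l\<bar> \<le> 1 * R" unfolding abs_mult using a X j T(1) by (intro mult_mono) auto
    qed
    then have "\<bar>s\<bar> \<le> S" using sl[OF j] unfolding S_def by simp
    from grid_approx[OF \<delta>(1) this] obtain s' where s': "s' \<in> ?Gs" "\<bar>s' - s\<bar> \<le> \<delta>" by blast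
    have "\<exists>a'\<in>?Ga. \<forall>l<d. \<bar>a' l - a l\<bar> \<le> h" by (rule grid_approx_fun[OF h(1) a])
    then obtain a' where a'G: "a' \<in> ?Ga" and "\<forall>l<d. \<bar>a' l - a l\<bar> \<le> h" by (elim bexE)
    then have a': "a' \<in> ?Ga" "\<And>l. l < d \<Longrightarrow> \<bar>a' l - a l\<bar> \<le> h" by simp_all
    have "1 \<le> \<bar>2 * a' l0\<bar>" using a'(2)[OF l0(1)] l0(2) h(2) by (simp add: abs_mult)
    then have H: "((\<lambda>l. 2 * a' l), 2 * s') \<in> ?H a' s'" using l0(1) by auto
    have "\<bar>(\<Sum>l<d. 2 * a' l * X j l) - 2 * s'\<bar> \<le> ?\<eta>" if "j \<in> T" for j
    proof -
      have "\<bar>\<Sum>l<d. (a' l - a l) * X j l\<bar> \<le> (\<Sum>l<d. h * R)"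
      proof (rule order_trans[OF sum_abs], rule sum_mono)
        fix l assume "l \<in> {..<d}"
        then show "\<bar>(a' l - a l) * X j l\<bar> \<le> h * R" unfolding abs_mult using a'(2) X that T(1) h by (intro mult_mono) auto
      qed
      also have "\<dots> = real d * \<delta>" using R by (simp add: h_def)
      finally have 1: "\<bar>(\<Sum>l<d. a' l * X j l) - (\<Sum>l<d. a l * X j l)\<bar> \<le> real d * \<delta>"
        by (simp add: sum_subtractf left_diff_distrib)
      have 2: "real d * \<delta> \<le> real n * real d * \<delta>"
        using mult_right_mono[OF n1(1), of "real d * \<delta>"] \<delta> by (simp add: mult.assoc)
      have 3: "\<delta> \<le> real d * \<delta>" using mult_right_mono[OF n1(2), of \<delta>] \<delta> by simp
      \<comment> \<open>Slab width, rounding of the normal vector and rounding of the offset, each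
        at most \<open>real n * real d * \<delta>\<close>.\<close>
      have Y: "\<bar>(\<Sum>l<d. a' l * X j l) - s'\<bar> \<le> 3 * (real n * real d * \<delta>)"
        using 1 2 3 sl[OF that] s'(2) by linarith
      have e1: "(\<Sum>l<d. 2 * a' l * X j l) - 2 * s' = 2 * ((\<Sum>l<d. a' l * X j l) - s')"
        by (simp add: sum_distrib_left mult.assoc right_diff_distrib)
      have e2: "?\<eta> = 2 * (3 * (real n * real d * \<delta>))" by simp
      show ?thesis unfolding e1 e2 abs_mult using mult_left_mono[OF Y, of 2] by (simp only: abs_numeral)
    qed
    then have "\<forall>j\<in>T. \<exists>(a, s)\<in>?H a' s'. \<bar>(\<Sum>l<d. a l * X j l) - s\<bar> \<le> ?\<eta>"
      using H by (intro ballI bexI[OF _ H]) simp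
    then have "?E a' s' X" using T by blast
    then show "\<exists>a\<in>?Ga. \<exists>s\<in>?Gs. ?E a s X" using a'(1) s'(1) by blast
  next
    let ?A = "4 * real n * real d * R / \<delta>"
    have r: "2 \<le> R / \<delta>" using \<delta> by (simp add: field_simps)
    have nd: "1 \<le> real n * real d" using mult_mono[of 1 "real n" 1 "real d"] n1 by simp
    have "real (card ?Ga) = real (card (grid h 1)) ^ d" by (simp add: card_PiE)
    also have "\<dots> \<le> ?A ^ d"
    proof (rule power_mono)
      have "real (card (grid h 1)) \<le> 2 * 1 / h + 2" using h by (intro card_grid_le) auto
      also have "\<dots> = 2 * (R / \<delta>) + 2" by (simp add: h_def)
      also have "\<dots> \<le> 4 * (1 * (R / \<delta>))" using r by simp
      also have "\<dots> \<le> 4 * ((real n * real d) * (R / \<delta>))" using nd r by (intro mult_left_mono mult_right_mono) auto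
      finally show "real (card (grid h 1)) \<le> ?A" by (simp add: mult.assoc)
    qed simp
    finally have ga: "real (card ?Ga) \<le> ?A ^ d" .
    have gs: "real (card ?Gs) \<le> ?A"
    proof -
      have "real (card ?Gs) \<le> 2 * S / \<delta> + 2" using \<delta> S0 by (intro card_grid_le)
      also have "\<dots> = 2 * (real d * (R / \<delta>)) + 2 * (real n * real d) + 2" using \<delta> by (simp add: S_def field_simps)
      also have "\<dots> \<le> 2 * ((real n * real d) * (R / \<delta>)) + (real n * real d) * (R / \<delta>) + (real n * real d) * (R / \<delta>)"
      proof (intro add_mono)
        show "2 * (real d * (R / \<delta>)) \<le> 2 * (real n * real d * (R / \<delta>))"
          using n1 r by (intro mult_left_mono mult_right_mono) auto
        show "2 * (real n * real d) \<le> real n * real d * (R / \<delta>)" using mult_left_mono[OF r, of "real n * real d"] by simp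
        show "2 \<le> real n * real d * (R / \<delta>)" using mult_mono[OF nd r] by simp
      qed
      finally show ?thesis by (simp add: mult_ac)
    qed
    have "real (card ?Ga) * (real (card ?Gs) * ?c) \<le> ?A ^ d * (?A * ?c)"
      using ga gs c0 R \<delta> by (intro mult_mono) auto
    also have "\<dots> = ?A ^ (d + 1) * ((real n * (2 * ?\<eta> / \<sigma>)) ^ 4) ^ (d + 1)"
      by (simp only: power_mult power_add power_one_right mult.assoc)
    finally have F: "real (card ?Ga) * (real (card ?Gs) * ?c) \<le> ?A ^ (d + 1) * ((real n * (2 * ?\<eta> / \<sigma>)) ^ 4) ^ (d + 1)" .
    have e3: "real n * (2 * ?\<eta> / \<sigma>) = 12 * (real n)\<^sup>2 * real d * \<delta> / \<sigma>" by (simp add: power2_eq_square)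
    have e4: "(?A * (12 * (real n)\<^sup>2 * real d * \<delta> / \<sigma>) ^ 4) ^ (d + 1) = ?A ^ (d + 1) * ((real n * (2 * ?\<eta> / \<sigma>)) ^ 4) ^ (d + 1)"
      unfolding e3 by (rule power_mult_distrib)
    show "real (card ?Ga) * (real (card ?Gs) * ?c) \<le> (?A * (12 * (real n)\<^sup>2 * real d * \<delta> / \<sigma>) ^ 4) ^ (d + 1)"
      unfolding e4 by (rule F)
  qed
qed

text \<open>The centers are rounded to multiples of \<rho>, with at most
  \<open>6 * R / \<rho>\<close> choices for each of \<open>d * k\<close> coordinates. For fixed
  centers the difference of two squared distances is affine in the point, so every point lies in one
  of at most \<open>k ^ 2\<close> slabs. By \<open>8 * \<rho> \<le> \<delta>\<close> the rounded
  centers still differ by \<open>\<delta> / 4\<close> in some coordinate, which the factor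
  \<open>4 / \<delta>\<close> turns into a pivot.\<close>

lemma outer_le_bisector_event:
  assumes \<rho>: "0 < \<rho>" "\<rho> \<le> R" and \<delta>: "8 * \<rho> \<le> \<delta>"
  shows "outer_le PP (\<lambda>X. bounded_by n d R X \<and> bisector_event n d k R \<rho> \<delta> X)
    ((6 * R / \<rho> * (real n * (real k)\<^sup>2 * (108 * real d * R * \<rho> / \<delta> / \<sigma>)) ^ 6) ^ (d * k))"
proof -
  have \<delta>0: "0 < \<delta>" and R: "0 < R" using \<rho> \<delta> by linarith+
  let ?G = "\<Pi>\<^sub>E i\<in>{..<k}. \<Pi>\<^sub>E l\<in>{..<d}. grid \<rho> (2 * R)"
  \<comment> \<open>54 = 2 * (13 + 2 * 7): the error allowed by the event plus the rounding of two
    centers, multiplied by \<open>2 / \<delta>\<close>.\<close>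
  let ?\<eta> = "54 * real d * R * \<rho> / \<delta>"
  let ?h = "\<lambda>C (i, i'). ((\<lambda>l. 4 / \<delta> * (C i' l - C i l)), 2 / \<delta> * (\<Sum>l<d. (C i' l)\<^sup>2 - (C i l)\<^sup>2)) :: vec \<times> real"
  let ?I = "\<lambda>C. {(i, i'). i < k \<and> i' < k \<and> (\<exists>l<d. \<delta> / 4 \<le> \<bar>C i' l - C i l\<bar>)}"
  let ?H = "\<lambda>C. ?h C ` ?I C"
  let ?E = "\<lambda>C X. \<exists>T\<subseteq>{..<n}. card T = 6 * d * k \<and>
     (\<forall>j\<in>T. \<exists>(a, s)\<in>?H C. \<bar>(\<Sum>l<d. a l * X j l) - s\<bar> \<le> ?\<eta>)"
  let ?c = "(real n * (real k)\<^sup>2 * (2 * ?\<eta> / \<sigma>)) ^ (6 * d * k)"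
  have \<eta>0: "0 \<le> ?\<eta>" using R \<rho> \<delta>0 by simp
  have c0: "0 \<le> ?c"
    by (intro zero_le_power mult_nonneg_nonneg divide_nonneg_nonneg \<eta>0) (use \<sigma> in auto)
  have s1: "outer_le PP (?E C) ?c" for C :: "nat \<Rightarrow> vec"
  proof -
    have sub: "?I C \<subseteq> {..<k} \<times> {..<k}" by auto
    then have fin: "finite (?I C)" by (rule finite_subset) simp
    have "card (?H C) \<le> card (?I C)" by (rule card_image_le[OF fin])
    also have "\<dots> \<le> card ({..<k} \<times> {..<k})" by (rule card_mono[OF _ sub]) simp
    also have "\<dots> = k\<^sup>2" by (simp add: card_cartesian_product power2_eq_square)
    finally have "real (card (?H C)) \<le> real (k\<^sup>2)" by (rule of_nat_mono)
    then have card: "real (card (?H C)) \<le> (real k)\<^sup>2" by simp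
    have o1: "outer_le PP (?E C) ((real n * real (card (?H C)) * (2 * ?\<eta> / \<sigma>)) ^ (6 * d * k))"
    proof (rule outer_le_slabs[OF \<eta>0])
      show "finite (?H C)" using fin by simp
      fix a s assume "(a, s) \<in> ?H C"
      then obtain i i' l where l: "l < d" "\<delta> / 4 \<le> \<bar>C i' l - C i l\<bar>" and a: "a = (\<lambda>l. 4 / \<delta> * (C i' l - C i l))"
        by auto
      have "4 / \<delta> * (\<delta> / 4) \<le> 4 / \<delta> * \<bar>C i' l - C i l\<bar>" using \<delta>0 l by (intro mult_left_mono) auto
      moreover have "\<bar>a l\<bar> = 4 / \<delta> * \<bar>C i' l - C i l\<bar>" unfolding a abs_mult using \<delta>0 by simp
      ultimately have "1 \<le> \<bar>a l\<bar>" using \<delta>0 by simp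
      then show "\<exists>l<d. 1 \<le> \<bar>a l\<bar>" using l by blast
    qed
    have o2: "(real n * real (card (?H C)) * (2 * ?\<eta> / \<sigma>)) ^ (6 * d * k) \<le> ?c"
    proof -
      have "0 \<le> 2 * ?\<eta> / \<sigma>" by (intro divide_nonneg_nonneg mult_nonneg_nonneg \<eta>0) (use \<sigma> in auto)
      then show ?thesis
        by (intro power_mono mult_right_mono mult_left_mono card mult_nonneg_nonneg of_nat_0_le_iff)
    qed
    show ?thesis by (rule outer_le_mono[OF o1 _ o2])
  qed
  have finG: "finite ?G" by (intro finite_PiE) auto
  have "outer_le PP (\<lambda>X. \<exists>C\<in>?G. ?E C X) (real (card ?G) * ?c)"
    by (intro outer_le_Bex s1 c0 finG)
  then show ?thesis
  proof (rule outer_le_mono)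
    fix X assume "bounded_by n d R X \<and> bisector_event n d k R \<rho> \<delta> X"
    then have X: "\<And>j l. j < n \<Longrightarrow> l < d \<Longrightarrow> \<bar>X j l\<bar> \<le> R" and be: "bisector_event n d k R \<rho> \<delta> X"
      by (auto simp: bounded_by_def)
    from be obtain T C where T: "T \<subseteq> {..<n}" "card T = 6 * d * k" and C: "\<And>i l. i < k \<Longrightarrow> l < d \<Longrightarrow> \<bar>C i l\<bar> \<le> 2 * R"
      and mv: "\<And>j. j \<in> T \<Longrightarrow> \<exists>i<k. \<exists>i'<k. (\<exists>l<d. \<delta> - 3 * \<rho> \<le> \<bar>C i l - C i' l\<bar>) \<and>
          \<bar>sqdist d (X j) (C i) - sqdist d (X j) (C i')\<bar> \<le> 13 * real d * R * \<rho>"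
      unfolding bisector_event_def by blast
    have "\<forall>i\<in>{..<k}. \<exists>g. g \<in> (\<Pi>\<^sub>E l\<in>{..<d}. grid \<rho> (2 * R)) \<and> (\<forall>l<d. \<bar>g l - C i l\<bar> \<le> \<rho>)"
    proof
      fix i assume "i \<in> {..<k}"
      then have "\<bar>C i l\<bar> \<le> 2 * R" if "l < d" for l using C that by simp
      from grid_approx_fun[where y="C i" and B="2 * R", OF \<rho>(1) this]
      show "\<exists>g. g \<in> (\<Pi>\<^sub>E l\<in>{..<d}. grid \<rho> (2 * R)) \<and> (\<forall>l<d. \<bar>g l - C i l\<bar> \<le> \<rho>)" by (simp only: Bex_def)
    qed
    from bchoice[OF this] obtain C' where "\<forall>i\<in>{..<k}. C' i \<in> (\<Pi>\<^sub>E l\<in>{..<d}. grid \<rho> (2 * R)) \<and> (\<forall>l<d. \<bar>C' i l - C i l\<bar> \<le> \<rho>)"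
      by (elim exE)
    then have C': "\<And>i. i < k \<Longrightarrow> C' i \<in> (\<Pi>\<^sub>E l\<in>{..<d}. grid \<rho> (2 * R))"
      "\<And>i l. i < k \<Longrightarrow> l < d \<Longrightarrow> \<bar>C' i l - C i l\<bar> \<le> \<rho>" by simp_all
    define D where "D = restrict C' {..<k}"
    have DG: "D \<in> ?G" using C'(1) by (simp add: D_def)
    have DC: "\<bar>D i l - C i l\<bar> \<le> \<rho>" if "i < k" "l < d" for i l using C'(2)[OF that] that by (simp add: D_def)
    have "\<exists>(a, s)\<in>?H D. \<bar>(\<Sum>l<d. a l * X j l) - s\<bar> \<le> ?\<eta>" if jT: "j \<in> T" for j
    proof -
      from mv[OF jT] obtain i i' l where i: "i < k" "i' < k" and l: "l < d" "\<delta> - 3 * \<rho> \<le> \<bar>C i l - C i' l\<bar>"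
        and sq: "\<bar>sqdist d (X j) (C i) - sqdist d (X j) (C i')\<bar> \<le> 13 * real d * R * \<rho>" by blast
      have jn: "j < n" using jT T by auto
      have "\<delta> / 4 \<le> \<bar>D i' l - D i l\<bar>" using DC[OF i(1) l(1)] DC[OF i(2) l(1)] l(2) \<delta> \<rho> by linarith
      then have I: "(i, i') \<in> ?I D" using i l by auto
      have app: "\<bar>sqdist d (X j) (D a) - sqdist d (X j) (C a)\<bar> \<le> real d * (\<rho> * (2 * R + 3 * R + 2 * R))" if "a < k" for a
      proof (rule abs_sqdist_diff_le)
        fix l assume l: "l < d"
        show "\<bar>D a l\<bar> \<le> 3 * R" using DC[OF that l] C[OF that l] \<rho>(2) by linarith
      qed (use that DC C X jn in auto)
      have "\<bar>sqdist d (X j) (D i) - sqdist d (X j) (D i')\<bar> \<le> 13 * real d * R * \<rho> + 2 * (real d * (\<rho> * (2 * R + 3 * R + 2 * R)))"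
        using app[OF i(1)] app[OF i(2)] sq by linarith
      also have "\<dots> = 27 * real d * R * \<rho>" by (simp add: algebra_simps)
      finally have "2 / \<delta> * \<bar>sqdist d (X j) (D i) - sqdist d (X j) (D i')\<bar> \<le> 2 / \<delta> * (27 * real d * R * \<rho>)"
        using \<delta>0 by (intro mult_left_mono) auto
      moreover have "\<bar>2 / \<delta> * (sqdist d (X j) (D i) - sqdist d (X j) (D i'))\<bar> = 2 / \<delta> * \<bar>sqdist d (X j) (D i) - sqdist d (X j) (D i')\<bar>"
        unfolding abs_mult using \<delta>0 by simp
      moreover have "2 / \<delta> * (27 * real d * R * \<rho>) = ?\<eta>" by simp
      ultimately have "\<bar>2 / \<delta> * (sqdist d (X j) (D i) - sqdist d (X j) (D i'))\<bar> \<le> ?\<eta>" by (simp only:)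
      moreover have "2 / \<delta> * (sqdist d (X j) (D i) - sqdist d (X j) (D i')) =
          (\<Sum>l<d. 4 / \<delta> * (D i' l - D i l) * X j l) - 2 / \<delta> * (\<Sum>l<d. (D i' l)\<^sup>2 - (D i l)\<^sup>2)"
        unfolding sqdist_def sum_subtractf[symmetric] sum_distrib_left
        using \<delta>0 by (intro sum.cong refl) (simp add: field_simps power2_eq_square)
      ultimately have "\<bar>(\<Sum>l<d. 4 / \<delta> * (D i' l - D i l) * X j l) - 2 / \<delta> * (\<Sum>l<d. (D i' l)\<^sup>2 - (D i l)\<^sup>2)\<bar> \<le> ?\<eta>"
        by (simp only:)
      then show ?thesis by (intro bexI[OF _ imageI[OF I]]) simp
    qed
    then have "?E D X" using T by blast
    then show "\<exists>C\<in>?G. ?E C X" using DG by blast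
  next
    have r: "1 \<le> R / \<rho>" using \<rho> by simp
    have "real (card ?G) = (real (card (grid \<rho> (2 * R))) ^ d) ^ k" by (simp add: card_PiE)
    also have "\<dots> = real (card (grid \<rho> (2 * R))) ^ (d * k)" by (simp add: power_mult)
    also have "\<dots> \<le> (6 * R / \<rho>) ^ (d * k)"
    proof (rule power_mono)
      have "real (card (grid \<rho> (2 * R))) \<le> 2 * (2 * R) / \<rho> + 2" using \<rho> R by (intro card_grid_le) auto
      also have "\<dots> \<le> 6 * R / \<rho>" using r by simp
      finally show "real (card (grid \<rho> (2 * R))) \<le> 6 * R / \<rho>" .
    qed simp
    finally have F: "real (card ?G) * ?c \<le> (6 * R / \<rho>) ^ (d * k) * ?c" using c0 by (rule mult_right_mono)
    let ?B = "real n * (real k)\<^sup>2 * (108 * real d * R * \<rho> / \<delta> / \<sigma>)"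
    have "2 * ?\<eta> / \<sigma> = 108 * real d * R * \<rho> / \<delta> / \<sigma>" by simp
    then have e1: "?c = (?B ^ 6) ^ (d * k)" by (simp only: power_mult[symmetric] mult.assoc)
    show "real (card ?G) * ?c \<le> (6 * R / \<rho> * ?B ^ 6) ^ (d * k)"
      using F unfolding power_mult_distrib[of "6 * R / \<rho>" "?B ^ 6" "d * k"] e1[symmetric] .
  qed
qed

end

section \<open>Gaussian tails and the bounding box\<close>

text \<open>Half of the exponent is at most \<open>- s ^ 2 / 4\<close> on the tail; the other half
  is the exponent of a Gaussian with standard deviation \<open>sqrt 2 * \<sigma>\<close>, whose
  normalization differs by a factor at most 2.\<close>

lemma normal_tail:
  assumes \<sigma>: "0 < \<sigma>" and s: "0 \<le> s"
  shows "emeasure (density lborel (normal_density m \<sigma>)) {y. s * \<sigma> < \<bar>y - m\<bar>} \<le> ennreal (2 * exp (- s\<^sup>2 / 4))"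
proof -
  let ?A = "{y. s * \<sigma> < \<bar>y - m\<bar>}"
  interpret N: prob_space "density lborel (normal_density m (sqrt 2 * \<sigma>))" using \<sigma> by (intro prob_space_normal_density) auto
  have le: "normal_density m \<sigma> y \<le> 2 * exp (- s\<^sup>2 / 4) * normal_density m (sqrt 2 * \<sigma>) y" if "y \<in> ?A" for y
  proof -
    have "s * \<sigma> < \<bar>y - m\<bar>" using that by simp
    then have "(s * \<sigma>)\<^sup>2 \<le> \<bar>y - m\<bar>\<^sup>2" using s \<sigma> by (intro power_mono) auto
    then have sq: "s\<^sup>2 * \<sigma>\<^sup>2 \<le> (y - m)\<^sup>2" by (simp add: power_mult_distrib)
    have "s\<^sup>2 / 4 \<le> (y - m)\<^sup>2 / (4 * \<sigma>\<^sup>2)" using sq \<sigma> by (simp add: field_simps)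
    then have "- (y - m)\<^sup>2 / (2 * \<sigma>\<^sup>2) \<le> - s\<^sup>2 / 4 + - (y - m)\<^sup>2 / (4 * \<sigma>\<^sup>2)" by (simp add: field_simps)
    then have e: "exp (- (y - m)\<^sup>2 / (2 * \<sigma>\<^sup>2)) \<le> exp (- s\<^sup>2 / 4) * exp (- (y - m)\<^sup>2 / (4 * \<sigma>\<^sup>2))"
      by (simp add: exp_add[symmetric])
    have q: "sqrt (2 * pi * (sqrt 2 * \<sigma>)\<^sup>2) = sqrt 2 * sqrt (2 * pi * \<sigma>\<^sup>2)"
      by (simp add: power_mult_distrib real_sqrt_mult)
    have s2: "sqrt 2 \<le> (2::real)" by (rule real_le_lsqrt) auto
    let ?q = "sqrt (2 * pi * \<sigma>\<^sup>2)" and ?E = "exp (- s\<^sup>2 / 4) * exp (- (y - m)\<^sup>2 / (4 * \<sigma>\<^sup>2))"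
    have q0: "0 < ?q" using \<sigma> by simp
    have "normal_density m \<sigma> y \<le> 1 / ?q * ?E"
      unfolding normal_density_def using e q0 by (intro mult_left_mono) auto
    also have "\<dots> \<le> (2 / sqrt 2) * (1 / ?q * ?E)"
    proof -
      have "1 \<le> 2 / sqrt 2" using s2 by simp
      from mult_right_mono[OF this, of "1 / ?q * ?E"] q0 show ?thesis by simp
    qed
    also have "\<dots> = 2 * exp (- s\<^sup>2 / 4) * normal_density m (sqrt 2 * \<sigma>) y"
      unfolding normal_density_def q by (simp add: power_mult_distrib)
    finally show ?thesis .
  qed
  have "emeasure (density lborel (normal_density m \<sigma>)) ?A = (\<integral>\<^sup>+y. ennreal (normal_density m \<sigma> y) * indicator ?A y \<partial>lborel)"
    by (rule emeasure_density) auto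
  also have "\<dots> \<le> (\<integral>\<^sup>+y. ennreal (2 * exp (- s\<^sup>2 / 4)) * (ennreal (normal_density m (sqrt 2 * \<sigma>) y)) \<partial>lborel)"
  proof (rule nn_integral_mono)
    fix y
    show "ennreal (normal_density m \<sigma> y) * indicator ?A y \<le> ennreal (2 * exp (- s\<^sup>2 / 4)) * ennreal (normal_density m (sqrt 2 * \<sigma>) y)"
    proof (cases "y \<in> ?A")
      case True
      then show ?thesis using le[OF True] by (simp add: ennreal_mult[symmetric] ennreal_leI)
    qed simp
  qed
  also have "\<dots> = ennreal (2 * exp (- s\<^sup>2 / 4)) * (\<integral>\<^sup>+y. ennreal (normal_density m (sqrt 2 * \<sigma>) y) \<partial>lborel)"
    by (rule nn_integral_cmult) simp
  also have "(\<integral>\<^sup>+y. ennreal (normal_density m (sqrt 2 * \<sigma>) y) \<partial>lborel) = 1"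
    using N.emeasure_space_1 by (simp add: emeasure_density)
  finally show ?thesis by simp
qed

context gaussian_points
begin

lemma distr_coordinate:
  assumes "j < n" "l < d"
  shows "distr PP (density lborel (normal_density (\<mu> j l) \<sigma>)) (\<lambda>X. X j l) = density lborel (normal_density (\<mu> j l) \<sigma>)"
proof -
  let ?N = "\<lambda>j l. density lborel (normal_density (\<mu> j l) \<sigma>)"
  let ?P = "\<lambda>j. PiM {..<d} (?N j)"
  have pN: "prob_space (?N i l)" for i l by (rule prob_space_normal[OF \<sigma>])
  have pP: "prob_space (?P i)" for i by (rule prob_space_PiM[OF pN])
  have "distr PP (?N j l) (\<lambda>X. X j l) = distr (distr PP (?P j) (\<lambda>X. X j)) (?N j l) (\<lambda>x. x l)"
  proof (subst distr_distr)
    show "(\<lambda>X. X j) \<in> measurable PP (?P j)"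
      unfolding perturbed_points_def using assms by (intro measurable_component_singleton) simp
    show "(\<lambda>x. x l) \<in> measurable (?P j) (?N j l)"
      using assms by (intro measurable_component_singleton) simp
  qed (simp add: comp_def)
  also have "distr PP (?P j) (\<lambda>X. X j) = ?P j"
    unfolding perturbed_points_def using assms by (intro distr_PiM_component pP) auto
  also have "distr (?P j) (?N j l) (\<lambda>x. x l) = ?N j l"
    using assms by (intro distr_PiM_component pN) auto
  finally show ?thesis .
qed

lemma outer_le_not_bounded:
  assumes \<mu>: "\<And>j l. j < n \<Longrightarrow> l < d \<Longrightarrow> 0 \<le> \<mu> j l \<and> \<mu> j l \<le> 1" and s: "0 \<le> s"
  shows "outer_le PP (\<lambda>X. \<not> bounded_by n d (1 + s * \<sigma>) X) (real n * (real d * (2 * exp (- s\<^sup>2 / 4))))"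
proof -
  have one: "outer_le PP (\<lambda>X. 1 + s * \<sigma> < \<bar>X j l\<bar>) (2 * exp (- s\<^sup>2 / 4))" if jl: "j \<in> {..<n}" "l \<in> {..<d}" for j l
  proof (rule outer_leI)
    let ?N = "density lborel (normal_density (\<mu> j l) \<sigma>)"
    let ?A = "{y. s * \<sigma> < \<bar>y - \<mu> j l\<bar>}"
    have m: "(\<lambda>X. X j l) \<in> measurable PP ?N" using measurable_coordinate[of j n l d] jl by simp
    have A: "?A \<in> sets ?N" by simp
    show "{X \<in> space PP. 1 + s * \<sigma> < \<bar>X j l\<bar>} \<subseteq> (\<lambda>X. X j l) -` ?A \<inter> space PP" using \<mu>[of j l] jl by auto
    show "(\<lambda>X. X j l) -` ?A \<inter> space PP \<in> sets PP" using m A by (rule measurable_sets)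
    have "emeasure PP ((\<lambda>X. X j l) -` ?A \<inter> space PP) = emeasure (distr PP ?N (\<lambda>X. X j l)) ?A"
      using emeasure_distr[OF m A] by simp
    also have "\<dots> = emeasure ?N ?A" using distr_coordinate[of j l] jl by simp
    also have "\<dots> \<le> ennreal (2 * exp (- s\<^sup>2 / 4))" by (rule normal_tail[OF \<sigma> s])
    finally show "emeasure PP ((\<lambda>X. X j l) -` ?A \<inter> space PP) \<le> ennreal (2 * exp (- s\<^sup>2 / 4))" .
  qed
  have "outer_le PP (\<lambda>X. \<exists>j\<in>{..<n}. \<exists>l\<in>{..<d}. 1 + s * \<sigma> < \<bar>X j l\<bar>)
    (real (card {..<n}) * (real (card {..<d}) * (2 * exp (- s\<^sup>2 / 4))))"
    by (intro outer_le_Bex one) auto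
  then show ?thesis by (rule outer_le_mono) (auto simp: bounded_by_def not_le)
qed

end

section \<open>The expected number of iterations\<close>

lemma power_le_power_of_le_1:
  fixes x y :: real
  assumes "0 \<le> x" "x \<le> y" "y \<le> 1" "a \<le> b"
  shows "x ^ b \<le> y ^ a"
proof -
  have "x ^ b \<le> y ^ b" using assms by (intro power_mono)
  also have "\<dots> \<le> y ^ a" using assms by (intro power_decreasing) auto
  finally show ?thesis .
qed

context kmeans_run
begin

text \<open>Without an event every window loses more than \<epsilon>, so \<open>N\<close>
  consecutive windows would exhaust the potential. They start at iteration 1, where
  \<open>pot_1_le\<close> applies.\<close>

lemma iterations_le_of_no_event:
  assumes d: "0 < d" and gen: "generic n d k c0 X" and bd: "bounded_by n d R X" and R: "0 \<le> R"
    and m: "m = k ^ b * 2 ^ k" and \<epsilon>: "0 < \<epsilon>" and \<rho>: "\<rho> = real m * sqrt \<epsilon>" "\<rho> \<le> R" "\<epsilon> \<le> real d * R * \<rho>"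
    and no: "\<not> slab_event n d \<delta> X" "\<not> means_event n d \<rho> X" "\<not> bisector_event n d k R \<rho> \<delta> X"
      "\<not> relation_event n d (22 * d * k) b \<rho> X"
    and N: "0 < N" "4 * real n * real d * R\<^sup>2 \<le> real N * \<epsilon>"
  shows "kmeans_iterations d n k X c0 \<le> enat (1 + N * m)"
proof (rule ccontr)
  assume "\<not> ?thesis"
  then have run: "\<not> stops u" if "1 \<le> u" "u \<le> 1 + N * m" for u using iterations_le[OF that] by blast
  have Xb: "\<And>j l. j < n \<Longrightarrow> l < d \<Longrightarrow> \<bar>X j l\<bar> \<le> R" using bd by (simp add: bounded_by_def)
  have step: "pot (1 + i * m) - pot (1 + i * m + m) > \<epsilon>" if "i < N" for i
  proof (rule ccontr)
    assume "\<not> ?thesis"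
    then have le: "pot (1 + i * m) - pot (1 + i * m + m) \<le> \<epsilon>" by simp
    have "Suc i * m \<le> N * m" using that by (intro mult_right_mono) auto
    then have "1 + i * m + m \<le> 1 + N * m" by simp
    then have "slab_event n d \<delta> X \<or> means_event n d \<rho> X \<or> bisector_event n d k R \<rho> \<delta> X \<or>
      relation_event n d (22 * d * k) b \<rho> X"
      using run \<epsilon> m by (intro window_events[OF d gen R Xb _ _ le _ _ \<rho>]) auto
    then show False using no by blast
  qed
  have "i \<le> N \<Longrightarrow> pot (1 + i * m) \<le> pot 1 - real i * \<epsilon>" for i
  proof (induction i)
    case (Suc i)
    then have "pot (1 + i * m) \<le> pot 1 - real i * \<epsilon>" "pot (1 + i * m) - pot (1 + i * m + m) > \<epsilon>" using step by auto
    moreover have "1 + Suc i * m = 1 + i * m + m" by simp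
    ultimately show ?case by (simp add: algebra_simps)
  qed simp
  \<comment> \<open>The last window is kept apart because its strict loss makes the potential
    negative, while the induction gives a weak inequality.\<close>
  then obtain N' where N': "N = Suc N'" "pot (1 + N' * m) \<le> pot 1 - real N' * \<epsilon>" using N(1) by (cases N) auto
  have "pot (1 + N' * m + m) < pot 1 - real N' * \<epsilon> - \<epsilon>" using step[of N'] N' by simp
  also have "\<dots> = pot 1 - real N * \<epsilon>" by (simp add: N' algebra_simps)
  also have "\<dots> \<le> 0" using pot_1_le[OF Xb] N(2) by linarith
  finally show False using pot_nonneg[of "1 + N' * m + m"] by linarith
qed

end

locale smoothed_kmeans = gaussian_points +
  fixes k :: nat and c0 :: "nat \<Rightarrow> vec"
  assumes n: "0 < n" and d: "0 < d" and k: "0 < k" and kn: "k \<le> n" and dn: "d \<le> n"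
    and \<mu>: "\<And>j l. j < n \<Longrightarrow> l < d \<Longrightarrow> 0 \<le> \<mu> j l \<and> \<mu> j l \<le> 1"
begin

text \<open>With \<open>4 * n\<close> standard deviations the tail is of order exp (- 4 * n^2),
  which beats the deterministic bound \<open>k ^ n + 1\<close>.\<close>

definition "R = 1 + (4 * real n) * \<sigma>"
text \<open>The size of the box in units of \<sigma>.\<close>

definition "r = 1 / \<sigma> + 4 * real n"
text \<open>The expectation contains \<open>m ^ 3\<close>, so \<open>k div 8\<close> uses 3/8 of the
  exponent \<open>k\<close>. The summand 2 ensures \<open>k \<le> 8 * b\<close> and
  \<open>2 \<le> b * d\<close>.\<close>

definition "b = 2 + k div 8"
definition "m = k ^ b * 2 ^ k"
text \<open>Collects what the events demand: 178 = 176 + 2 and \<open>8 ^ (22 * k)\<close> come from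
  the relations, \<open>r ^ 4\<close> and 4000000, whose square exceeds \<open>6 * 108 ^ 6\<close>,
  from the bisectors.\<close>

definition "K = 4000000 * (real n + 1) ^ 178 * 8 ^ (22 * k) * r ^ 4"
text \<open>The number of windows losing \<open>\<sigma> ^ 2 * e\<close> each that exhaust
  \<open>4 * n * d * R ^ 2\<close>, times \<open>m\<close>; the leading 1 is the iteration before
  the first window.\<close>

definition "iteration_bound e = 1 + nat \<lceil>4 * real n * real d * r\<^sup>2 / e\<rceil> * m"

lemma R_eq: "R = r * \<sigma>"
  using \<sigma> by (simp add: R_def r_def field_simps)

lemma r_ge: "4 \<le> r"
proof -
  have "4 * 1 \<le> 4 * real n" using n by simp
  moreover have "0 < 1 / \<sigma>" using \<sigma> by simp
  ultimately show ?thesis unfolding r_def by linarith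
qed

lemma m_ge: "1 \<le> m"
  using k by (simp add: m_def)

lemma K_ge: "4000000 * (real n + 1) ^ a * 8 ^ c * r ^ f \<le> K" if "a \<le> 178" "c \<le> 22 * k" "f \<le> 4"
  unfolding K_def using r_ge that by (intro mult_mono power_increasing mult_nonneg_nonneg) auto

text \<open>Lengths are measured in units of \<sigma>. Each of four events gets probability at most
  the square of \<open>u = p * K\<close>, and genericity fails with probability 0; \<open>u\<close>
  is proportional to \<open>sqrt e\<close>, so the total is linear in \<open>e\<close>.\<close>

lemma bad_event_bound:
  assumes e: "0 < e" "e \<le> 1"
  shows "outer_le PP (\<lambda>X. bounded_by n d R X \<and> \<not> kmeans_iterations d n k X c0 \<le> enat (iteration_bound e)) (4 * K\<^sup>2 * (real m)\<^sup>2 * e)"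
proof -
  define p where "p = real m * sqrt e"
  define \<epsilon> where "\<epsilon> = \<sigma>\<^sup>2 * e"
  define \<rho> where "\<rho> = \<sigma> * p"
  \<comment> \<open>Slabs ask for small \<delta>, bisectors for small
    \<open>\<rho> / \<delta>\<close>; this choice makes \<open>\<delta> / \<sigma>\<close> and
    \<open>\<rho> / \<delta>\<close> both equal to \<open>sqrt p\<close>.\<close>
  define \<delta> where "\<delta> = \<sigma> * sqrt p"
  define u where "u = p * K"
  have m1: "1 \<le> real m" using m_ge by simp
  have p0: "0 < p" using e m1 by (simp add: p_def)
  have K0: "4000000 \<le> K" using K_ge[of 0 0 0] by simp
  have u0: "0 < u" using p0 K0 by (simp add: u_def)
  have goal_eq: "4 * K\<^sup>2 * (real m)\<^sup>2 * e = 4 * u\<^sup>2" using e by (simp add: u_def p_def power_mult_distrib)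
  show ?thesis
  \<comment> \<open>For \<open>u > 1\<close> the claimed bound exceeds 1; otherwise exponents of
    bases below \<open>u\<close> may be lowered to 2.\<close>
  proof (cases "u \<le> 1")
    case False
    then have "1\<^sup>2 \<le> u\<^sup>2" by (intro power_mono) auto
    then show ?thesis unfolding goal_eq by (intro outer_le_one[OF prob_space_axioms]) simp
  next
    case u1: True
    let ?N = "real n + 1"
    have N: "1 \<le> ?N" "real n \<le> ?N" "real d \<le> ?N" "real k \<le> ?N" using dn kn by auto
    have pK: "p * x \<le> u" if "x \<le> K" for x unfolding u_def using that p0 by (intro mult_left_mono) auto
    have "p * 4000000 \<le> 1" using pK[OF K0] u1 by linarith
    then have ps: "p \<le> 1 / 4000000" by simp
    have sp: "sqrt p * sqrt p = p" "0 < sqrt p" using p0 by auto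
    have "sqrt p \<le> sqrt ((1 / 8)\<^sup>2)" using ps by (intro real_sqrt_le_mono) (simp add: power2_eq_square)
    then have s8: "sqrt p \<le> 1 / 8" by simp
    have \<epsilon>0: "0 < \<epsilon>" and \<rho>0: "0 < \<rho>" and \<delta>0: "0 < \<delta>" using e \<sigma> p0 by (auto simp: \<epsilon>_def \<rho>_def \<delta>_def)
    have \<rho>eq: "\<rho> = real m * sqrt \<epsilon>" using \<sigma> by (simp add: \<rho>_def \<epsilon>_def p_def real_sqrt_mult)
    have R0: "0 < R" using r_ge \<sigma> by (simp add: R_eq)
    have \<rho>R: "\<rho> \<le> R" using ps r_ge \<sigma> by (simp add: \<rho>_def R_eq mult.commute)
    have \<epsilon>R: "\<epsilon> \<le> real d * R * \<rho>"
    proof -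
      have "e \<le> sqrt e" using e by (intro real_le_rsqrt) (simp add: power2_eq_square mult_left_le)
      also have "\<dots> \<le> p" using mult_right_mono[OF m1, of "sqrt e"] e by (simp add: p_def)
      finally have "e \<le> p" .
      also have "1 * p \<le> (real d * r) * p" using r_ge d p0 mult_mono[of 1 "real d" 1 r] by (intro mult_right_mono) auto
      finally have "\<sigma>\<^sup>2 * e \<le> \<sigma>\<^sup>2 * (real d * r * p)" by (intro mult_left_mono) auto
      then show ?thesis by (simp add: \<epsilon>_def R_eq \<rho>_def power2_eq_square mult_ac)
    qed
    have \<delta>R: "2 * \<delta> \<le> R"
    proof -
      have "2 * sqrt p \<le> r" using s8 r_ge by linarith
      from mult_left_mono[OF this, of \<sigma>] show ?thesis using \<sigma> by (simp add: \<delta>_def R_eq mult_ac)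
    qed
    have \<rho>\<delta>: "8 * \<rho> \<le> \<delta>"
    proof -
      have "8 * (sqrt p * sqrt p) \<le> 1 * sqrt p" using mult_right_mono[OF s8, of "sqrt p"] sp by simp
      then have "8 * p \<le> sqrt p" using sp by simp
      from mult_left_mono[OF this, of \<sigma>] show ?thesis using \<sigma> by (simp add: \<delta>_def \<rho>_def)
    qed
    have E1: "outer_le PP (\<lambda>X. \<not> generic n d k c0 X) 0" by (rule outer_le_not_generic[OF d])
    have E2: "outer_le PP (\<lambda>X. bounded_by n d R X \<and> slab_event n d \<delta> X) (u\<^sup>2)"
    proof (rule outer_le_mono[OF outer_le_slab_event[OF n d \<delta>0 \<delta>R]])
      let ?B = "4 * real n * real d * R / \<delta> * (12 * (real n)\<^sup>2 * real d * \<delta> / \<sigma>) ^ 4"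
      have "?B = 82944 * ((real n * (real n) ^ 8) * (real d * real d ^ 4)) * r * (sqrt p * (sqrt p * sqrt p))"
        using \<sigma> sp by (simp add: R_eq \<delta>_def power_mult_distrib field_simps power4_eq_xxxx power2_eq_square eval_nat_numeral)
      also have "\<dots> \<le> 4000000 * (?N ^ 9 * ?N ^ 5) * r * (1 * p)"
      proof -
        have "real n * (real n) ^ 8 \<le> ?N ^ 9" using power_mono[OF N(2), of 9] by (simp add: eval_nat_numeral)
        moreover have "real d * real d ^ 4 \<le> ?N ^ 5" using power_mono[OF N(3), of 5] by (simp add: eval_nat_numeral)
        moreover have "sqrt p * (sqrt p * sqrt p) \<le> 1 * p" 
        proof -
          have "sqrt p \<le> 1" using s8 by linarith
          then show ?thesis unfolding sp(1) using p0 by (intro mult_right_mono) simp_all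
        qed
        ultimately show ?thesis using r_ge sp by (intro mult_mono) auto
      qed
      also have "\<dots> = p * (4000000 * ?N ^ 14 * 8 ^ 0 * r ^ 1)" by (simp add: power_add[symmetric])
      also have "\<dots> \<le> u" by (intro pK K_ge) auto
      finally have "?B \<le> u" .
      moreover have "0 \<le> ?B" using R0 \<delta>0 \<sigma> by simp
      \<comment> \<open>Of the three factors \<open>sqrt p\<close> in the base, \<open>p\<close> is
        kept; the exponent \<open>d + 1 \<ge> 2\<close> then yields the square.\<close>
      ultimately show "?B ^ (d + 1) \<le> u\<^sup>2" using u1 d by (intro power_le_power_of_le_1) auto
    qed
    have E3: "outer_le PP (means_event n d \<rho>) (u\<^sup>2)"
    proof (rule outer_le_mono[OF outer_le_means_event])
      have "?N ^ (3 * (4 * d + 3)) * (2 * real (4 * d + 3) * \<rho> / \<sigma>) ^ (2 * d) \<le> (?N ^ 11) ^ (2 * d) * (14 * ?N * p) ^ (2 * d)"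
      proof (rule mult_mono)
        \<comment> \<open>12 * d + 9 is at most 22 * d since \<open>d\<close> is positive.\<close>
        have "?N ^ (3 * (4 * d + 3)) \<le> ?N ^ (11 * (2 * d))" using N d by (intro power_increasing) auto
        then show "?N ^ (3 * (4 * d + 3)) \<le> (?N ^ 11) ^ (2 * d)" by (simp only: power_mult)
        have "2 * real (4 * d + 3) \<le> 14 * ?N" using N d by simp
        then have "2 * real (4 * d + 3) * p \<le> 14 * ?N * p" using p0 by (intro mult_right_mono) auto
        moreover have "2 * real (4 * d + 3) * \<rho> / \<sigma> = 2 * real (4 * d + 3) * p" using \<sigma> by (simp add: \<rho>_def)
        ultimately show "(2 * real (4 * d + 3) * \<rho> / \<sigma>) ^ (2 * d) \<le> (14 * ?N * p) ^ (2 * d)"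
          using p0 by (intro power_mono) auto
      qed (use \<rho>0 \<sigma> in auto)
      also have "\<dots> = (?N ^ 11 * (14 * ?N * p)) ^ (2 * d)" by (rule power_mult_distrib[symmetric])
      also have "\<dots> \<le> u\<^sup>2"
      proof (rule power_le_power_of_le_1)
        have "?N ^ 11 * (14 * ?N * p) = p * (14 * ?N ^ 12 * 8 ^ 0 * r ^ 0)" by (simp add: eval_nat_numeral)
        also have "\<dots> \<le> p * (4000000 * ?N ^ 12 * 8 ^ 0 * r ^ 0)" using p0 by (intro mult_left_mono mult_right_mono) auto
        also have "\<dots> \<le> u" by (intro pK K_ge) auto
        finally show "?N ^ 11 * (14 * ?N * p) \<le> u" .
      qed (use u1 p0 d in auto)
      finally show "?N ^ (3 * (4 * d + 3)) * (2 * real (4 * d + 3) * \<rho> / \<sigma>) ^ (2 * d) \<le> u\<^sup>2" .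
    qed (use \<rho>0 in auto)
    have E4: "outer_le PP (\<lambda>X. bounded_by n d R X \<and> bisector_event n d k R \<rho> \<delta> X) (u\<^sup>2)"
    proof (rule outer_le_mono[OF outer_le_bisector_event[OF \<rho>0 \<rho>R \<rho>\<delta>]])
      let ?B = "6 * R / \<rho> * (real n * (real k)\<^sup>2 * (108 * real d * R * \<rho> / \<delta> / \<sigma>)) ^ 6"
      have pd: "p / sqrt p = sqrt p" using sp by (simp add: real_div_sqrt p0 less_imp_le)
      have q1: "6 * R / \<rho> = 6 * r / p" using \<sigma> by (simp add: R_eq \<rho>_def)
      have "R * \<rho> / \<delta> / \<sigma> = r * (p / sqrt p)" using \<sigma> sp by (simp add: R_eq \<rho>_def \<delta>_def)
      moreover have "108 * real d * R * \<rho> / \<delta> / \<sigma> = 108 * (real d * (R * \<rho> / \<delta> / \<sigma>))" by simp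
      ultimately have q2: "108 * real d * R * \<rho> / \<delta> / \<sigma> = 108 * (real d * (r * sqrt p))"
        by (simp only: pd)
      have q3: "real n * (real k)\<^sup>2 * (108 * (real d * (r * sqrt p))) = 108 * ((real n * (real k)\<^sup>2 * real d) * (r * sqrt p))"
        by (simp add: mult_ac)
      have nk: "real n * (real k)\<^sup>2 * real d \<le> ?N * ?N\<^sup>2 * ?N" using N by (intro mult_mono power_mono) auto
      have "?B \<le> 6 * r / p * (108 * ((?N * ?N\<^sup>2 * ?N) * (r * sqrt p))) ^ 6"
        unfolding q1 q2 q3 using nk r_ge p0 sp by (intro mult_left_mono power_mono mult_right_mono mult_nonneg_nonneg) auto
      also have "\<dots> = 6 * 108 ^ 6 * (?N ^ 24 * r ^ 7 * (sqrt p) ^ 6 / p)"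
        by (simp add: power_mult_distrib eval_nat_numeral)
      \<comment> \<open>Six points with a factor \<open>sqrt p\<close> each give
        \<open>p ^ 3\<close>; the grid takes one factor, and \<open>p ^ 2\<close> remains even if
        \<open>d * k = 1\<close>.\<close>
      also have "(sqrt p) ^ 6 = p ^ 3" using sp by (simp add: eval_nat_numeral)
      also have "6 * 108 ^ 6 * (?N ^ 24 * r ^ 7 * p ^ 3 / p) = 6 * 108 ^ 6 * (?N ^ 24 * r ^ 7 * p\<^sup>2)"
        using p0 by (simp add: eval_nat_numeral)
      also have "\<dots> \<le> 4000000\<^sup>2 * (?N ^ 24 * r ^ 8 * p\<^sup>2)"
      proof (rule mult_mono)
        show "?N ^ 24 * r ^ 7 * p\<^sup>2 \<le> ?N ^ 24 * r ^ 8 * p\<^sup>2"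
          using r_ge N(1) by (intro mult_right_mono mult_left_mono power_increasing) auto
      qed (use r_ge in auto)
      also have "\<dots> = (p * (4000000 * ?N ^ 12 * 8 ^ 0 * r ^ 4))\<^sup>2" by (simp add: power_mult_distrib eval_nat_numeral)
      also have "\<dots> \<le> u\<^sup>2"
      proof (rule power_mono)
        show "p * (4000000 * ?N ^ 12 * 8 ^ 0 * r ^ 4) \<le> u" by (intro pK K_ge) auto
      qed (use p0 r_ge in auto)
      finally have B: "?B \<le> u\<^sup>2" .
      moreover have "u\<^sup>2 \<le> 1" using u0 u1 by (simp add: power_le_one)
      moreover have "0 \<le> ?B" using R0 \<delta>0 \<rho>0 \<sigma> by simp
      ultimately have "?B ^ (d * k) \<le> (u\<^sup>2) ^ 1" using d k by (intro power_le_power_of_le_1) (auto simp: Suc_le_eq)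
      then show "?B ^ (d * k) \<le> u\<^sup>2" by simp
    qed
    have E5: "outer_le PP (relation_event n d (22 * d * k) b \<rho>) (u\<^sup>2)"
    proof (rule outer_le_mono[OF outer_le_relation_event])
      let ?q = "22 * d * k"
      have kb: "k \<le> 8 * b" unfolding b_def by simp
      have "?N ^ ?q * 8 ^ (?q * b) * (4 * (real n)\<^sup>2 * \<rho> / \<sigma>) ^ (b * d)
        \<le> (?N ^ 176) ^ (b * d) * (8 ^ (22 * k)) ^ (b * d) * (4 * ?N\<^sup>2 * p) ^ (b * d)"
      proof (intro mult_mono)
        \<comment> \<open>176 = 22 * 8: the choice of the moved points is distributed over the
          \<open>b * d\<close> forms.\<close>
        have "d * k \<le> d * (8 * b)" using kb by (rule mult_le_mono2)
        then have "?N ^ ?q \<le> ?N ^ (176 * (b * d))" using N by (intro power_increasing) (auto simp: mult_ac)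
        then show "?N ^ ?q \<le> (?N ^ 176) ^ (b * d)" by (simp only: power_mult)
        have "?q * b = 22 * k * (b * d)" by simp
        then show "(8::real) ^ (?q * b) \<le> (8 ^ (22 * k)) ^ (b * d)" by (simp only: power_mult)
        have "4 * (real n)\<^sup>2 * \<rho> / \<sigma> = 4 * (real n)\<^sup>2 * p" using \<sigma> by (simp add: \<rho>_def)
        also have "\<dots> \<le> 4 * ?N\<^sup>2 * p" using N p0 by (intro mult_right_mono mult_left_mono power_mono) auto
        finally show "(4 * (real n)\<^sup>2 * \<rho> / \<sigma>) ^ (b * d) \<le> (4 * ?N\<^sup>2 * p) ^ (b * d)"
          using \<rho>0 \<sigma> by (intro power_mono) auto
      qed (use \<rho>0 \<sigma> in auto)
      also have "\<dots> = (?N ^ 176 * 8 ^ (22 * k) * (4 * ?N\<^sup>2 * p)) ^ (b * d)" by (simp only: power_mult_distrib)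
      also have "\<dots> \<le> u\<^sup>2"
      proof (rule power_le_power_of_le_1)
        have "?N ^ 176 * 8 ^ (22 * k) * (4 * ?N\<^sup>2 * p) = p * (4 * (?N ^ 176 * ?N\<^sup>2) * 8 ^ (22 * k) * r ^ 0)" by simp
        also have "?N ^ 176 * ?N\<^sup>2 = ?N ^ 178" by (simp only: power_add[symmetric]) simp
        also have "p * (4 * ?N ^ 178 * 8 ^ (22 * k) * r ^ 0) \<le> p * (4000000 * ?N ^ 178 * 8 ^ (22 * k) * r ^ 0)"
          using p0 by (intro mult_left_mono mult_right_mono) auto
        also have "\<dots> \<le> u" by (intro pK K_ge) auto
        finally show "?N ^ 176 * 8 ^ (22 * k) * (4 * ?N\<^sup>2 * p) \<le> u" .
        have "2 * 1 \<le> b * d" using d unfolding b_def by (intro mult_le_mono) auto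
        then show "2 \<le> b * d" by simp
      qed (use u1 p0 in auto)
      finally show "?N ^ ?q * 8 ^ (?q * b) * (4 * (real n)\<^sup>2 * \<rho> / \<sigma>) ^ (b * d) \<le> u\<^sup>2" .
    qed (use \<rho>0 in auto)
    have "outer_le PP (\<lambda>X. \<not> generic n d k c0 X \<or> (bounded_by n d R X \<and> slab_event n d \<delta> X) \<or> means_event n d \<rho> X \<or>
       (bounded_by n d R X \<and> bisector_event n d k R \<rho> \<delta> X) \<or> relation_event n d (22 * d * k) b \<rho> X)
       (0 + (u\<^sup>2 + (u\<^sup>2 + (u\<^sup>2 + u\<^sup>2))))"
      by (intro outer_le_disj E1 E2 E3 E4 E5) auto
    then show ?thesis unfolding goal_eq
    proof (rule outer_le_mono)
      fix X assume X: "bounded_by n d R X \<and> \<not> kmeans_iterations d n k X c0 \<le> enat (iteration_bound e)"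
      interpret kr: kmeans_run d n k X c0 by standard (rule k)
      let ?x = "4 * real n * real d * r\<^sup>2 / e"
      have x0: "0 < ?x" using n d r_ge e by simp
      have "?x \<le> real (nat \<lceil>?x\<rceil>)" by (rule real_nat_ceiling_ge)
      then have "?x * \<epsilon> \<le> real (nat \<lceil>?x\<rceil>) * \<epsilon>" using \<epsilon>0 by (intro mult_right_mono) auto
      moreover have "?x * \<epsilon> = 4 * real n * real d * R\<^sup>2" using e by (simp add: \<epsilon>_def R_eq power_mult_distrib)
      ultimately have N: "4 * real n * real d * R\<^sup>2 \<le> real (nat \<lceil>?x\<rceil>) * \<epsilon>" by simp
      have N0: "0 < nat \<lceil>?x\<rceil>" using x0 by (simp add: zero_less_ceiling)
      show "\<not> generic n d k c0 X \<or> (bounded_by n d R X \<and> slab_event n d \<delta> X) \<or> means_event n d \<rho> X \<or>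
       (bounded_by n d R X \<and> bisector_event n d k R \<rho> \<delta> X) \<or> relation_event n d (22 * d * k) b \<rho> X"
      proof (rule ccontr)
        assume "\<not> ?thesis"
        then have "kmeans_iterations d n k X c0 \<le> enat (1 + nat \<lceil>?x\<rceil> * m)"
          using X R0 by (intro kr.iterations_le_of_no_event[OF d _ _ _ m_def \<epsilon>0 \<rho>eq \<rho>R \<epsilon>R _ _ _ _ N0 N]) auto
        then show False using X by (simp add: iteration_bound_def)
      qed
    qed simp
  qed
qed

lemma iteration_bound_le: "0 < e \<Longrightarrow> e \<le> 1 \<Longrightarrow> real (iteration_bound e) \<le> 8 * (real n)\<^sup>2 * r\<^sup>2 * real m / e"
proof -
  assume e: "0 < e" "e \<le> 1"
  let ?x = "4 * real n * real d * r\<^sup>2 / e"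
  have m1: "1 \<le> real m" using m_ge by simp
  have "1 * 1 * 1 \<le> real n * real d * r\<^sup>2" using n d r_ge by (intro mult_mono) auto
  then have w: "4 \<le> 4 * (real n * real d * r\<^sup>2)" by simp
  have "4 * (real n * real d * r\<^sup>2) * 1 \<le> 4 * (real n * real d * r\<^sup>2) * (1 / e)"
    using e w by (intro mult_left_mono) auto
  then have "4 \<le> 4 * (real n * real d * r\<^sup>2) * (1 / e)" using w by linarith
  then have x4: "4 \<le> ?x" by simp
  have "real (nat \<lceil>?x\<rceil>) \<le> ?x + 1" using x4 by linarith
  then have "real (nat \<lceil>?x\<rceil>) * real m \<le> (?x + 1) * real m" using m1 by (intro mult_right_mono) auto
  then have "real (iteration_bound e) \<le> 1 + (?x + 1) * real m" by (simp add: iteration_bound_def)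
  also have "\<dots> \<le> real m + (?x + 1) * real m" using m1 by simp
  also have "\<dots> = (?x + 2) * real m" by (simp add: algebra_simps)
  also have "\<dots> \<le> (2 * ?x) * real m"
  proof (rule mult_right_mono)
    have "x + 2 \<le> 2 * x" if "4 \<le> x" for x :: real using that by linarith
    from this[OF x4] show "?x + 2 \<le> 2 * ?x" .
  qed simp
  also have "\<dots> = real d * (8 * real n * r\<^sup>2 * real m / e)" by simp
  also have "\<dots> \<le> real n * (8 * real n * r\<^sup>2 * real m / e)" using dn e by (intro mult_right_mono) auto
  also have "\<dots> = 8 * (real n)\<^sup>2 * r\<^sup>2 * real m / e" by (simp add: power2_eq_square)
  finally show ?thesis .
qed

text \<open>By \<open>k \<le> 2 ^ n\<close> the bound at this scale exceeds the deterministic one,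
  so \<open>n ^ 2\<close> halvings of \<open>e\<close> suffice.\<close>

lemma iteration_bound_ge: "k ^ n + 1 \<le> iteration_bound ((1 / 2) ^ (n\<^sup>2))"
proof -
  let ?e = "(1 / 2) ^ (n\<^sup>2) :: real"
  let ?x = "4 * real n * real d * r\<^sup>2 / ?e"
  have "1 * 1 * 1 \<le> real n * real d * r\<^sup>2" using n d r_ge by (intro mult_mono) auto
  then have "1 * 2 ^ (n\<^sup>2) \<le> (4 * (real n * real d * r\<^sup>2)) * 2 ^ (n\<^sup>2)" by (intro mult_right_mono) auto
  also have "\<dots> = ?x" by (simp add: power_one_over)
  also have "?x \<le> real (nat \<lceil>?x\<rceil>)" by (rule real_nat_ceiling_ge)
  finally have "real (2 ^ (n\<^sup>2)) \<le> real (nat \<lceil>?x\<rceil>)" by simp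
  then have x: "2 ^ (n\<^sup>2) \<le> nat \<lceil>?x\<rceil>" by (simp only: of_nat_le_iff)
  have "k \<le> 2 ^ n" using kn less_exp[of n] by linarith
  then have "k ^ n \<le> (2 ^ n) ^ n" by (rule power_mono) simp
  also have "\<dots> = 2 ^ (n\<^sup>2)" by (simp add: power_mult[symmetric] power2_eq_square)
  also have "\<dots> \<le> nat \<lceil>?x\<rceil> * 1" using x by simp
  also have "\<dots> \<le> nat \<lceil>?x\<rceil> * m" using m_ge by (intro mult_left_mono) auto
  finally show ?thesis by (simp add: iteration_bound_def)
qed

text \<open>Halving \<open>e\<close> doubles the estimate of the iteration bound and halves that of
  the failure probability, so all \<open>n ^ 2\<close> dyadic scales contribute the same amount,
  proportional to \<open>m ^ 3 * K ^ 2\<close>. The bad events are covered by measurable sets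
  \<open>A i\<close>, which makes the dominating function \<open>?g\<close> measurable.\<close>

lemma expected_iterations_le:
  "(\<integral>\<^sup>+ X. ennreal_of_enat (kmeans_iterations d n k X c0) \<partial>PP) \<le> ennreal (76 * (real n + 1) ^ 4 * r\<^sup>2 * real m ^ 3 * K\<^sup>2)"
proof -
  define e where "e = (\<lambda>i::nat. (1 / 2) ^ i :: real)"
  define I where "I = n\<^sup>2"
  define W where "W = k ^ n + 1"
  define Q where "Q = 4 * K\<^sup>2 * (real m)\<^sup>2"
  define tail where "tail = real n * (real d * (2 * exp (- (4 * real n)\<^sup>2 / 4)))"
  have e01: "0 < e i" "e i \<le> 1" for i by (auto simp: e_def power_le_one)
  have Q0: "0 \<le> Q" by (simp add: Q_def)
  have t0: "0 \<le> tail" by (simp add: tail_def)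
  have "\<forall>i. \<exists>A. A \<in> sets PP \<and> {X \<in> space PP. bounded_by n d R X \<and> \<not> kmeans_iterations d n k X c0 \<le> enat (iteration_bound (e i))} \<subseteq> A \<and>
     emeasure PP A \<le> ennreal (Q * e i)"
    using bad_event_bound[OF e01] unfolding outer_le_def Q_def by blast
  from choice[OF this] obtain A where "\<forall>i. A i \<in> sets PP \<and>
     {X \<in> space PP. bounded_by n d R X \<and> \<not> kmeans_iterations d n k X c0 \<le> enat (iteration_bound (e i))} \<subseteq> A i \<and>
     emeasure PP (A i) \<le> ennreal (Q * e i)" by (elim exE)
  then have A: "\<And>i. A i \<in> sets PP"
    "\<And>i. {X \<in> space PP. bounded_by n d R X \<and> \<not> kmeans_iterations d n k X c0 \<le> enat (iteration_bound (e i))} \<subseteq> A i"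
    "\<And>i. emeasure PP (A i) \<le> ennreal (Q * e i)" by (blast, blast, blast)
  have "outer_le PP (\<lambda>X. \<not> bounded_by n d R X) tail"
    unfolding R_def tail_def by (rule outer_le_not_bounded[OF \<mu>]) auto
  then obtain B where B: "B \<in> sets PP" "{X \<in> space PP. \<not> bounded_by n d R X} \<subseteq> B" "emeasure PP B \<le> ennreal tail"
    unfolding outer_le_def by blast
  have it_W: "kmeans_iterations d n k X c0 \<le> enat W" for X
  proof -
    interpret kr: kmeans_run d n k X c0 by standard (rule k)
    show ?thesis using kr.stops_exponential kr.iterations_le unfolding W_def by blast
  qed
  have of_enat_le: "ennreal_of_enat x \<le> ennreal (real y)" if "x \<le> enat y" for x y
  proof -
    have "ennreal_of_enat x \<le> ennreal_of_enat (enat y)" using that by (simp only: ennreal_of_enat_le_iff)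
    then show ?thesis by (simp add: ennreal_of_nat_eq_real_of_nat)
  qed
  have le_add: "x \<le> x + y" "x \<le> y + x" for x y :: ennreal
    using add_left_mono[of 0 y x] add_right_mono[of 0 y x] by simp_all
  let ?f = "\<lambda>X. ennreal_of_enat (kmeans_iterations d n k X c0)"
  \<comment> \<open>A base level, one term per scale on the set covering the failure of the bound
    for \<open>e i\<close>, and the deterministic bound on a set covering the point sets outside the
    box.\<close>
  let ?g = "\<lambda>X. ennreal (real (iteration_bound (e 0))) + (\<Sum>i<I. ennreal (real (iteration_bound (e (Suc i)))) * indicator (A i) X) + ennreal (real W) * indicator B X"
  have "?f X \<le> ?g X" if X: "X \<in> space PP" for X
  proof (cases "X \<in> B")
    case True
    then have "?f X \<le> ennreal (real W) * indicator B X" using of_enat_le[OF it_W] by simp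
    also have "\<dots> \<le> ?g X" by (rule le_add(2))
    finally show ?thesis .
  next
    case False
    then have bd: "bounded_by n d R X" using B(2) X by blast
    have ex: "kmeans_iterations d n k X c0 \<le> enat (iteration_bound (e I))"
      using order_trans[OF it_W, of "enat (iteration_bound (e I))"] iteration_bound_ge by (simp add: W_def e_def I_def)
    define i where "i = (LEAST i. kmeans_iterations d n k X c0 \<le> enat (iteration_bound (e i)))"
    have i: "kmeans_iterations d n k X c0 \<le> enat (iteration_bound (e i))" unfolding i_def by (rule LeastI[of _ I]) (rule ex)
    have iI: "i \<le> I" unfolding i_def by (rule Least_le) (rule ex)
    show ?thesis
    proof (cases i)
      case 0
      then have "?f X \<le> ennreal (real (iteration_bound (e 0)))" using of_enat_le[OF i] by simp
      also have "\<dots> \<le> ?g X" unfolding add.assoc by (rule le_add(1))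
      finally show ?thesis .
    next
      case (Suc i')
      then have "\<not> kmeans_iterations d n k X c0 \<le> enat (iteration_bound (e i'))" 
        using not_less_Least[of i' "\<lambda>i. kmeans_iterations d n k X c0 \<le> enat (iteration_bound (e i))"] unfolding i_def by simp
      \<comment> \<open>By minimality of \<open>i\<close> the bound for \<open>e i'\<close> fails,
        so the valid bound of the next scale is charged to \<open>A i'\<close>.\<close>
      then have "X \<in> A i'" using A(2)[of i'] X bd by blast
      then have "?f X \<le> ennreal (real (iteration_bound (e (Suc i')))) * indicator (A i') X" using of_enat_le[OF i] Suc by simp
      also have "\<dots> \<le> (\<Sum>i<I. ennreal (real (iteration_bound (e (Suc i)))) * indicator (A i) X)"
        using Suc iI by (intro member_le_sum[where f="\<lambda>i. ennreal (real (iteration_bound (e (Suc i)))) * indicator (A i) X"]) auto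
      also have "\<dots> \<le> ennreal (real (iteration_bound (e 0))) + (\<Sum>i<I. ennreal (real (iteration_bound (e (Suc i)))) * indicator (A i) X)"
        by (rule le_add(2))
      also have "\<dots> \<le> ?g X" by (rule le_add(1))
      finally show ?thesis .
    qed
  qed
  then have "(\<integral>\<^sup>+X. ?f X \<partial>PP) \<le> (\<integral>\<^sup>+X. ?g X \<partial>PP)" by (rule nn_integral_mono)
  also have "\<dots> = ennreal (real (iteration_bound (e 0))) + (\<Sum>i<I. ennreal (real (iteration_bound (e (Suc i)))) * emeasure PP (A i)) + ennreal (real W) * emeasure PP B"
  proof -
    have mA: "(\<lambda>X. ennreal (real (iteration_bound (e (Suc i)))) * indicator (A i) X) \<in> borel_measurable PP" for i using A(1) by measurable
    have mB: "(\<lambda>X. ennreal (real W) * indicator B X) \<in> borel_measurable PP" using B(1) by measurable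
    have mS: "(\<lambda>X. \<Sum>i<I. ennreal (real (iteration_bound (e (Suc i)))) * indicator (A i) X) \<in> borel_measurable PP"
      by (intro borel_measurable_sum mA)
    have "(\<integral>\<^sup>+X. ?g X \<partial>PP) = (\<integral>\<^sup>+X. ennreal (real (iteration_bound (e 0))) + (\<Sum>i<I. ennreal (real (iteration_bound (e (Suc i)))) * indicator (A i) X) \<partial>PP)
       + (\<integral>\<^sup>+X. ennreal (real W) * indicator B X \<partial>PP)"
      by (intro nn_integral_add borel_measurable_add borel_measurable_const mS mB)
    also have "(\<integral>\<^sup>+X. ennreal (real (iteration_bound (e 0))) + (\<Sum>i<I. ennreal (real (iteration_bound (e (Suc i)))) * indicator (A i) X) \<partial>PP)
       = (\<integral>\<^sup>+X. ennreal (real (iteration_bound (e 0))) \<partial>PP) + (\<integral>\<^sup>+X. (\<Sum>i<I. ennreal (real (iteration_bound (e (Suc i)))) * indicator (A i) X) \<partial>PP)"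
      by (intro nn_integral_add borel_measurable_const mS)
    also have "(\<integral>\<^sup>+X. (\<Sum>i<I. ennreal (real (iteration_bound (e (Suc i)))) * indicator (A i) X) \<partial>PP)
       = (\<Sum>i<I. \<integral>\<^sup>+X. ennreal (real (iteration_bound (e (Suc i)))) * indicator (A i) X \<partial>PP)"
      by (rule nn_integral_sum[OF mA])
    finally show ?thesis using A(1) B(1) by (simp add: nn_integral_cmult_indicator emeasure_space_1)
  qed
  also have "\<dots> \<le> ennreal (real (iteration_bound (e 0))) + (\<Sum>i<I. ennreal (real (iteration_bound (e (Suc i)))) * ennreal (Q * e i)) + ennreal (real W) * ennreal tail"
    by (intro add_mono order_refl sum_mono mult_left_mono A(3) B(3)) auto
  also have "\<dots> = ennreal (real (iteration_bound (e 0)) + (\<Sum>i<I. real (iteration_bound (e (Suc i))) * (Q * e i)) + real W * tail)"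
  proof -
    have "(\<Sum>i<I. ennreal (real (iteration_bound (e (Suc i)))) * ennreal (Q * e i)) = ennreal (\<Sum>i<I. real (iteration_bound (e (Suc i))) * (Q * e i))"
      using Q0 e01(1)[THEN less_imp_le] by (subst sum_ennreal[symmetric]) (auto simp: ennreal_mult)
    moreover have "0 \<le> (\<Sum>i<I. real (iteration_bound (e (Suc i))) * (Q * e i))"
      using Q0 e01(1)[THEN less_imp_le] by (intro sum_nonneg) auto
    ultimately show ?thesis using t0 by (simp add: ennreal_mult[symmetric])
  qed
  also have "\<dots> \<le> ennreal (76 * (real n + 1) ^ 4 * r\<^sup>2 * real m ^ 3 * K\<^sup>2)"
  proof (rule ennreal_leI)
    have m1: "1 \<le> real m" using m_ge by simp
    have K1: "1 \<le> K" using K_ge[of 0 0 0] by simp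
    let ?G = "8 * (real n)\<^sup>2 * r\<^sup>2 * real m"
    have F0: "real (iteration_bound (e 0)) \<le> ?G" using iteration_bound_le[OF e01, of 0] by (simp add: e_def)
    have "real (iteration_bound (e (Suc i))) * (Q * e i) \<le> 2 * ?G * Q" for i
    proof -
      have "real (iteration_bound (e (Suc i))) * (Q * e i) \<le> (?G / e (Suc i)) * (Q * e i)"
        using iteration_bound_le[OF e01, of "Suc i"] Q0 e01(1)[of i] by (intro mult_right_mono) auto
      also have "\<dots> = 2 * ?G * Q" using e01(1)[of i] by (simp add: e_def)
      finally show ?thesis .
    qed
    then have "(\<Sum>i<I. real (iteration_bound (e (Suc i))) * (Q * e i)) \<le> (\<Sum>i<I. 2 * ?G * Q)" by (intro sum_mono)
    also have "\<dots> = (real n)\<^sup>2 * (2 * ?G * Q)" by (simp add: I_def)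
    also have "\<dots> = 64 * (real n ^ 4 * (r\<^sup>2 * (real m ^ 3 * K\<^sup>2)))"
      by (simp add: Q_def eval_nat_numeral)
    finally have S: "(\<Sum>i<I. real (iteration_bound (e (Suc i))) * (Q * e i)) \<le> 64 * (real n ^ 4 * (r\<^sup>2 * (real m ^ 3 * K\<^sup>2)))" .
    \<comment> \<open>\<open>real W\<close> is at most 2 * exp (n^2) and \<open>n * d\<close> at
      most exp (n^2), so the factor exp (- 4 * n^2) of the tail outweighs both.\<close>
    have WT: "real W * tail \<le> 4"
    proof -
      have ex: "x \<le> exp x" for x :: real using exp_ge_add_one_self[of x] by linarith
      have e2: "(2::real) \<le> exp 1" using exp_ge_add_one_self[of 1] by simp
      have "k \<le> 2 ^ n" using kn less_exp[of n] by linarith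
      then have "k ^ n \<le> (2 ^ n) ^ n" by (rule power_mono) simp
      then have "k ^ n \<le> 2 ^ (n * n)" by (simp add: power_mult)
      then have "real (k ^ n) \<le> real (2 ^ (n * n))" by (rule of_nat_mono)
      also have "\<dots> = 2 ^ (n * n)" by simp
      also have "\<dots> \<le> exp 1 ^ (n * n)" using e2 by (rule power_mono) simp
      also have "\<dots> = exp ((real n)\<^sup>2)" by (simp add: exp_of_nat_mult[symmetric] power2_eq_square)
      finally have k1: "real (k ^ n) \<le> exp ((real n)\<^sup>2)" .
      have k2: "1 \<le> exp ((real n)\<^sup>2)" by simp
      have "real W \<le> 2 * exp ((real n)\<^sup>2)" 
      proof -
        have "real W = real (k ^ n) + 1" by (simp add: W_def)
        then show ?thesis using k1 k2 by linarith
      qed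
      moreover have "tail \<le> 2 * exp ((real n)\<^sup>2) * exp (- (4 * (real n)\<^sup>2))"
      proof -
        have "real n * real d \<le> real n * real n" using dn by (intro mult_left_mono) auto
        also have "\<dots> \<le> exp ((real n)\<^sup>2)" using ex[of "(real n)\<^sup>2"] by (simp add: power2_eq_square)
        finally have "real n * real d * (2 * exp (- (4 * (real n)\<^sup>2))) \<le> exp ((real n)\<^sup>2) * (2 * exp (- (4 * (real n)\<^sup>2)))"
          by (intro mult_right_mono) auto
        then show ?thesis by (simp add: tail_def power_mult_distrib mult_ac)
      qed
      ultimately have "real W * tail \<le> (2 * exp ((real n)\<^sup>2)) * (2 * exp ((real n)\<^sup>2) * exp (- (4 * (real n)\<^sup>2)))"
        using t0 by (intro mult_mono) auto
      also have "\<dots> = 4 * exp ((real n)\<^sup>2 + (real n)\<^sup>2 + - (4 * (real n)\<^sup>2))" by (simp only: exp_add)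
      also have "\<dots> \<le> 4 * 1" by (intro mult_left_mono) auto
      finally show ?thesis by simp
    qed
    let ?Z = "(real n + 1) ^ 4 * (r\<^sup>2 * (real m ^ 3 * K\<^sup>2))"
    have r1: "1 \<le> r\<^sup>2" using r_ge by simp
    have mm: "real m \<le> real m ^ 3 * K\<^sup>2"
    proof -
      have "real m ^ 1 * 1 \<le> real m ^ 3 * K\<^sup>2" using m1 K1 by (intro mult_mono power_increasing) auto
      then show ?thesis by simp
    qed
    have "(real n)\<^sup>2 \<le> (real n + 1)\<^sup>2" by (rule power_mono) auto
    also have "\<dots> \<le> (real n + 1) ^ 4" by (rule power_increasing) auto
    finally have "(real n)\<^sup>2 * (r\<^sup>2 * real m) \<le> ?Z" using mm r1 m1 by (intro mult_mono mult_nonneg_nonneg) auto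
    then have G: "?G \<le> 8 * ?Z" by simp
    have S': "64 * (real n ^ 4 * (r\<^sup>2 * (real m ^ 3 * K\<^sup>2))) \<le> 64 * ?Z"
      using r1 m1 by (intro mult_left_mono mult_right_mono power_mono) auto
    have "1 * (1 * (1 * 1)) \<le> ?Z" using r1 m1 K1 by (intro mult_mono) auto
    then have Z1: "4 \<le> 4 * ?Z" by simp
    \<comment> \<open>76 = 8 + 64 + 4: base level, dyadic scales with 64 = 2 * 8 * 4, and
      tail.\<close>
    have "real (iteration_bound (e 0)) + (\<Sum>i<I. real (iteration_bound (e (Suc i))) * (Q * e i)) + real W * tail \<le> 76 * ?Z"
      using F0 G S S' WT Z1 by linarith
    then show "real (iteration_bound (e 0)) + (\<Sum>i<I. real (iteration_bound (e (Suc i))) * (Q * e i)) + real W * tail \<le> 76 * (real n + 1) ^ 4 * r\<^sup>2 * real m ^ 3 * K\<^sup>2"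
      by (simp add: mult.assoc)
  qed
  finally show ?thesis .
qed

end

section \<open>Absorbing exponential factors into the power of k\<close>

text \<open>For \<open>k\<close> at least the square of \<open>A\<close>, the base \<open>A\<close>
  is at most the square root of \<open>k\<close>, so \<open>A ^ k\<close> uses about half of the
  exponent and 3/8 are left for the other factor. For the finitely many smaller \<open>k\<close>,
  \<open>A ^ k\<close> is below a constant.\<close>

lemma power_absorb:
  fixes A :: nat
  assumes "1 \<le> A" "0 < k"
  shows "A ^ k * k ^ (3 * (k div 8)) \<le> A ^ (A\<^sup>2) * k ^ k"
proof (cases "A\<^sup>2 \<le> k")
  case True
  define h where "h = (k + 1) div 2"
  have "A ^ k \<le> A ^ (2 * h)" using assms by (intro power_increasing) (auto simp: h_def)
  also have "\<dots> = (A\<^sup>2) ^ h" by (rule power_mult)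
  also have "\<dots> \<le> k ^ h" using True by (rule power_mono) simp
  finally have "A ^ k * k ^ (3 * (k div 8)) \<le> k ^ h * k ^ (3 * (k div 8))" by (rule mult_right_mono) simp
  also have "\<dots> = k ^ (h + 3 * (k div 8))" by (simp add: power_add)
  also have "\<dots> \<le> k ^ k"
  proof (rule power_increasing)
    have "8 * (k div 8) \<le> k" "2 * h \<le> k + 1" by (simp_all add: h_def)
    then show "h + 3 * (k div 8) \<le> k" by linarith
  qed (use assms in auto)
  also have "\<dots> \<le> A ^ (A\<^sup>2) * k ^ k" using assms by simp
  finally show ?thesis .
next
  case False
  then have "A ^ k \<le> A ^ (A\<^sup>2)" using assms by (intro power_increasing) auto
  moreover have "k ^ (3 * (k div 8)) \<le> k ^ k" using assms by (intro power_increasing) auto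
  ultimately show ?thesis by (intro mult_mono) auto
qed

theorem theorem2:
  shows "\<exists>(D::nat) (p::nat \<Rightarrow> nat \<Rightarrow> real).
    \<forall>(n::nat) (k::nat) (d::nat) (\<sigma>::real) (\<mu>::nat \<Rightarrow> vec) (c0::nat \<Rightarrow> vec).
      0 < n \<and> 0 < k \<and> 0 < d \<and> k \<le> n \<and> d \<le> n \<and> 0 < \<sigma> \<and>
      (\<forall>j<n. \<forall>l<d. 0 \<le> \<mu> j l \<and> \<mu> j l \<le> 1) \<longrightarrow>
      (\<integral>\<^sup>+ X. ennreal_of_enat (kmeans_iterations d n k X c0) \<partial>(perturbed_points n d \<sigma> \<mu>))
        \<le> ennreal (real k ^ (k * d) *
             (\<Sum>a\<le>D. \<Sum>b\<le>D. p a b * real n ^ a * (1 / \<sigma>) ^ b))"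
proof -
  \<comment> \<open>45 = 1 + 44: the \<open>8 ^ k\<close> in \<open>m ^ 3\<close> and the
    \<open>8 ^ (44 * k)\<close> in the square of \<open>K\<close>.\<close>
  define A :: nat where "A = 8 ^ 45"
  define T where "T = real (A ^ (A\<^sup>2))"
  define C where "C = 76 * 4000000\<^sup>2 * 2 ^ 360 * 5 ^ 10 * 2 ^ 10 * T"
  have T0: "0 \<le> T" unfolding T_def by (rule of_nat_0_le_iff)
  \<comment> \<open>The coefficient table of \<open>C * x ^ 376 * (1 + y ^ 10)\<close>.\<close>
  define p where "p = (\<lambda>a b::nat. if a = (376::nat) \<and> (b = 0 \<or> b = 10) then C else 0)"
  have p_sum: "(\<Sum>a\<le>376. \<Sum>b\<le>376. p a b * x ^ a * y ^ b) = C * x ^ 376 * (1 + y ^ 10)" for x y :: real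
  proof -
    have "(\<Sum>a\<le>376. \<Sum>b\<le>376. p a b * x ^ a * y ^ b) = (\<Sum>a\<in>{376}. \<Sum>b\<le>376. p a b * x ^ a * y ^ b)"
      by (rule sum.mono_neutral_right) (auto simp: p_def)
    also have "\<dots> = (\<Sum>a\<in>{376}. \<Sum>b\<in>{0, 10}. p a b * x ^ a * y ^ b)"
      by (intro sum.cong refl sum.mono_neutral_right) (auto simp: p_def)
    also have "\<dots> = C * x ^ 376 * (1 + y ^ 10)" by (simp add: p_def algebra_simps)
    finally show ?thesis .
  qed
  show ?thesis
  proof (intro exI[of _ 376] exI[of _ p] allI impI)
    fix n k d :: nat and \<sigma> :: real and \<mu> c0 :: "nat \<Rightarrow> vec"
    assume H: "0 < n \<and> 0 < k \<and> 0 < d \<and> k \<le> n \<and> d \<le> n \<and> 0 < \<sigma> \<and> (\<forall>j<n. \<forall>l<d. 0 \<le> \<mu> j l \<and> \<mu> j l \<le> 1)"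
    interpret S: smoothed_kmeans n d \<sigma> \<mu> k c0 by unfold_locales (use H in auto)
    define y where "y = 1 / \<sigma>"
    have y0: "0 \<le> y" using H by (simp add: y_def)
    have n1: "1 \<le> real n" using H by simp
    have r: "S.r ^ 10 \<le> (5 * real n) ^ 10 * (2 ^ 10 * (1 + y ^ 10))"
    proof -
      have "S.r \<le> 5 * real n * (1 + y)"
      proof -
        have "y * 1 \<le> y * (5 * real n)" using n1 y0 by (intro mult_left_mono) auto
        then show ?thesis unfolding S.r_def y_def[symmetric] using n1 by (simp add: algebra_simps)
      qed
      then have "S.r ^ 10 \<le> (5 * real n * (1 + y)) ^ 10" using S.r_ge by (intro power_mono) auto
      also have "\<dots> = (5 * real n) ^ 10 * (1 + y) ^ 10" by (rule power_mult_distrib)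
      also have "(1 + y) ^ 10 \<le> 2 ^ 10 * (1 + y ^ 10)"
      proof (cases "y \<le> 1")
        case True
        then have "(1 + y) ^ 10 \<le> 2 ^ 10" using y0 by (intro power_mono) auto
        also have "\<dots> \<le> 2 ^ 10 * (1 + y ^ 10)" using y0 by simp
        finally show ?thesis .
      next
        case False
        then have "(1 + y) ^ 10 \<le> (2 * y) ^ 10" using y0 by (intro power_mono) auto
        also have "\<dots> = 2 ^ 10 * y ^ 10" by (rule power_mult_distrib)
        also have "\<dots> \<le> 2 ^ 10 * (1 + y ^ 10)" by simp
        finally show ?thesis .
      qed
      finally show ?thesis by (simp add: mult_left_mono)
    qed
    have N: "real n + 1 \<le> 2 * real n" using n1 by simp
    have kk: "real (A ^ k * k ^ (3 * (k div 8))) \<le> T * real k ^ (k * d)"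
    proof -
      have "A ^ k * k ^ (3 * (k div 8)) \<le> A ^ (A\<^sup>2) * k ^ k" using H by (intro power_absorb) (auto simp: A_def)
      \<comment> \<open>The bound for the expectation does not involve \<open>d\<close>; passing
        from \<open>k\<close> to \<open>k * d\<close> in the exponent weakens it.\<close>
      also have "\<dots> \<le> A ^ (A\<^sup>2) * k ^ (k * d)" using H by (intro mult_left_mono power_increasing) auto
      finally have "real (A ^ k * k ^ (3 * (k div 8))) \<le> real (A ^ (A\<^sup>2) * k ^ (k * d))" by (rule of_nat_mono)
      then show ?thesis unfolding T_def by (simp only: of_nat_mult of_nat_power)
    qed
    have m3: "real S.m ^ 3 = real k ^ 6 * (real k ^ (3 * (k div 8)) * 8 ^ k)"
    proof -
      have "S.b * 3 = 6 + 3 * (k div 8)" by (simp add: S.b_def)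
      then have "(real k ^ S.b) ^ 3 = real k ^ 6 * real k ^ (3 * (k div 8))"
        by (simp only: power_mult[symmetric] power_add)
      moreover have "((2::real) ^ k) ^ 3 = 8 ^ k"
      proof -
        have "((2::real) ^ k) ^ 3 = (2 ^ 3) ^ k" by (simp only: power_mult[symmetric] mult.commute)
        then show ?thesis by simp
      qed
      ultimately show ?thesis by (simp add: S.m_def power_mult_distrib mult.assoc)
    qed
    have K2: "S.K\<^sup>2 = 4000000\<^sup>2 * ((real n + 1) ^ 356 * (8 ^ (44 * k) * S.r ^ 8))"
    proof -
      have "((real n + 1) ^ 178)\<^sup>2 = (real n + 1) ^ 356" "((8::real) ^ (22 * k))\<^sup>2 = 8 ^ (44 * k)" "(S.r ^ 4)\<^sup>2 = S.r ^ 8"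
        by (simp_all add: power_mult[symmetric])
      then show ?thesis unfolding S.K_def power_mult_distrib by (simp only: mult.assoc)
    qed
    have e8: "(8::real) ^ k * 8 ^ (44 * k) = real A ^ k"
    proof -
      have "real A = 8 ^ 45" by (simp only: A_def of_nat_power of_nat_numeral)
      then have "real A ^ k = 8 ^ (45 * k)" by (simp only: power_mult)
      moreover have "45 * k = k + 44 * k" by simp
      ultimately show ?thesis by (simp only: power_add)
    qed
    have e10: "S.r\<^sup>2 * S.r ^ 8 = S.r ^ 10" by (simp only: power_add[symmetric]) simp
    have e360: "(real n + 1) ^ 4 * (real n + 1) ^ 356 = (real n + 1) ^ 360" by (simp only: power_add[symmetric]) simp
    have "76 * (real n + 1) ^ 4 * S.r\<^sup>2 * real S.m ^ 3 * S.K\<^sup>2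
       = 76 * 4000000\<^sup>2 * (((real n + 1) ^ 4 * (real n + 1) ^ 356) * (real k ^ 6 * ((S.r\<^sup>2 * S.r ^ 8) * ((8 ^ k * 8 ^ (44 * k)) * real k ^ (3 * (k div 8))))))"
      unfolding m3 K2 by (simp only: mult_ac)
    also have "\<dots> = 76 * 4000000\<^sup>2 * ((real n + 1) ^ 360 * (real k ^ 6 * (S.r ^ 10 * real (A ^ k * k ^ (3 * (k div 8))))))"
      by (simp only: e8 e10 e360 of_nat_mult of_nat_power)
    \<comment> \<open>376 = 360 + 6 + 10: the powers of \<open>n + 1\<close>, the factor
      \<open>k ^ 6\<close> left over from \<open>m ^ 3\<close>, and \<open>r ^ 10\<close> with
      \<open>r\<close> at most \<open>5 * n * (1 + y)\<close>.\<close>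
    also have "\<dots> \<le> 76 * 4000000\<^sup>2 * ((2 * real n) ^ 360 * (real n ^ 6 * (((5 * real n) ^ 10 * (2 ^ 10 * (1 + y ^ 10))) * (T * real k ^ (k * d)))))"
    proof (intro mult_left_mono mult_mono r kk)
      show "(real n + 1) ^ 360 \<le> (2 * real n) ^ 360" using N by (rule power_mono) simp
      show "real k ^ 6 \<le> real n ^ 6" using H by (intro power_mono) auto
    qed (use y0 S.r_ge T0 in \<open>auto intro!: mult_nonneg_nonneg\<close>)
    also have "\<dots> = real k ^ (k * d) * (C * ((real n ^ 360 * real n ^ 6) * real n ^ 10) * (1 + y ^ 10))"
      unfolding C_def power_mult_distrib by (simp only: mult_ac)
    also have "(real n ^ 360 * real n ^ 6) * real n ^ 10 = real n ^ 376"
      by (simp only: power_add[symmetric]) simp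
    finally have bound: "76 * (real n + 1) ^ 4 * S.r\<^sup>2 * real S.m ^ 3 * S.K\<^sup>2 \<le> real k ^ (k * d) * (C * real n ^ 376 * (1 + y ^ 10))" .
    show "(\<integral>\<^sup>+ X. ennreal_of_enat (kmeans_iterations d n k X c0) \<partial>(perturbed_points n d \<sigma> \<mu>))
        \<le> ennreal (real k ^ (k * d) * (\<Sum>a\<le>376. \<Sum>b\<le>376. p a b * real n ^ a * (1 / \<sigma>) ^ b))"
      unfolding p_sum using order_trans[OF S.expected_iterations_le ennreal_leI[OF bound]] by (simp only: y_def)
  qed
qed

end
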